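(* Let $\Phi$ be a polynomial time computable implicit set system and let $b,c\ge 1$ be constants. If there is an algorithm for $\Phi$-Extension with running time $b^{n-|X|}c^{k}N^{O(1)}$, then there is a deterministic algorithm for $\Phi$-Subset with running time $\left(1+b-\frac{1}{c}\right)^{n+o(n)}N^{O(1)}$.
   Context: An implicit set system is a function $\Phi$ that takes as input a string $I\in\{0,1\}^*$ (an instance) and outputs a set system $(U_I,\mathcal{F}_I)$, where $U_I$ is a finite universe and $\mathcal{F}_I$ is a collection of subsets of $U_I$. Write $n=|U_I|$ and $N=|I|$, and assume $N\ge n$. $\Phi$ is polynomial time computable if $U_I$ can be computed from $I$ in polynomial time and, given $I$, $U_I$ and $S\subseteq U_I$, membership $S\in\mathcal{F}_I$ can be decided in polynomial time. The problem $\Phi$-Subset: given an instance $I$, output a set $S\in\mathcal{F}_I$ if one exists. The problem $\Phi$-Extension: given an instance $I$, a set $X\subseteq U_I$ and an integer $k$, decide whether there exists $S\subseteq U_I\setminus X$ with $S\cup X\in\mathcal{F}_I$ and $|S|\le k$. *)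

theory Defs
  imports Complex_Main "HOL-Library.Landau_Symbols"
begin

text \<open>
  Algorithms are programs of the WHILE language of N. D. Jones (Computability and Complexity from
  a Programming Perspective), extended with a conditional. Data are binary trees, and the cost
  counts elementary operations on cons cells. Trees can share subtrees, so copying a
  variable is one pointer operation. A logarithmic-cost RAM and this model simulate each other
  with an overhead per step that is polynomial in the logarithm of the running time, hence
  polynomial in the input length for single-exponential algorithms.
\<close>

datatype tree = Leaf | Node tree tree

fun hd_tree :: "tree \<Rightarrow> tree" where
  "hd_tree Leaf = Leaf"
| "hd_tree (Node x y) = x"

fun tl_tree :: "tree \<Rightarrow> tree" where
  "tl_tree Leaf = Leaf"
| "tl_tree (Node x y) = y"

datatype expr = Var nat | LeafE | NodeE expr expr | HdE expr | TlE expr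

type_synonym store = "nat \<Rightarrow> tree"

fun eval_expr :: "expr \<Rightarrow> store \<Rightarrow> tree" where
  "eval_expr (Var i) s = s i"
| "eval_expr LeafE s = Leaf"
| "eval_expr (NodeE e f) s = Node (eval_expr e s) (eval_expr f s)"
| "eval_expr (HdE e) s = hd_tree (eval_expr e s)"
| "eval_expr (TlE e) s = tl_tree (eval_expr e s)"

fun cost_expr :: "expr \<Rightarrow> nat" where
  "cost_expr (Var i) = 1"
| "cost_expr LeafE = 1"
| "cost_expr (NodeE e f) = 1 + cost_expr e + cost_expr f"
| "cost_expr (HdE e) = 1 + cost_expr e"
| "cost_expr (TlE e) = 1 + cost_expr e"

datatype program =
    Assign nat expr
  | Seq program program
  | Cond expr program program
  | While expr program

text \<open>\<open>exec p s t s'\<close>: started in \<open>s\<close>, program \<open>p\<close> halts in \<open>s'\<close> after \<open>t\<close> steps.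
  The tree \<^const>\<open>Leaf\<close> counts as false, every other tree as true.\<close>

inductive exec :: "program \<Rightarrow> store \<Rightarrow> nat \<Rightarrow> store \<Rightarrow> bool" where
  Assign: "exec (Assign i e) s (1 + cost_expr e) (s(i := eval_expr e s))"
| Seq: "exec p s t s' \<Longrightarrow> exec q s' u s'' \<Longrightarrow> exec (Seq p q) s (1 + t + u) s''"
| CondTrue: "eval_expr e s \<noteq> Leaf \<Longrightarrow> exec p s t s' \<Longrightarrow> exec (Cond e p q) s (1 + cost_expr e + t) s'"
| CondFalse: "eval_expr e s = Leaf \<Longrightarrow> exec q s t s' \<Longrightarrow> exec (Cond e p q) s (1 + cost_expr e + t) s'"
| WhileFalse: "eval_expr e s = Leaf \<Longrightarrow> exec (While e p) s (1 + cost_expr e) s"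
| WhileTrue: "eval_expr e s \<noteq> Leaf \<Longrightarrow> exec p s t s' \<Longrightarrow> exec (While e p) s' u s''
    \<Longrightarrow> exec (While e p) s (1 + cost_expr e + t + u) s''"

inductive_cases AssignE: "exec (Assign i e) s t s'"
inductive_cases SeqE: "exec (Seq p q) s t s'"
inductive_cases CondE: "exec (Cond e p q) s t s'"
inductive_cases WhileE: "exec (While e p) s t s'"

lemma exec_deterministic:
  "exec p s t s' \<Longrightarrow> exec p s u s'' \<Longrightarrow> u = t \<and> s'' = s'"
proof (induction arbitrary: u s'' rule: exec.induct)
  case (Assign i e s)
  then show ?case by (auto elim: AssignE)
next
  case (Seq p s t s' q u s'' v r)
  from Seq.prems show ?case by (rule SeqE) (auto dest!: Seq.IH)
next
  case (CondTrue e s p t s' q)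
  from CondTrue.prems CondTrue.hyps show ?case by (auto elim!: CondE dest!: CondTrue.IH)
next
  case (CondFalse e s q t s' p)
  from CondFalse.prems CondFalse.hyps show ?case by (auto elim!: CondE dest!: CondFalse.IH)
next
  case (WhileFalse e s p)
  from WhileFalse.prems WhileFalse.hyps show ?case by (rule_tac WhileE) auto
next
  case (WhileTrue e s p t s' u s'' v r)
  from WhileTrue.prems show ?case
    by (rule WhileE) (use WhileTrue.hyps in \<open>auto dest!: WhileTrue.IH\<close>)
qed

text \<open>Input and output are in variable 0; all other variables are initially \<^const>\<open>Leaf\<close>.\<close>

definition computes :: "program \<Rightarrow> tree \<Rightarrow> tree \<Rightarrow> nat \<Rightarrow> bool" where
  "computes p x y t \<longleftrightarrow> (\<exists>s. exec p ((\<lambda>i. Leaf)(0 := x)) t s \<and> s 0 = y)"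


type_synonym bitstring = "bool list"

fun enc_bool :: "bool \<Rightarrow> tree" where
  "enc_bool False = Leaf"
| "enc_bool True = Node Leaf Leaf"

fun enc_list :: "('a \<Rightarrow> tree) \<Rightarrow> 'a list \<Rightarrow> tree" where
  "enc_list f [] = Leaf"
| "enc_list f (x # xs) = Node (f x) (enc_list f xs)"

definition enc_bits :: "bitstring \<Rightarrow> tree" where
  "enc_bits = enc_list enc_bool"

text \<open>Binary digits, least significant first, without leading zeros.\<close>

fun binary :: "nat \<Rightarrow> bitstring" where
  "binary k = (if k = 0 then [] else odd k # binary (k div 2))"

declare binary.simps [simp del]

definition enc_nat :: "nat \<Rightarrow> tree" where
  "enc_nat k = enc_bits (binary k)"

text \<open>A finite set is represented by any repetition-free listing of its elements.\<close>

definition represents :: "tree \<Rightarrow> bitstring set \<Rightarrow> bool" where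
  "represents x S \<longleftrightarrow> (\<exists>xs. distinct xs \<and> set xs = S \<and> x = enc_list enc_bits xs)"


type_synonym set_system = "bitstring set \<times> bitstring set set"

abbreviation universe :: "(bitstring \<Rightarrow> set_system) \<Rightarrow> bitstring \<Rightarrow> bitstring set" where
  "universe \<Phi> I \<equiv> fst (\<Phi> I)"

abbreviation family :: "(bitstring \<Rightarrow> set_system) \<Rightarrow> bitstring \<Rightarrow> bitstring set set" where
  "family \<Phi> I \<equiv> snd (\<Phi> I)"

definition implicit_set_system :: "(bitstring \<Rightarrow> set_system) \<Rightarrow> bool" where
  "implicit_set_system \<Phi> \<longleftrightarrow>
     (\<forall>I. finite (universe \<Phi> I) \<and> family \<Phi> I \<subseteq> Pow (universe \<Phi> I) \<and>
          card (universe \<Phi> I) \<le> length I)"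

text \<open>Throughout, \<open>N\<^sup>O\<^sup>(\<^sup>1\<^sup>)\<close> is read as \<open>C * (N + 1)^d\<close> with constants \<open>C\<close> and \<open>d\<close>, which
  also makes sense for \<open>N \<le> 1\<close>.\<close>

definition poly_time_computable :: "(bitstring \<Rightarrow> set_system) \<Rightarrow> bool" where
  "poly_time_computable \<Phi> \<longleftrightarrow>
     (\<exists>p (C::real) d. \<forall>I. \<exists>y t. computes p (enc_bits I) y t \<and> represents y (universe \<Phi> I) \<and>
        real t \<le> C * real (length I + 1) ^ d) \<and>
     (\<exists>q (C::real) d. \<forall>I S u x.
        S \<subseteq> universe \<Phi> I \<longrightarrow> represents u (universe \<Phi> I) \<longrightarrow> represents x S \<longrightarrow>
        (\<exists>t. computes q (Node (enc_bits I) (Node u x)) (enc_bool (S \<in> family \<Phi> I)) t \<and>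
           real t \<le> C * real (length I + 1) ^ d))"

text \<open>A negative budget \<open>k\<close> makes every extension instance trivially negative (and \<open>c^k\<close> is then
  no meaningful time bound), so \<open>k\<close> is a natural number, given in binary.\<close>

definition solves_extension_in ::
  "(bitstring \<Rightarrow> set_system) \<Rightarrow> program \<Rightarrow> (bitstring \<Rightarrow> bitstring set \<Rightarrow> nat \<Rightarrow> real) \<Rightarrow> bool" where
  "solves_extension_in \<Phi> p T \<longleftrightarrow>
     (\<forall>I X k x. X \<subseteq> universe \<Phi> I \<longrightarrow> represents x X \<longrightarrow>
        (\<exists>t. computes p (Node (enc_bits I) (Node x (enc_nat k)))
               (enc_bool (\<exists>S. S \<subseteq> universe \<Phi> I - X \<and> S \<union> X \<in> family \<Phi> I \<and> card S \<le> k)) t \<and>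
           real t \<le> T I X k))"

text \<open>The output is \<^const>\<open>Leaf\<close> if the family is empty; the constructor \<^const>\<open>Node\<close> around a
  solution distinguishes this from the solution \<open>{}\<close>, which is itself represented by
  \<^const>\<open>Leaf\<close>.\<close>

definition solves_subset_in ::
  "(bitstring \<Rightarrow> set_system) \<Rightarrow> program \<Rightarrow> (bitstring \<Rightarrow> real) \<Rightarrow> bool" where
  "solves_subset_in \<Phi> p T \<longleftrightarrow>
     (\<forall>I. \<exists>y t. computes p (enc_bits I) y t \<and> real t \<le> T I \<and>
        (if family \<Phi> I = {} then y = Leaf
         else \<exists>S z. S \<in> family \<Phi> I \<and> represents z S \<and> y = Node Leaf z))"

end

theory Submission
  imports Defs "HOL-Library.Extended_Nat"
begin

text \<open>
  Split the universe into blocks of a constant size \<open>B\<close>. A cover of a block is a list of pairs \<open>(X, r)\<close>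
  such that every subset \<open>S\<close> of the block contains some \<open>X\<close> with \<open>r \<ge> |S - X|\<close>; its weight is
  the sum of all \<open>b\<^sup>B\<^sup>-\<^sup>|\<^sup>X\<^sup>| c\<^sup>r\<close>. Choosing one pair per block in all possible ways and asking the extension
  algorithm about each combination decides whether the family is empty, and since weights multiply, all
  queries together cost about \<open>W\<^sup>n\<^sup>/\<^sup>B\<close> for a cover of weight \<open>W\<close>. A positive query leads to a member of
  the family by self-reduction. Rounding a fractional cover shows that covers of weight
  \<open>(B + 1)\<^sup>2 (1 + b - 1 / c)\<^sup>B\<close> exist.

  The numbers \<open>b\<close> and \<open>c\<close> need not be computable, so the program cannot choose a good cover. Instead it runs
  the algorithm for all covers in parallel, with clocks of doubling length, as in Levin's universal
  search. Each fixed cover thus bounds the running time up to a constant factor and a power of the input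
  length, and letting \<open>B\<close> tend to infinity gives the exponent \<open>n + o(n)\<close>.
\<close>

section \<open>Bounded loops compiled to WHILE programs\<close>

text \<open>The base has a probabilistic origin. Let X keep each element of a solution S
  independently with probability p = 1 - 1/c. A set X that misses r elements carries a factor
  (1/c)^r, which cancels the cost c^r of the query. What remains is a factor p for each element of
  the universe inside X and b for each element outside, hence b + p = 1 + b - 1/c. Covers
  derandomize this experiment; restricting them to blocks of fixed size turns the cover into a
  constant object that a candidate number can name.

  The rounding loss (B + 1)^2 is paid once per block, so for large B it is hidden in a factor (1 +
  \<delta>) of the exponent, while an incomplete last block costs only a constant. A single o(n)
  demands one program that serves every \<delta>; this is a second reason for searching through all
  covers.

  Outputs of the search are not verified. Candidates are tested for being covers, and every cover
  yields a correct answer: validity governs correctness, weight governs time alone.\<close>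

fun ren_expr :: "(nat \<Rightarrow> nat) \<Rightarrow> expr \<Rightarrow> expr" where
  "ren_expr r (Var i) = Var (r i)"
| "ren_expr r LeafE = LeafE"
| "ren_expr r (NodeE e f) = NodeE (ren_expr r e) (ren_expr r f)"
| "ren_expr r (HdE e) = HdE (ren_expr r e)"
| "ren_expr r (TlE e) = TlE (ren_expr r e)"

fun ren :: "(nat \<Rightarrow> nat) \<Rightarrow> program \<Rightarrow> program" where
  "ren r (Assign i e) = Assign (r i) (ren_expr r e)"
| "ren r (Seq p q) = Seq (ren r p) (ren r q)"
| "ren r (Cond e p q) = Cond (ren_expr r e) (ren r p) (ren r q)"
| "ren r (While e p) = While (ren_expr r e) (ren r p)"

fun vars_expr :: "expr \<Rightarrow> nat set" where
  "vars_expr (Var i) = {i}"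
| "vars_expr LeafE = {}"
| "vars_expr (NodeE e f) = vars_expr e \<union> vars_expr f"
| "vars_expr (HdE e) = vars_expr e"
| "vars_expr (TlE e) = vars_expr e"

fun vars :: "program \<Rightarrow> nat set" where
  "vars (Assign i e) = insert i (vars_expr e)"
| "vars (Seq p q) = vars p \<union> vars q"
| "vars (Cond e p q) = vars_expr e \<union> vars p \<union> vars q"
| "vars (While e p) = vars_expr e \<union> vars p"

lemma finite_vars_expr [simp]: "finite (vars_expr e)"
  by (induction e) auto

lemma finite_vars [simp]: "finite (vars p)"
  by (induction p) auto

lemma eval_ren_expr: "(\<And>i. i \<in> vars_expr e \<Longrightarrow> u (r i) = s i) \<Longrightarrow> eval_expr (ren_expr r e) u = eval_expr e s"
  by (induction e) auto

lemma cost_ren_expr [simp]: "cost_expr (ren_expr r e) = cost_expr e"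
  by (induction e) auto

lemma exec_Assign: "t = 1 + cost_expr e \<Longrightarrow> s' = s(i := eval_expr e s) \<Longrightarrow> exec (Assign i e) s t s'"
  using exec.Assign by simp

lemma exec_Seq: "exec p s t s' \<Longrightarrow> exec q s' u s'' \<Longrightarrow> v = 1 + t + u \<Longrightarrow> exec (Seq p q) s v s''"
  using exec.Seq by simp

lemma exec_Cond:
  "(eval_expr e s \<noteq> Leaf \<Longrightarrow> exec p s t s') \<Longrightarrow> (eval_expr e s = Leaf \<Longrightarrow> exec q s t s')
    \<Longrightarrow> u = 1 + cost_expr e + t \<Longrightarrow> exec (Cond e p q) s u s'"
  using exec.CondTrue exec.CondFalse by (cases "eval_expr e s = Leaf") auto

text \<open>Renaming keeps the step count, so a program embedded in a block of registers costs
  exactly what it costs alone. The set \<open>A\<close> may exceed \<open>vars p\<close>, because a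
  call reserves an initial segment of registers.\<close>

lemma exec_ren:
  assumes "exec p s t s'" "vars p \<subseteq> A" "inj_on r A" "\<And>i. i \<in> A \<Longrightarrow> u (r i) = s i"
  shows "\<exists>u'. exec (ren r p) u t u' \<and> (\<forall>i\<in>A. u' (r i) = s' i) \<and> (\<forall>j. j \<notin> r ` A \<longrightarrow> u' j = u j)"
  using assms
proof (induction arbitrary: u rule: exec.induct)
  case (Assign i e s)
  have e: "eval_expr (ren_expr r e) u = eval_expr e s"
    using Assign.prems by (intro eval_ren_expr) auto
  have i: "i \<in> A" using Assign.prems by auto
  have "exec (ren r (Assign i e)) u (1 + cost_expr e) (u(r i := eval_expr e s))"
    unfolding ren.simps by (rule exec_Assign) (simp_all only: e cost_ren_expr)
  moreover have "\<forall>k\<in>A. (u(r i := eval_expr e s)) (r k) = (s(i := eval_expr e s)) k"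
    using i Assign.prems by (auto simp: inj_on_eq_iff)
  moreover have "\<forall>j. j \<notin> r ` A \<longrightarrow> (u(r i := eval_expr e s)) j = u j" using i by auto
  ultimately show ?case by blast
next
  case (Seq p s t s' q v s'')
  from Seq.IH(1)[OF _ Seq.prems(2) Seq.prems(3)] Seq.prems(1) obtain u1 where
    1: "exec (ren r p) u t u1" "\<And>i. i \<in> A \<Longrightarrow> u1 (r i) = s' i" "\<forall>j. j \<notin> r ` A \<longrightarrow> u1 j = u j" by auto
  from Seq.IH(2)[OF _ Seq.prems(2) 1(2)] Seq.prems(1) obtain u2 where
    2: "exec (ren r q) u1 v u2" "\<And>i. i \<in> A \<Longrightarrow> u2 (r i) = s'' i" "\<forall>j. j \<notin> r ` A \<longrightarrow> u2 j = u1 j" by auto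
  show ?case using 1 2 by (intro exI[of _ u2]) (auto intro: exec_Seq)
next
  case (CondTrue e s p t s' q)
  have e: "eval_expr (ren_expr r e) u = eval_expr e s"
    using CondTrue.prems by (intro eval_ren_expr) auto
  from CondTrue.IH[OF _ CondTrue.prems(2) CondTrue.prems(3)] CondTrue.prems(1) obtain u1 where
    1: "exec (ren r p) u t u1" "\<forall>i\<in>A. u1 (r i) = s' i" "\<forall>j. j \<notin> r ` A \<longrightarrow> u1 j = u j" by auto
  have "exec (ren r (Cond e p q)) u (1 + cost_expr e + t) u1"
    unfolding ren.simps by (rule exec_Cond) (use 1(1) e CondTrue.hyps in simp_all)
  with 1 show ?case by blast
next
  case (CondFalse e s q t s' p)
  have e: "eval_expr (ren_expr r e) u = eval_expr e s"
    using CondFalse.prems by (intro eval_ren_expr) auto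
  from CondFalse.IH[OF _ CondFalse.prems(2) CondFalse.prems(3)] CondFalse.prems(1) obtain u1 where
    1: "exec (ren r q) u t u1" "\<forall>i\<in>A. u1 (r i) = s' i" "\<forall>j. j \<notin> r ` A \<longrightarrow> u1 j = u j" by auto
  have "exec (ren r (Cond e p q)) u (1 + cost_expr e + t) u1"
    unfolding ren.simps by (rule exec_Cond) (use 1(1) e CondFalse.hyps in simp_all)
  with 1 show ?case by blast
next
  case (WhileFalse e s p)
  have e: "eval_expr (ren_expr r e) u = eval_expr e s"
    using WhileFalse.prems by (intro eval_ren_expr) auto
  have "exec (ren r (While e p)) u (1 + cost_expr e) u"
    using exec.WhileFalse[of "ren_expr r e" u "ren r p"] e WhileFalse.hyps by simp
  with WhileFalse.prems show ?case by blast
next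
  case (WhileTrue e s p t s' v s'')
  have e: "eval_expr (ren_expr r e) u = eval_expr e s"
    using WhileTrue.prems by (intro eval_ren_expr) auto
  from WhileTrue.IH(1)[OF _ WhileTrue.prems(2) WhileTrue.prems(3)] WhileTrue.prems(1) obtain u1 where
    1: "exec (ren r p) u t u1" "\<And>i. i \<in> A \<Longrightarrow> u1 (r i) = s' i" "\<forall>j. j \<notin> r ` A \<longrightarrow> u1 j = u j" by auto
  from WhileTrue.IH(2)[OF _ WhileTrue.prems(2) 1(2)] WhileTrue.prems(1) obtain u2 where
    2: "exec (ren r (While e p)) u1 v u2" "\<And>i. i \<in> A \<Longrightarrow> u2 (r i) = s'' i" "\<forall>j. j \<notin> r ` A \<longrightarrow> u2 j = u1 j" by auto
  have "exec (ren r (While e p)) u (1 + cost_expr e + t + v) u2"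
    using exec.WhileTrue[of "ren_expr r e" u "ren r p" t u1 v u2] 1 2 e WhileTrue.hyps by simp
  with 1 2 show ?case by auto
qed

section \<open>Results and running times of programs\<close>

definition inp :: "tree \<Rightarrow> store" where
  "inp x = (\<lambda>i. Leaf)(0 := x)"

lemma inp_simps [simp]: "inp x 0 = x" "i \<noteq> 0 \<Longrightarrow> inp x i = Leaf"
  by (auto simp: inp_def)

lemma computes_inp: "computes p x y t \<longleftrightarrow> (\<exists>s. exec p (inp x) t s \<and> s 0 = y)"
  by (simp add: computes_def inp_def)

lemma computes_deterministic: "computes p x y t \<Longrightarrow> computes p x y' t' \<Longrightarrow> y' = y \<and> t' = t"
  unfolding computes_def using exec_deterministic by blast

definition result :: "program \<Rightarrow> tree \<Rightarrow> tree" where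
  "result p x = (THE y. \<exists>t. computes p x y t)"

text \<open>Divergence becomes the value \<infinity>, so that the costs of terms below are total
  functions even if a called program does not halt on its argument.\<close>

definition runtime :: "program \<Rightarrow> tree \<Rightarrow> enat" where
  "runtime p x = (if \<exists>y t. computes p x y t then enat (THE t. \<exists>y. computes p x y t) else \<infinity>)"

lemma computes_result: "computes p x y t \<Longrightarrow> result p x = y"
  unfolding result_def using computes_deterministic by blast

lemma computes_runtime: "computes p x y t \<Longrightarrow> runtime p x = enat t"
proof -
  assume *: "computes p x y t"
  then have "(THE t. \<exists>y. computes p x y t) = t" using computes_deterministic by blast
  with * show ?thesis unfolding runtime_def by auto
qed

lemma runtime_eq_enat_iff: "runtime p x = enat t \<longleftrightarrow> computes p x (result p x) t"
  by (metis computes_result computes_runtime enat.inject enat.simps(3) runtime_def)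

fun tlen :: "tree \<Rightarrow> nat" where
  "tlen Leaf = 0"
| "tlen (Node x y) = Suc (tlen y)"

text \<open>\<open>For i j l a b\<close> folds the body \<open>b\<close> over the list \<open>l\<close>, starting with \<open>a\<close>; the body finds the current
  element in \<open>i\<close> and the accumulator in \<open>j\<close>.\<close>

datatype tm =
    Ret expr
  | Ite expr tm tm
  | Bind nat tm tm
  | For nat nat expr expr tm
  | Run program expr

fun iter :: "(tree \<Rightarrow> tree \<Rightarrow> tree) \<Rightarrow> tree \<Rightarrow> tree \<Rightarrow> tree" where
  "iter g Leaf a = a"
| "iter g (Node x y) a = iter g y (g x a)"

text \<open>The constants are exact counts for the loop emitted by \<open>code\<close>: 2 steps for
  the test, and 11 more per round for fetching the element, copying the accumulator and advancing
  the list.\<close>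

fun iter_cost :: "(tree \<Rightarrow> tree \<Rightarrow> tree) \<Rightarrow> (tree \<Rightarrow> tree \<Rightarrow> enat) \<Rightarrow> tree \<Rightarrow> tree \<Rightarrow> enat" where
  "iter_cost g c Leaf a = 2"
| "iter_cost g c (Node x y) a = 13 + c x a + iter_cost g c y (g x a)"

fun den :: "tm \<Rightarrow> store \<Rightarrow> tree" where
  "den (Ret e) s = eval_expr e s"
| "den (Ite e a b) s = (if eval_expr e s \<noteq> Leaf then den a s else den b s)"
| "den (Bind i a b) s = den b (s(i := den a s))"
| "den (For i j l a b) s = iter (\<lambda>x y. den b (s(i := x, j := y))) (eval_expr l s) (eval_expr a s)"
| "den (Run p e) s = result p (eval_expr e s)"

text \<open>Clearing the work registers, two sequencing steps and the assignment of the argument;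
  evaluating the argument is counted in \<open>cost\<close>.\<close>

definition call_cost :: "program \<Rightarrow> nat" where
  "call_cost p = 3 * Max (insert 0 (vars p)) + 5"

fun cost :: "tm \<Rightarrow> store \<Rightarrow> enat" where
  "cost (Ret e) s = enat (1 + cost_expr e)"
| "cost (Ite e a b) s = enat (1 + cost_expr e) + (if eval_expr e s \<noteq> Leaf then cost a s else cost b s)"
| "cost (Bind i a b) s = 4 + cost a s + cost b (s(i := den a s))"
| "cost (For i j l a b) s = enat (4 + cost_expr a + cost_expr l) +
     iter_cost (\<lambda>x y. den b (s(i := x, j := y))) (\<lambda>x y. cost b (s(i := x, j := y))) (eval_expr l s) (eval_expr a s)"
| "cost (Run p e) s = enat (call_cost p + cost_expr e) + runtime p (eval_expr e s)"

fun clear :: "nat \<Rightarrow> nat \<Rightarrow> program" where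
  "clear n 0 = Assign n LeafE"
| "clear n (Suc m) = Seq (clear n m) (Assign (n + Suc m) LeafE)"

lemma exec_clear: "exec (clear n m) s (3 * m + 2) (\<lambda>i. if n \<le> i \<and> i \<le> n + m then Leaf else s i)"
proof (induction m)
  case 0
  show ?case by (auto intro!: exec_Assign)
next
  case (Suc m)
  show ?case by (auto intro!: exec_Seq[OF Suc] exec_Assign)
qed

text \<open>The map \<open>r\<close> sends the variables of the term to registers; \<open>n\<close>
  is the first free register and receives the result, and registers below \<open>n\<close> survive.
  Bound variables thus live on a stack: a loop keeps its accumulator in \<open>n\<close>, the
  remaining list in \<open>Suc n\<close> and the element in \<open>n + 2\<close>, and its body works
  from \<open>n + 3\<close> on. A called program gets its registers cleared, since they may hold
  values from earlier code, such as a previous loop iteration.\<close>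

fun code :: "tm \<Rightarrow> (nat \<Rightarrow> nat) \<Rightarrow> nat \<Rightarrow> program" where
  "code (Ret e) r n = Assign n (ren_expr r e)"
| "code (Ite e a b) r n = Cond (ren_expr r e) (code a r n) (code b r n)"
| "code (Bind i a b) r n = Seq (code a r n) (Seq (code b (r(i := n)) (Suc n)) (Assign n (Var (Suc n))))"
| "code (For i j l a b) r n =
     Seq (Assign n (ren_expr r a)) (Seq (Assign (Suc n) (ren_expr r l))
       (While (Var (Suc n))
         (Seq (Assign (n + 2) (HdE (Var (Suc n))))
           (Seq (code b (r(i := n + 2, j := n)) (n + 3))
             (Seq (Assign n (Var (n + 3))) (Assign (Suc n) (TlE (Var (Suc n)))))))))"
| "code (Run p e) r n =
     Seq (clear (Suc n) (Max (insert 0 (vars p)))) (Seq (Assign n (ren_expr r e)) (ren ((+) n) p))"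

lemma plus_eq_enat: "a + b = enat t \<Longrightarrow> \<exists>u v. a = enat u \<and> b = enat v \<and> t = u + v"
  by (cases a; cases b) auto

lemma numeral_plus_eq_enat:
  "numeral k + a + b = enat t \<Longrightarrow> \<exists>u v. a = enat u \<and> b = enat v \<and> t = numeral k + u + v"
  by (cases a; cases b) (auto simp: numeral_eq_enat)

lemma exec_code:
  assumes "\<And>i. r i < n" "\<And>i. s (r i) = E i" "cost a E = enat t"
  shows "\<exists>s'. exec (code a r n) s t s' \<and> s' n = den a E \<and> (\<forall>j<n. s' j = s j)"
  using assms
proof (induction a arbitrary: r n s t E)
  case (Ret e)
  have e: "eval_expr (ren_expr r e) s = eval_expr e E" using Ret.prems(2) by (rule eval_ren_expr)
  have "exec (code (Ret e) r n) s t (s(n := eval_expr e E))"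
    unfolding code.simps by (rule exec_Assign) (use Ret.prems(3) e in simp_all)
  moreover have "(s(n := eval_expr e E)) n = den (Ret e) E" "\<forall>j<n. (s(n := eval_expr e E)) j = s j" by auto
  ultimately show ?case by blast
next
  case (Ite e a b)
  have e: "eval_expr (ren_expr r e) s = eval_expr e E" using Ite.prems(2) by (rule eval_ren_expr)
  show ?case
  proof (cases "eval_expr e E = Leaf")
    case True
    with Ite.prems(3) obtain u where u: "cost b E = enat u" "t = 1 + cost_expr e + u"
      by (auto dest!: plus_eq_enat)
    from Ite.IH(2)[OF Ite.prems(1,2) u(1)] obtain s' where
      s': "exec (code b r n) s u s'" "s' n = den b E" "\<forall>j<n. s' j = s j" by blast
    have "exec (code (Ite e a b) r n) s t s'"
      unfolding code.simps by (rule exec_Cond) (use True e s'(1) u(2) in simp_all)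
    with s' True show ?thesis by auto
  next
    case False
    with Ite.prems(3) obtain u where u: "cost a E = enat u" "t = 1 + cost_expr e + u"
      by (auto dest!: plus_eq_enat)
    from Ite.IH(1)[OF Ite.prems(1,2) u(1)] obtain s' where
      s': "exec (code a r n) s u s'" "s' n = den a E" "\<forall>j<n. s' j = s j" by blast
    have "exec (code (Ite e a b) r n) s t s'"
      unfolding code.simps by (rule exec_Cond) (use False e s'(1) u(2) in simp_all)
    with s' False show ?thesis by auto
  qed
next
  case (Bind i a b)
  from Bind.prems(3) obtain u v where uv: "cost a E = enat u" "cost b (E(i := den a E)) = enat v"
      "t = 4 + u + v"
    using numeral_plus_eq_enat unfolding cost.simps iter_cost.simps by blast
  from Bind.IH(1)[OF Bind.prems(1,2) uv(1)] obtain s1 where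
    1: "exec (code a r n) s u s1" "s1 n = den a E" "\<forall>j<n. s1 j = s j" by blast
  have 2: "s1 ((r(i := n)) j) = (E(i := den a E)) j" for j
    using 1 Bind.prems(1,2) by auto
  have "(r(i := n)) j < Suc n" for j using Bind.prems(1) by (auto simp: less_SucI)
  from Bind.IH(2)[OF this 2 uv(2)] obtain s2 where
    3: "exec (code b (r(i := n)) (Suc n)) s1 v s2" "s2 (Suc n) = den b (E(i := den a E))"
       "\<forall>j<Suc n. s2 j = s1 j" by blast
  have "exec (Assign n (Var (Suc n))) s2 2 (s2(n := s2 (Suc n)))"
    by (rule exec_Assign) simp_all
  then have "exec (code (Bind i a b) r n) s (1 + u + (1 + v + 2)) (s2(n := s2 (Suc n)))"
    unfolding code.simps by (rule exec.Seq[OF 1(1) exec.Seq[OF 3(1)]])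
  moreover have "1 + u + (1 + v + 2) = t" using uv(3) by simp
  ultimately have "exec (code (Bind i a b) r n) s t (s2(n := s2 (Suc n)))" by (simp only:)
  moreover have "(s2(n := s2 (Suc n))) n = den (Bind i a b) E" "\<forall>j<n. (s2(n := s2 (Suc n))) j = s j"
    using 1 3 by auto
  ultimately show ?case by blast
next
  case (For i j l a b)
  define g where "g = (\<lambda>x y. den b (E(i := x, j := y)))"
  define c where "c = (\<lambda>x y. cost b (E(i := x, j := y)))"
  define B where "B = Seq (Assign (n + 2) (HdE (Var (Suc n))))
           (Seq (code b (r(i := n + 2, j := n)) (n + 3))
             (Seq (Assign n (Var (n + 3))) (Assign (Suc n) (TlE (Var (Suc n))))))"
  let ?W = "While (Var (Suc n)) B"
  \<comment> \<open>Induction along the list held in register \<open>Suc n\<close>. The store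
    \<open>u\<close> may be arbitrary above \<open>n + 1\<close>, since the iterations leave values
    there.\<close>
  have loop: "\<exists>u'. exec ?W u t u' \<and> u' n = iter g xs (u n) \<and> (\<forall>j<n. u' j = s j)"
    if "u (Suc n) = xs" "\<forall>j<n. u j = s j" "iter_cost g c xs (u n) = enat t" for u t xs
    using that
  proof (induction xs arbitrary: u t)
    case Leaf
    then have "t = 2" by (simp add: numeral_eq_enat)
    moreover have "exec ?W u 2 u"
      using exec.WhileFalse[of "Var (Suc n)" u B] Leaf by (simp add: numeral_2_eq_2)
    ultimately show ?case using Leaf by auto
  next
    case (Node x y)
    from Node.prems(3) obtain v w where vw: "c x (u n) = enat v" "iter_cost g c y (g x (u n)) = enat w" "t = 13 + v + w"
      using numeral_plus_eq_enat unfolding cost.simps iter_cost.simps by blast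
    define u1 where "u1 = u(n + 2 := x)"
    have eq: "u1 ((r(i := n + 2, j := n)) k) = (E(i := x, j := u n)) k" for k
    proof -
      have "r k < n" by (rule For.prems)
      with Node.prems(2) For.prems(2) show ?thesis by (auto simp: u1_def)
    qed
    have "(r(i := n + 2, j := n)) k < n + 3" for k
      using For.prems(1)[of k] by auto
    from For.IH[OF this eq vw(1)[unfolded c_def]] obtain u2 where
      2: "exec (code b (r(i := n + 2, j := n)) (n + 3)) u1 v u2" "u2 (n + 3) = g x (u n)" "\<forall>j<n + 3. u2 j = u1 j"
      unfolding g_def by blast
    define u3 where "u3 = u2(n := g x (u n), Suc n := y)"
    have step: "exec B u (11 + v) u3"
    proof -
      have 3: "exec (Assign (n + 2) (HdE (Var (Suc n)))) u 3 u1"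
        by (rule exec_Assign) (use Node.prems(1) in \<open>simp_all add: u1_def\<close>)
      have 4: "exec (Assign n (Var (n + 3))) u2 2 (u2(n := g x (u n)))"
        by (rule exec_Assign) (use 2(2) in simp_all)
      have "u2 (Suc n) = Node x y" using 2(3) Node.prems(1) by (simp add: u1_def)
      then have 5: "exec (Assign (Suc n) (TlE (Var (Suc n)))) (u2(n := g x (u n))) 3 u3"
        by (intro exec_Assign) (simp_all add: u3_def)
      have "exec B u (1 + 3 + (1 + v + (1 + 2 + 3))) u3"
        unfolding B_def by (rule exec.Seq[OF 3 exec.Seq[OF 2(1) exec.Seq[OF 4 5]]])
      moreover have "1 + 3 + (1 + v + (1 + 2 + 3)) = 11 + v" by simp
      ultimately show ?thesis by (simp only:)
    qed
    have "\<exists>u'. exec ?W u3 w u' \<and> u' n = iter g y (u3 n) \<and> (\<forall>j<n. u' j = s j)"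
      by (rule Node.IH(2)) (use vw(2) 2 Node.prems(2) in \<open>auto simp: u3_def u1_def\<close>)
    then obtain u4 where 4: "exec ?W u3 w u4" "u4 n = iter g y (u3 n)" "\<forall>j<n. u4 j = s j" by blast
    have "exec ?W u (1 + cost_expr (Var (Suc n)) + (11 + v) + w) u4"
      by (rule exec.WhileTrue[OF _ step 4(1)]) (use Node.prems(1) in simp)
    moreover have "1 + cost_expr (Var (Suc n)) + (11 + v) + w = t" using vw(3) by simp
    ultimately show ?case using 4 by (auto simp: u3_def)
  qed
  have a: "eval_expr (ren_expr r a) s = eval_expr a E" using For.prems(2) by (rule eval_ren_expr)
  have l: "eval_expr (ren_expr r l) (s(n := eval_expr a E)) = eval_expr l E"
    by (rule eval_ren_expr) (use For.prems(1,2) in \<open>auto simp: less_imp_neq\<close>)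
  from For.prems(3) obtain v where v: "iter_cost g c (eval_expr l E) (eval_expr a E) = enat v"
      "t = 4 + cost_expr a + cost_expr l + v"
    by (auto dest!: plus_eq_enat simp: numeral_eq_enat g_def c_def)
  define u where "u = s(n := eval_expr a E, Suc n := eval_expr l E)"
  have "\<exists>w. exec ?W u v w \<and> w n = iter g (eval_expr l E) (u n) \<and> (\<forall>j<n. w j = s j)"
    by (rule loop) (use v(1) in \<open>auto simp: u_def\<close>)
  then obtain w where
    w: "exec ?W u v w" "w n = iter g (eval_expr l E) (u n)" "\<forall>j<n. w j = s j" by blast
  have "exec (code (For i j l a b) r n) s t w"
    unfolding code.simps B_def[symmetric]
    by (rule exec_Seq[OF exec_Assign[OF refl refl] exec_Seq[where u = v and s'' = w, OF exec_Assign[OF refl refl]]])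
      (use w(1) v(2) a l in \<open>simp_all add: u_def\<close>)
  moreover have "u n = eval_expr a E" by (simp add: u_def)
  ultimately show ?case using w by (auto simp: g_def)
next
  case (Run p e)
  let ?m = "Max (insert 0 (vars p))"
  have e: "eval_expr (ren_expr r e) (\<lambda>i. if Suc n \<le> i \<and> i \<le> Suc n + ?m then Leaf else s i) = eval_expr e E"
  proof (rule eval_ren_expr)
    fix i
    have "r i < n" by (rule Run.prems)
    then show "(if Suc n \<le> r i \<and> r i \<le> Suc n + ?m then Leaf else s (r i)) = E i"
      using Run.prems(2) by simp
  qed
  from Run.prems obtain v where v: "runtime p (eval_expr e E) = enat v"
      "t = call_cost p + cost_expr e + v"
    by (auto dest!: plus_eq_enat)
  from v(1) obtain s1 where s1: "exec p (inp (eval_expr e E)) v s1" "s1 0 = result p (eval_expr e E)"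
    by (auto simp: runtime_eq_enat_iff computes_inp)
  define u where "u = (\<lambda>i. if Suc n \<le> i \<and> i \<le> Suc n + ?m then Leaf else s i)"
  define w where "w = u(n := eval_expr e E)"
  have sub: "vars p \<subseteq> {..?m}" by auto
  have wi: "w (n + i) = inp (eval_expr e E) i" if "i \<in> {..?m}" for i
    using that by (auto simp: w_def u_def inp_def)
  have inj: "inj_on ((+) n) {..?m}" by simp
  from exec_ren[OF s1(1) sub inj wi] obtain s2 where
    s2: "exec (ren ((+) n) p) w v s2" "\<forall>i\<in>{..?m}. s2 (n + i) = s1 i" "\<forall>j. j \<notin> (+) n ` {..?m} \<longrightarrow> s2 j = w j"
    by blast
  have "exec (code (Run p e) r n) s t s2"
    unfolding code.simps
    by (rule exec_Seq[OF exec_clear exec_Seq[where u = v and s'' = s2, OF exec_Assign[OF refl refl]]])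
      (use s2(1) e v(2) in \<open>simp_all add: w_def u_def call_cost_def\<close>)
  moreover have "s2 n = result p (eval_expr e E)" using s2(2) s1(2) by (auto dest!: bspec[of _ _ 0])
  moreover have "s2 j = s j" if "j < n" for j
  proof -
    have "j \<notin> (+) n ` {..?m}" using that by auto
    then have "s2 j = w j" using s2(3) by blast
    then show ?thesis using that by (simp add: w_def u_def)
  qed
  ultimately show ?case by auto
qed

text \<open>All variables other than 0 share register 1, which keeps its initial value
  \<open>Leaf\<close>; hence the code starts at register 2. The final copy and its sequencing
  account for 3 additional steps.\<close>

definition compile :: "tm \<Rightarrow> program" where
  "compile a = Seq (code a (\<lambda>i. if i = 0 then 0 else 1) 2) (Assign 0 (Var 2))"

lemma computes_compile:
  assumes "cost a (inp x) = enat t"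
  shows "computes (compile a) x (den a (inp x)) (t + 3)"
proof -
  have "\<exists>s'. exec (code a (\<lambda>i. if i = 0 then 0 else 1) 2) (inp x) t s' \<and> s' 2 = den a (inp x) \<and> (\<forall>j<2. s' j = inp x j)"
    by (rule exec_code) (use assms in \<open>auto simp: inp_def\<close>)
  then obtain s where
    s: "exec (code a (\<lambda>i. if i = 0 then 0 else 1) 2) (inp x) t s" "s 2 = den a (inp x)" by blast
  show ?thesis
    unfolding computes_inp compile_def
    by (rule exI[of _ "s(0 := s 2)"]) (use s in \<open>auto intro!: exec_Seq exec_Assign\<close>)
qed

lemma runtime_compile: "cost a (inp x) \<noteq> \<infinity> \<Longrightarrow> runtime (compile a) x = cost a (inp x) + 3"
  using computes_runtime[OF computes_compile] by (cases "cost a (inp x)") (auto simp: numeral_eq_enat)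

lemma result_compile: "cost a (inp x) \<noteq> \<infinity> \<Longrightarrow> result (compile a) x = den a (inp x)"
  using computes_result[OF computes_compile] by (cases "cost a (inp x)") auto

section \<open>Clocked programs\<close>

text \<open>In a clocked program variable 0 holds the clock, a list that loses one element per loop iteration;
  variable 1 is the flag of the loop tests, and the variables of the original program are shifted by 2.
  Once the clock has run out, all loops exit.\<close>

definition loop_test :: "expr \<Rightarrow> program" where
  "loop_test e = Cond (ren_expr ((+) 2) e) (Assign 1 (Var 0)) (Assign 1 LeafE)"

fun clock_body :: "program \<Rightarrow> program" where
  "clock_body (Assign i e) = Assign (2 + i) (ren_expr ((+) 2) e)"
| "clock_body (Seq p q) = Seq (clock_body p) (clock_body q)"
| "clock_body (Cond e p q) = Cond (ren_expr ((+) 2) e) (clock_body p) (clock_body q)"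
| "clock_body (While e p) = Seq (loop_test e) (While (Var 1)
     (Seq (clock_body p) (Seq (Assign 0 (TlE (Var 0))) (loop_test e))))"

lemma tlen_tl [simp]: "tlen (tl_tree x) = tlen x - 1"
  by (cases x) auto

lemma tlen_eq_0 [simp]: "tlen x = 0 \<longleftrightarrow> x = Leaf"
  by (cases x) auto

lemma tlen_pos: "0 < tlen x \<longleftrightarrow> x \<noteq> Leaf"
  by (cases x) auto

definition test_val :: "expr \<Rightarrow> store \<Rightarrow> tree" where
  "test_val e s = (if eval_expr e (\<lambda>i. s (2 + i)) \<noteq> Leaf then s 0 else Leaf)"

lemma exec_loop_test: "exec (loop_test e) s (3 + cost_expr e) (s(1 := test_val e s))"
proof -
  have e: "eval_expr (ren_expr ((+) 2) e) s = eval_expr e (\<lambda>i. s (2 + i))"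
    by (rule eval_ren_expr) simp
  have 1: "exec (Assign 1 (Var 0)) s 2 (s(1 := test_val e s))" if "eval_expr e (\<lambda>i. s (2 + i)) \<noteq> Leaf"
    by (rule exec_Assign) (use that in \<open>simp_all add: test_val_def\<close>)
  have 2: "exec (Assign 1 LeafE) s 2 (s(1 := test_val e s))" if "eval_expr e (\<lambda>i. s (2 + i)) = Leaf"
    by (rule exec_Assign) (use that in \<open>simp_all add: test_val_def\<close>)
  show ?thesis
    unfolding loop_test_def by (rule exec_Cond[OF 1 2]) (simp_all only: e cost_ren_expr, simp)
qed

fun clock_const :: "program \<Rightarrow> nat" where
  "clock_const (Assign i e) = 1 + cost_expr e"
| "clock_const (Seq p q) = 1 + clock_const p + clock_const q"
| "clock_const (Cond e p q) = 1 + cost_expr e + clock_const p + clock_const q"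
| "clock_const (While e p) = 2 * clock_const p + 2 * cost_expr e + 20"

text \<open>Only loops can take unbounded time, and every iteration removes an element from the
  clock. So a clocked program halts on every store, even where the original diverges, with
  \<open>clock_const p\<close> steps per tick and one further share for the code outside
  loops.\<close>

lemma exec_clock_body_total:
  "\<exists>t s'. exec (clock_body p) s t s' \<and> tlen (s' 0) \<le> tlen (s 0) \<and>
     t \<le> clock_const p * (1 + tlen (s 0) - tlen (s' 0))"
proof (induction p arbitrary: s)
  case (Assign i e)
  have "exec (clock_body (Assign i e)) s (1 + cost_expr e) (s(2 + i := eval_expr (ren_expr ((+) 2) e) s))"
    unfolding clock_body.simps by (rule exec_Assign) (simp_all only: cost_ren_expr)
  moreover have "(s(2 + i := eval_expr (ren_expr ((+) 2) e) s)) 0 = s 0" by simp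
  ultimately show ?case by (intro exI conjI) (assumption, simp_all)
next
  case (Seq p q)
  from Seq.IH(1)[of s] obtain t s1 where 1: "exec (clock_body p) s t s1" "tlen (s1 0) \<le> tlen (s 0)"
     "t \<le> clock_const p * (1 + tlen (s 0) - tlen (s1 0))" by blast
  from Seq.IH(2)[of s1] obtain u s2 where 2: "exec (clock_body q) s1 u s2" "tlen (s2 0) \<le> tlen (s1 0)"
     "u \<le> clock_const q * (1 + tlen (s1 0) - tlen (s2 0))" by blast
  have "1 + t + u \<le> 1 + clock_const p * (1 + tlen (s 0) - tlen (s2 0)) + clock_const q * (1 + tlen (s 0) - tlen (s2 0))"
    using 1 2 by (intro add_mono order_refl order_trans[OF 1(3)] order_trans[OF 2(3)] mult_left_mono) auto
  also have "\<dots> \<le> clock_const (Seq p q) * (1 + tlen (s 0) - tlen (s2 0))"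
  proof -
    obtain d where "1 + tlen (s 0) - tlen (s2 0) = Suc d" using 1(2) 2(2) by (auto simp: Suc_diff_le)
    then show ?thesis by (simp add: algebra_simps)
  qed
  finally show ?case using exec.Seq[OF 1(1) 2(1)] 1 2 by (intro exI[of _ "1 + t + u"] exI[of _ s2]) auto
next
  case (Cond e p q)
  let ?e = "ren_expr ((+) 2) e"
  show ?case
  proof (cases "eval_expr ?e s = Leaf")
    case True
    from Cond.IH(2)[of s] obtain u s2 where 2: "exec (clock_body q) s u s2" "tlen (s2 0) \<le> tlen (s 0)"
       "u \<le> clock_const q * (1 + tlen (s 0) - tlen (s2 0))" by blast
    have "1 + cost_expr e + u \<le> clock_const (Cond e p q) * (1 + tlen (s 0) - tlen (s2 0))"
    proof -
      obtain d where "1 + tlen (s 0) - tlen (s2 0) = Suc d" using 2(2) by (auto simp: Suc_diff_le)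
      then show ?thesis using 2(3) by (simp add: algebra_simps)
    qed
    then show ?thesis using exec.CondFalse[OF True 2(1), of "clock_body p"] 2(2)
      by (intro exI[of _ "1 + cost_expr e + u"] exI[of _ s2]) auto
  next
    case False
    from Cond.IH(1)[of s] obtain u s2 where 2: "exec (clock_body p) s u s2" "tlen (s2 0) \<le> tlen (s 0)"
       "u \<le> clock_const p * (1 + tlen (s 0) - tlen (s2 0))" by blast
    have "1 + cost_expr e + u \<le> clock_const (Cond e p q) * (1 + tlen (s 0) - tlen (s2 0))"
    proof -
      obtain d where "1 + tlen (s 0) - tlen (s2 0) = Suc d" using 2(2) by (auto simp: Suc_diff_le)
      then show ?thesis using 2(3) by (simp add: algebra_simps)
    qed
    then show ?thesis using exec.CondTrue[OF False 2(1), of "clock_body q"] 2(2)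
      by (intro exI[of _ "1 + cost_expr e + u"] exI[of _ s2]) auto
  qed
next
  case (While e p)
  \<comment> \<open>An iteration that removes d + 1 elements from the clock is charged at most d + 2
    shares of its body, and d + 2 \<le> 2 * (d + 1); hence the factor 2.\<close>
  define A where "A = 2 * clock_const p + cost_expr e + 11"
  define W where "W = While (Var 1) (Seq (clock_body p) (Seq (Assign 0 (TlE (Var 0))) (loop_test e)))"
  have loop: "\<exists>t s'. exec W s t s' \<and> tlen (s' 0) \<le> tlen (s 0) \<and> t \<le> A * (tlen (s 0) - tlen (s' 0)) + 2"
    if "s 1 \<noteq> Leaf \<longrightarrow> s 0 \<noteq> Leaf" for s
    using that
  proof (induction "tlen (s 0)" arbitrary: s rule: less_induct)
    case less
    show ?case
    proof (cases "s 1 = Leaf")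
      case True
      have "exec W s 2 s" unfolding W_def
        using exec.WhileFalse[of "Var 1" s] True by (simp add: numeral_2_eq_2)
      then show ?thesis by (intro exI[of _ 2] exI[of _ s]) auto
    next
      case False
      with less.prems have pos: "tlen (s 0) > 0" by (auto simp: tlen_pos)
      from While.IH[of s] obtain t s1 where 1: "exec (clock_body p) s t s1" "tlen (s1 0) \<le> tlen (s 0)"
         "t \<le> clock_const p * (1 + tlen (s 0) - tlen (s1 0))" by blast
      define s2 where "s2 = s1(0 := tl_tree (s1 0))"
      define s3 where "s3 = s2(1 := test_val e s2)"
      have 2: "exec (Assign 0 (TlE (Var 0))) s1 3 s2" by (rule exec_Assign) (simp_all add: s2_def)
      have 3: "exec (loop_test e) s2 (3 + cost_expr e) s3" unfolding s3_def by (rule exec_loop_test)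
      have body: "exec (Seq (clock_body p) (Seq (Assign 0 (TlE (Var 0))) (loop_test e))) s (1 + t + (1 + 3 + (3 + cost_expr e))) s3"
        by (rule exec.Seq[OF 1(1) exec.Seq[OF 2 3]])
      have l3: "tlen (s3 0) = tlen (s1 0) - 1" by (simp add: s3_def s2_def)
      have "s3 1 \<noteq> Leaf \<longrightarrow> s3 0 \<noteq> Leaf" by (auto simp: s3_def test_val_def)
      moreover have dec: "tlen (s3 0) < tlen (s 0)" using l3 1(2) pos by auto
      ultimately obtain u s4 where 4: "exec W s3 u s4" "tlen (s4 0) \<le> tlen (s3 0)" "u \<le> A * (tlen (s3 0) - tlen (s4 0)) + 2"
        using less.hyps by blast
      have "1 + cost_expr (Var 1) + (1 + t + (1 + 3 + (3 + cost_expr e))) + u \<le> A * (tlen (s 0) - tlen (s3 0)) + (A * (tlen (s3 0) - tlen (s4 0)) + 2)"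
      proof -
        obtain d where d: "tlen (s 0) - tlen (s3 0) = Suc d" using dec by (metis Suc_diff_Suc)
        have "1 + tlen (s 0) - tlen (s1 0) \<le> 2 + d" using d l3 by auto
        then have "t \<le> clock_const p * (2 + d)" using 1(3) by (meson le_trans mult_le_mono2)
        then have "t + 10 + cost_expr e \<le> A * Suc d" by (simp add: A_def algebra_simps)
        then show ?thesis using 4(3) d by simp
      qed
      also have "\<dots> = A * (tlen (s 0) - tlen (s4 0)) + 2"
        using dec 4(2) by (simp flip: add_mult_distrib2)
      finally have "1 + cost_expr (Var 1) + (1 + t + (1 + 3 + (3 + cost_expr e))) + u \<le> A * (tlen (s 0) - tlen (s4 0)) + 2" .
      moreover have "exec W s (1 + cost_expr (Var 1) + (1 + t + (1 + 3 + (3 + cost_expr e))) + u) s4"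
        using exec.WhileTrue[OF _ body 4(1)[unfolded W_def], folded W_def] False by (metis eval_expr.simps(1))
      ultimately show ?thesis using dec 4(2) by (metis le_trans less_imp_le)
    qed
  qed
  define s1 where "s1 = s(1 := test_val e s)"
  have "s1 1 \<noteq> Leaf \<longrightarrow> s1 0 \<noteq> Leaf" by (auto simp: s1_def test_val_def)
  from loop[OF this] obtain t s2 where 2: "exec W s1 t s2" "tlen (s2 0) \<le> tlen (s1 0)" "t \<le> A * (tlen (s1 0) - tlen (s2 0)) + 2"
    by blast
  have "exec (clock_body (While e p)) s (1 + (3 + cost_expr e) + t) s2"
    unfolding clock_body.simps W_def[symmetric]
    by (rule exec.Seq[OF exec_loop_test 2(1)[unfolded s1_def]])
  moreover have "1 + (3 + cost_expr e) + t \<le> clock_const (While e p) * (1 + tlen (s 0) - tlen (s2 0))"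
  proof -
    have [simp]: "s1 0 = s 0" by (simp add: s1_def)
    obtain d where d: "tlen (s 0) - tlen (s2 0) = d" by simp
    then have "1 + tlen (s 0) - tlen (s2 0) = Suc d" using 2(2) by auto
    then show ?thesis using 2(3) d by (simp add: A_def algebra_simps)
  qed
  ultimately show ?case using 2(2) by (intro exI[of _ "1 + (3 + cost_expr e) + t"] exI[of _ s2]) (simp add: s1_def)
qed

lemma clock_body_Leaf: "exec (clock_body p) s t s' \<Longrightarrow> s 0 = Leaf \<Longrightarrow> s' 0 = Leaf"
  using exec_clock_body_total[of p s] exec_deterministic by (metis le_zero_eq tlen_eq_0)

text \<open>Each loop iteration takes the original at least one step, so ticks never outnumber
  steps. Either the clock has run dry, which needs an original run at least as long as the clock, or
  the simulation has been faithful throughout.\<close>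

lemma exec_clock_body:
  assumes "exec p s t s'" "\<And>i. u (2 + i) = s i"
  shows "\<exists>v u'. exec (clock_body p) u v u' \<and>
    (u' 0 = Leaf \<and> tlen (u 0) \<le> t \<or> (\<forall>i. u' (2 + i) = s' i) \<and> tlen (u 0) \<le> tlen (u' 0) + t)"
  using assms
proof (induction arbitrary: u rule: exec.induct)
  case (Assign i e s)
  have "eval_expr (ren_expr ((+) 2) e) u = eval_expr e s" using Assign by (intro eval_ren_expr) auto
  then have "exec (clock_body (Assign i e)) u (1 + cost_expr e) (u(2 + i := eval_expr e s))"
    unfolding clock_body.simps by (intro exec_Assign) (simp_all only: cost_ren_expr)
  moreover have "\<forall>j. (u(2 + i := eval_expr e s)) (2 + j) = (s(i := eval_expr e s)) j"
    using Assign by auto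
  moreover have "(u(2 + i := eval_expr e s)) 0 = u 0" by simp
  ultimately show ?case by (metis le_add1)
next
  case (Seq p s t s' q v s'')
  from Seq.IH(1)[OF Seq.prems] obtain t1 u1 where 1: "exec (clock_body p) u t1 u1"
    "u1 0 = Leaf \<and> tlen (u 0) \<le> t \<or> (\<forall>i. u1 (2 + i) = s' i) \<and> tlen (u 0) \<le> tlen (u1 0) + t" by blast
  show ?case
  proof (cases "u1 0 = Leaf \<and> tlen (u 0) \<le> t")
    case True
    obtain t2 u2 where 2: "exec (clock_body q) u1 t2 u2" using exec_clock_body_total by blast
    then have "u2 0 = Leaf" using clock_body_Leaf True by blast
    then show ?thesis using exec.Seq[OF 1(1) 2] True
      by (intro exI[of _ "1 + t1 + t2"] exI[of _ u2]) auto
  next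
    case False
    with 1(2) have 3: "\<And>i. u1 (2 + i) = s' i" "tlen (u 0) \<le> tlen (u1 0) + t" by auto
    from Seq.IH(2)[OF 3(1)] obtain t2 u2 where 2: "exec (clock_body q) u1 t2 u2"
      "u2 0 = Leaf \<and> tlen (u1 0) \<le> v \<or> (\<forall>i. u2 (2 + i) = s'' i) \<and> tlen (u1 0) \<le> tlen (u2 0) + v" by blast
    then show ?thesis using exec.Seq[OF 1(1) 2(1)] 3(2)
      by (intro exI[of _ "1 + t1 + t2"] exI[of _ u2]) auto
  qed
next
  case (CondTrue e s p t s' q)
  have e: "eval_expr (ren_expr ((+) 2) e) u = eval_expr e s" using CondTrue.prems by (intro eval_ren_expr) auto
  from CondTrue.IH[OF CondTrue.prems] obtain t1 u1 where 1: "exec (clock_body p) u t1 u1"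
    "u1 0 = Leaf \<and> tlen (u 0) \<le> t \<or> (\<forall>i. u1 (2 + i) = s' i) \<and> tlen (u 0) \<le> tlen (u1 0) + t" by blast
  have "exec (clock_body (Cond e p q)) u (1 + cost_expr e + t1) u1"
    using exec.CondTrue[OF _ 1(1), of "ren_expr ((+) 2) e"] e CondTrue.hyps by simp
  with 1(2) show ?case by (intro exI[of _ "1 + cost_expr e + t1"] exI[of _ u1]) auto
next
  case (CondFalse e s q t s' p)
  have e: "eval_expr (ren_expr ((+) 2) e) u = eval_expr e s" using CondFalse.prems by (intro eval_ren_expr) auto
  from CondFalse.IH[OF CondFalse.prems] obtain t1 u1 where 1: "exec (clock_body q) u t1 u1"
    "u1 0 = Leaf \<and> tlen (u 0) \<le> t \<or> (\<forall>i. u1 (2 + i) = s' i) \<and> tlen (u 0) \<le> tlen (u1 0) + t" by blast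
  have "exec (clock_body (Cond e p q)) u (1 + cost_expr e + t1) u1"
    using exec.CondFalse[OF _ 1(1), of "ren_expr ((+) 2) e"] e CondFalse.hyps by simp
  with 1(2) show ?case by (intro exI[of _ "1 + cost_expr e + t1"] exI[of _ u1]) auto
next
  case (WhileFalse e s p)
  define W where "W = While (Var 1) (Seq (clock_body p) (Seq (Assign 0 (TlE (Var 0))) (loop_test e)))"
  define u1 where "u1 = u(1 := Leaf)"
  have tv: "test_val e u = Leaf" using WhileFalse by (simp add: test_val_def)
  have 1: "exec (loop_test e) u (3 + cost_expr e) u1" using exec_loop_test[of e u] by (simp add: tv u1_def)
  have 2: "exec W u1 2 u1" unfolding W_def
    using exec.WhileFalse[of "Var 1" u1] by (simp add: numeral_2_eq_2 u1_def)
  have "exec (clock_body (While e p)) u (1 + (3 + cost_expr e) + 2) u1"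
    unfolding clock_body.simps W_def[symmetric] by (rule exec.Seq[OF 1 2])
  moreover have "\<forall>i. u1 (2 + i) = s i" "u1 0 = u 0" using WhileFalse.prems by (auto simp: u1_def)
  ultimately show ?case by (metis le_add1)
next
  case (WhileTrue e s p t s' v s'')
  define B where "B = Seq (clock_body p) (Seq (Assign 0 (TlE (Var 0))) (loop_test e))"
  have cW: "clock_body (While e p) = Seq (loop_test e) (While (Var 1) B)" by (simp add: B_def)
  define u1 where "u1 = u(1 := test_val e u)"
  have 1: "exec (loop_test e) u (3 + cost_expr e) u1" using exec_loop_test[of e u] by (simp add: u1_def)
  show ?case
  proof (cases "u 0 = Leaf")
    case True
    obtain t2 u2 where 2: "exec (clock_body (While e p)) u t2 u2" using exec_clock_body_total by blast
    then have "u2 0 = Leaf" using clock_body_Leaf True by blast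
    then show ?thesis using 2 True by (intro exI[of _ t2] exI[of _ u2]) auto
  next
    case False
    have "u1 1 \<noteq> Leaf" using False WhileTrue.prems WhileTrue.hyps by (simp add: u1_def test_val_def)
    then have cond: "eval_expr (Var 1) u1 \<noteq> Leaf" by simp
    have u1: "\<And>i. u1 (2 + i) = s i" "u1 0 = u 0" using WhileTrue.prems by (auto simp: u1_def)
    from WhileTrue.IH(1)[OF u1(1)] obtain t1 u2 where 2: "exec (clock_body p) u1 t1 u2"
      "u2 0 = Leaf \<and> tlen (u 0) \<le> t \<or> (\<forall>i. u2 (2 + i) = s' i) \<and> tlen (u 0) \<le> tlen (u2 0) + t"
      unfolding u1(2) by blast
    define u3 where "u3 = u2(0 := tl_tree (u2 0))"
    have 3: "exec (Assign 0 (TlE (Var 0))) u2 3 u3" by (rule exec_Assign) (simp_all add: u3_def)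
    \<comment> \<open>The loop test that ends an iteration, followed by the remaining loop, is
      precisely \<open>clock_body (While e p)\<close> started in \<open>u3\<close>; this brings the
      remaining loop into the form of the induction hypothesis, and determinism identifies the two
      runs.\<close>
    obtain t4 u4 where 4: "exec (clock_body (While e p)) u3 t4 u4" using exec_clock_body_total by blast
    from 4 obtain t5 t6 u5 where 5: "exec (loop_test e) u3 t5 u5" "exec (While (Var 1) B) u5 t6 u4"
      unfolding cW by (auto elim: SeqE)
    have "exec B u1 (1 + t1 + (1 + 3 + t5)) u5" unfolding B_def
      by (rule exec.Seq[OF 2(1) exec.Seq[OF 3 5(1)]])
    from exec.Seq[OF 1 exec.WhileTrue[OF cond this 5(2)]]
    obtain T where run: "exec (clock_body (While e p)) u T u4" unfolding cW by blast
    show ?thesis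
    proof (cases "u2 0 = Leaf \<and> tlen (u 0) \<le> t")
      case True
      then have "u3 0 = Leaf" by (simp add: u3_def)
      then have "u4 0 = Leaf" using clock_body_Leaf 4 by blast
      then show ?thesis using run True by (intro exI[of _ T] exI[of _ u4]) auto
    next
      case False
      with 2(2) have 6: "\<forall>i. u2 (2 + i) = s' i" "tlen (u 0) \<le> tlen (u2 0) + t" by auto
      have "\<And>i. u3 (2 + i) = s' i" using 6(1) by (simp add: u3_def)
      from WhileTrue.IH(2)[OF this] obtain t7 u7 where 7: "exec (clock_body (While e p)) u3 t7 u7"
       "u7 0 = Leaf \<and> tlen (u3 0) \<le> v \<or> (\<forall>i. u7 (2 + i) = s'' i) \<and> tlen (u3 0) \<le> tlen (u7 0) + v" by blast
      have "u7 = u4" using exec_deterministic 4 7(1) by blast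
      moreover have "tlen (u3 0) = tlen (u2 0) - 1" by (simp add: u3_def)
      ultimately show ?thesis using run 6(2) 7(2) by (intro exI[of _ T] exI[of _ u4]) auto
    qed
  qed
qed

text \<open>The input is saved in variable 2 before variable 0 is overwritten by the clock. An empty
  clock is reported as \<open>Leaf\<close> even after a complete simulation; this happens only if
  the run is at least as long as the clock.\<close>

definition clocked :: "program \<Rightarrow> program" where
  "clocked p = Seq (Assign 2 (TlE (Var 0))) (Seq (Assign 0 (HdE (Var 0))) (Seq (clock_body p)
     (Cond (Var 0) (Assign 0 (NodeE (Var 2) LeafE)) (Assign 0 LeafE))))"

lemma computes_clocked:
  assumes "computes p x y t"
  shows "\<exists>z v. computes (clocked p) (Node k x) z v \<and> v \<le> clock_const p * (1 + tlen k) + 20 \<and>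
    (z = Leaf \<or> z = Node y Leaf) \<and> (t < tlen k \<longrightarrow> z = Node y Leaf)"
proof -
  from assms obtain s' where s': "exec p (inp x) t s'" "s' 0 = y" by (auto simp: computes_inp)
  define u1 where "u1 = (inp (Node k x))(2 := x)"
  define u2 where "u2 = u1(0 := k)"
  have 1: "exec (Assign 2 (TlE (Var 0))) (inp (Node k x)) 3 u1"
    by (rule exec_Assign) (simp_all add: u1_def)
  have 2: "exec (Assign 0 (HdE (Var 0))) u1 3 u2"
    by (rule exec_Assign) (simp_all add: u1_def u2_def)
  have "u2 (2 + i) = inp x i" for i by (simp add: u1_def u2_def inp_def)
  from exec_clock_body[OF s'(1) this] obtain v u3 where 3: "exec (clock_body p) u2 v u3"
    "u3 0 = Leaf \<and> tlen (u2 0) \<le> t \<or> (\<forall>i. u3 (2 + i) = s' i) \<and> tlen (u2 0) \<le> tlen (u3 0) + t" by blast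
  obtain v' u' where "exec (clock_body p) u2 v' u'"
    "v' \<le> clock_const p * (1 + tlen (u2 0) - tlen (u' 0))" using exec_clock_body_total by blast
  with 3(1) have v: "v \<le> clock_const p * (1 + tlen k - tlen (u3 0))"
    using exec_deterministic[OF 3(1)] by (force simp: u2_def)
  also have "\<dots> \<le> clock_const p * (1 + tlen k)" by (intro mult_le_mono2) simp
  finally have v: "v \<le> clock_const p * (1 + tlen k)" .
  have u32: "u3 2 = y" if "\<forall>i. u3 (2 + i) = s' i"
    using that[rule_format, of 0] s'(2) by simp
  define z where "z = (if u3 0 \<noteq> Leaf then Node (u3 2) Leaf else Leaf)"
  define w where "w = (if u3 0 \<noteq> Leaf then 4 else 2 :: nat)"
  have 41: "exec (Assign 0 (NodeE (Var 2) LeafE)) u3 w (u3(0 := z))" if "eval_expr (Var 0) u3 \<noteq> Leaf"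
    by (rule exec_Assign) (use that in \<open>simp_all add: w_def z_def\<close>)
  have 42: "exec (Assign 0 LeafE) u3 w (u3(0 := z))" if "eval_expr (Var 0) u3 = Leaf"
    by (rule exec_Assign) (use that in \<open>simp_all add: w_def z_def\<close>)
  have 4: "exec (Cond (Var 0) (Assign 0 (NodeE (Var 2) LeafE)) (Assign 0 LeafE)) u3 (1 + cost_expr (Var 0) + w) (u3(0 := z))"
    by (rule exec_Cond[OF 41 42 refl])
  have "exec (clocked p) (inp (Node k x)) (1 + 3 + (1 + 3 + (1 + v + (1 + cost_expr (Var 0) + w)))) (u3(0 := z))"
    unfolding clocked_def by (rule exec.Seq[OF 1 exec.Seq[OF 2 exec.Seq[OF 3(1) 4]]])
  then have "computes (clocked p) (Node k x) z (1 + 3 + (1 + 3 + (1 + v + (1 + cost_expr (Var 0) + w))))"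
    unfolding computes_inp by (intro exI[of _ "u3(0 := z)"]) simp
  moreover have "1 + 3 + (1 + 3 + (1 + v + (1 + cost_expr (Var 0) + w))) \<le> clock_const p * (1 + tlen k) + 20"
    using v by (simp add: w_def)
  moreover have "z = Leaf \<or> z = Node y Leaf"
    using 3(2) u32 by (auto simp: z_def)
  moreover have "t < tlen k \<longrightarrow> z = Node y Leaf"
    using 3(2) u32 by (auto simp: z_def u2_def)
  ultimately show ?thesis by blast
qed

section \<open>Weighted covers of the cube\<close>

text \<open>The greedy algorithm for weighted set cover, compared with a fractional cover
  \<open>x\<close> of cost \<open>V\<close>. By averaging, some \<open>t\<close> costs at most
  \<open>V / card R\<close> per newly covered element. It covers \<open>d t\<close> of them, and
  \<open>d t / card R\<close> is at most the part of the harmonic sum from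
  \<open>card R' + 1\<close> to \<open>card R\<close>. The same \<open>x\<close> still covers the
  rest fractionally, so induction pays for it with the remaining terms.\<close>

lemma greedy_weighted_cover:
  fixes w x :: "'a \<Rightarrow> real"
  assumes "finite T" "\<And>t. t \<in> T \<Longrightarrow> w t \<ge> 0" "\<And>t. t \<in> T \<Longrightarrow> x t \<ge> 0"
    and "finite R" "\<And>s. s \<in> R \<Longrightarrow> (\<Sum>t | t \<in> T \<and> c t s. x t) \<ge> 1"
  shows "\<exists>T'\<subseteq>T. (\<forall>s\<in>R. \<exists>t\<in>T'. c t s) \<and> sum w T' \<le> (\<Sum>t\<in>T. x t * w t) * (\<Sum>i=1..card R. 1 / real i)"
  using assms(4,5)
proof (induction "card R" arbitrary: R rule: less_induct)
  case less
  define V where "V = (\<Sum>t\<in>T. x t * w t)"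
  define d where "d t = card {s \<in> R. c t s}" for t
  have V: "V \<ge> 0" unfolding V_def using assms by (intro sum_nonneg) auto
  show ?case
  proof (cases "R = {}")
    case True
    then show ?thesis by (intro exI[of _ "{}"]) auto
  next
    case False
    then have R: "card R > 0" using less.prems by (simp add: card_gt_0_iff)
    have "real (card R) = (\<Sum>s\<in>R. 1)" by simp
    also have "\<dots> \<le> (\<Sum>s\<in>R. \<Sum>t | t \<in> T \<and> c t s. x t)"
      using less.prems by (intro sum_mono) auto
    also have "\<dots> = (\<Sum>s\<in>R. \<Sum>t\<in>T. if c t s then x t else 0)"
      by (intro sum.cong refl sum.inter_filter assms(1))
    also have "\<dots> = (\<Sum>t\<in>T. \<Sum>s\<in>R. if c t s then x t else 0)"
      by (rule sum.swap)
    also have "\<dots> = (\<Sum>t\<in>T. x t * d t)"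
    proof (intro sum.cong refl)
      fix t
      have "(\<Sum>s\<in>R. if c t s then x t else 0) = (\<Sum>s | s \<in> R \<and> c t s. x t)"
        by (rule sum.inter_filter[symmetric]) (rule less.prems)
      then show "(\<Sum>s\<in>R. if c t s then x t else 0) = x t * d t" by (simp add: d_def)
    qed
    finally have cov: "real (card R) \<le> (\<Sum>t\<in>T. x t * d t)" .
    \<comment> \<open>If every useful \<open>t\<close> were more expensive than
      \<open>V / card R\<close> per element, summing with the weights \<open>x\<close> would give
      \<open>V * (\<Sum>t\<in>T. x t * d t) < V * card R\<close>, against
      \<open>cov\<close>.\<close>
    have "\<exists>t\<in>T. d t > 0 \<and> w t * card R \<le> V * d t"
    proof (rule ccontr)
      assume "\<not> ?thesis"
      then have *: "d t = 0 \<or> w t * card R > V * d t" if "t \<in> T" for t using that by force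
      have "(\<Sum>t\<in>T. x t * (V * d t)) < (\<Sum>t\<in>T. x t * (w t * card R))"
      proof (rule sum_strict_mono_ex1)
        show "\<forall>t\<in>T. x t * (V * d t) \<le> x t * (w t * card R)"
        proof
          fix t assume "t \<in> T"
          with *[OF this] assms(2,3)[of t] show "x t * (V * d t) \<le> x t * (w t * card R)"
            by (intro mult_left_mono) auto
        qed
        have "\<exists>t\<in>T. x t * d t > 0"
        proof (rule ccontr)
          assume "\<not> ?thesis"
          then have "(\<Sum>t\<in>T. x t * d t) \<le> 0" by (intro sum_nonpos) force
          with cov R show False by simp
        qed
        then obtain t where t: "t \<in> T" "x t * d t > 0" by blast
        then have "x t > 0" "d t > 0" using assms(3)[of t] by (auto simp: zero_less_mult_iff)
        with *[OF t(1)] t(1) show "\<exists>t\<in>T. x t * (V * d t) < x t * (w t * card R)"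
          by (intro bexI[of _ t]) auto
      qed (rule assms)
      also have "\<dots> = V * card R" by (simp add: V_def sum_distrib_right mult.assoc)
      finally have "V * (\<Sum>t\<in>T. x t * d t) < V * card R"
        by (simp add: sum_distrib_left mult_ac)
      moreover have "V * card R \<le> V * (\<Sum>t\<in>T. x t * d t)"
        using cov V by (rule mult_left_mono)
      ultimately show False by simp
    qed
    then obtain t where t: "t \<in> T" "d t > 0" "w t * card R \<le> V * d t" by blast
    define R' where "R' = {s \<in> R. \<not> c t s}"
    have fin: "finite R'" using less.prems by (simp add: R'_def)
    have "R = R' \<union> {s \<in> R. c t s}" "R' \<inter> {s \<in> R. c t s} = {}" by (auto simp: R'_def)
    then have card: "card R = card R' + d t"
      unfolding d_def using card_Un_disjoint[of R' "{s \<in> R. c t s}"] less.prems fin by simp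
    have "card R' < card R" using card t(2) by simp
    then obtain T' where T': "T' \<subseteq> T" "\<forall>s\<in>R'. \<exists>t\<in>T'. c t s" "sum w T' \<le> V * (\<Sum>i=1..card R'. 1 / real i)"
      using less.hyps[of R'] fin less.prems by (auto simp: V_def R'_def)
    have "w t \<le> V * (d t / card R)" using t(3) R by (simp add: field_simps)
    also have "\<dots> \<le> V * (\<Sum>i=card R'+1..card R. 1 / real i)"
    proof (rule mult_left_mono[OF _ V])
      have "real (d t) / card R = (\<Sum>i=card R'+1..card R. 1 / real (card R))"
        using card by simp
      also have "\<dots> \<le> (\<Sum>i=card R'+1..card R. 1 / real i)"
        by (intro sum_mono) (auto simp: frac_le)
      finally show "real (d t) / card R \<le> \<dots>" .
    qed
    finally have "w t + sum w T' \<le> V * ((\<Sum>i=1..card R'. 1 / real i) + (\<Sum>i=card R'+1..card R. 1 / real i))"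
      using T'(3) by (simp add: distrib_left)
    also have "(\<Sum>i=1..card R'. 1 / real i) + (\<Sum>i=card R'+1..card R. 1 / real i) = (\<Sum>i=1..card R. 1 / real i)"
      using sum.ub_add_nat[of 1 "card R'" "\<lambda>i. 1 / real i" "d t"] card by simp
    finally have "w t + sum w T' \<le> V * (\<Sum>i=1..card R. 1 / real i)" .
    moreover have "sum w (insert t T') \<le> w t + sum w T'"
      using assms(1,2) t(1) finite_subset[OF T'(1)] by (cases "t \<in> T'") (auto simp: insert_absorb)
    moreover have "\<forall>s\<in>R. \<exists>t\<in>insert t T'. c t s" using T'(2) by (auto simp: R'_def)
    ultimately show ?thesis using T'(1) t(1) by (intro exI[of _ "insert t T'"]) (auto simp: V_def)
  qed
qed

text \<open>Each dyadic range from 2^n + 1 to 2^(n + 1) contributes at most 1.\<close>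

lemma harmonic_two_power_le: "(\<Sum>i=1..2 ^ n. 1 / real i) \<le> real n + 1"
proof (induction n)
  case (Suc n)
  have "(\<Sum>i=1..2 ^ Suc n. 1 / real i) = (\<Sum>i=1..2 ^ n. 1 / real i) + (\<Sum>i=2^n+1..2^n+2^n. 1 / real i)"
    using sum.ub_add_nat[of 1 "2 ^ n" "\<lambda>i. 1 / real i" "2 ^ n"] by (simp add: mult_2)
  also have "(\<Sum>i=2^n+1..2^n+2^n. 1 / real i) \<le> (\<Sum>i=(2::nat)^n+1..2^n+2^n. 1 / 2 ^ n)"
  proof (intro sum_mono frac_le)
    fix i :: nat assume "i \<in> {2^n+1..2^n+2^n}"
    then have "2 ^ n \<le> i" by simp
    then show "2 ^ n \<le> real i" by (metis of_nat_le_iff of_nat_numeral of_nat_power)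
  qed auto
  also have "\<dots> = 1" by simp
  finally show ?case using Suc by simp
qed simp

section \<open>Subsets of a block as vectors of the Boolean cube\<close>

abbreviation cube :: "nat \<Rightarrow> bool list set" where
  "cube n \<equiv> {xs. length xs = n}"

lemma cube_Suc: "cube (Suc n) = (#) True ` cube n \<union> (#) False ` cube n"
  by (auto simp: length_Suc_conv image_iff)

lemma finite_cube [simp]: "finite (cube n)"
  by (induction n) (simp_all add: cube_Suc)

lemma sum_cube_Suc: "sum f (cube (Suc n)) = (\<Sum>xs\<in>cube n. f (True # xs) + f (False # xs))" for f :: "_ \<Rightarrow> real"
proof -
  have "sum f (cube (Suc n)) = sum f ((#) True ` cube n) + sum f ((#) False ` cube n)"
    unfolding cube_Suc by (rule sum.union_disjoint) auto
  then show ?thesis by (simp add: sum.reindex sum.distrib)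
qed

lemma card_cube: "card (cube n) = 2 ^ n"
proof -
  have "card {xs. set xs \<subseteq> (UNIV :: bool set) \<and> length xs = n} = card (UNIV :: bool set) ^ n"
    by (rule card_lists_length_eq) simp
  then show ?thesis by simp
qed

text \<open>\<open>gap X S\<close> is the size of the difference of \<open>S\<close> and \<open>X\<close>, as characteristic vectors.\<close>

fun below :: "bool list \<Rightarrow> bool list \<Rightarrow> bool" where
  "below (x # X) (s # S) \<longleftrightarrow> (x \<longrightarrow> s) \<and> below X S"
| "below _ _ = True"

fun gap :: "bool list \<Rightarrow> bool list \<Rightarrow> nat" where
  "gap (x # X) (s # S) = of_bool (s \<and> \<not> x) + gap X S"
| "gap _ _ = 0"

fun ones :: "bool list \<Rightarrow> nat" where
  "ones [] = 0"
| "ones (x # X) = of_bool x + ones X"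

lemma ones_le: "ones X \<le> length X"
  by (induction X) auto

lemma gap_le: "gap X S \<le> length S"
  by (induction X S rule: gap.induct) auto

text \<open>A random subset of \<open>S\<close> that contains each element with probability \<open>p\<close>.\<close>

lemma sum_below: "(\<Sum>X\<in>cube (length S). if below X S then p ^ ones X * (1 - p) ^ gap X S else 0) = (1::real)"
proof (induction S)
  case (Cons s S)
  have "(\<Sum>X\<in>cube (length S). (if below (True # X) (s # S) then p ^ ones (True # X) * (1 - p) ^ gap (True # X) (s # S) else 0)
        + (if below (False # X) (s # S) then p ^ ones (False # X) * (1 - p) ^ gap (False # X) (s # S) else 0))
     = (\<Sum>X\<in>cube (length S). if below X S then p ^ ones X * (1 - p) ^ gap X S else 0)"
    by (intro sum.cong refl) (auto simp: algebra_simps)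
  then show ?case using Cons by (simp add: sum_cube_Suc)
qed simp

text \<open>The binomial theorem, with the sum taken over subsets instead of sizes.\<close>

lemma sum_ones: "(\<Sum>X\<in>cube n. p ^ ones X * b ^ (n - ones X)) = (p + b) ^ n" for p b :: real
proof (induction n)
  case (Suc n)
  have "(\<Sum>X\<in>cube (Suc n). p ^ ones X * b ^ (Suc n - ones X)) = (\<Sum>X\<in>cube n. (p + b) * (p ^ ones X * b ^ (n - ones X)))"
    unfolding sum_cube_Suc
  proof (intro sum.cong refl)
    fix X assume "X \<in> cube n"
    then show "p ^ ones (True # X) * b ^ (Suc n - ones (True # X)) + p ^ ones (False # X) * b ^ (Suc n - ones (False # X))
      = (p + b) * (p ^ ones X * b ^ (n - ones X))"
      using ones_le[of X] by (simp add: Suc_diff_le algebra_simps)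
  qed
  then show ?case using Suc by (simp flip: sum_distrib_left)
qed simp

text \<open>With \<open>p = 1 - 1 / c\<close> the factors \<open>(1 - p)\<^sup>r\<close> and \<open>c\<^sup>r\<close> cancel, so that \<open>p\<^sup>|\<^sup>X\<^sup>| (1 - p)\<^sup>r\<close> is a fractional
  cover of weight \<open>(n + 1) (b + p)\<^sup>n\<close>; the greedy algorithm loses another factor \<open>n + 1\<close>.\<close>

lemma cube_cover_exists:
  fixes b c :: real
  assumes "b \<ge> 1" "c \<ge> 1"
  shows "\<exists>T. finite T \<and> (\<forall>(X, r)\<in>T. length X = n) \<and>
    (\<forall>S\<in>cube n. \<exists>(X, r)\<in>T. below X S \<and> gap X S \<le> r) \<and>
    (\<Sum>(X, r)\<in>T. b ^ (n - ones X) * c ^ r) \<le> (real n + 1) ^ 2 * (1 + b - 1 / c) ^ n"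
proof -
  define p where "p = 1 - 1 / c"
  have p: "0 \<le> p" "(1 - p) * c = 1" "p \<le> 1" using assms by (auto simp: p_def field_simps)
  define T where "T = cube n \<times> {..n}"
  define x where "x = (\<lambda>(X, r). p ^ ones X * (1 - p) ^ r)"
  define w where "w = (\<lambda>(X, r). b ^ (n - ones X) * c ^ r)"
  define cv where "cv = (\<lambda>(X, r) S. below X S \<and> gap X S \<le> r)"
  have "\<exists>T'\<subseteq>T. (\<forall>S\<in>cube n. \<exists>t\<in>T'. cv t S) \<and> sum w T' \<le> (\<Sum>t\<in>T. x t * w t) * (\<Sum>i=1..card (cube n). 1 / real i)"
  proof (rule greedy_weighted_cover)
    fix S assume S: "S \<in> cube n"
    have "1 = (\<Sum>X\<in>cube n. if below X S then p ^ ones X * (1 - p) ^ gap X S else 0)"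
      using sum_below[where p = p and S = S] S by simp
    also have "\<dots> = (\<Sum>X | X \<in> cube n \<and> below X S. p ^ ones X * (1 - p) ^ gap X S)"
      using sum.inter_filter[of "cube n" "\<lambda>X. p ^ ones X * (1 - p) ^ gap X S" "\<lambda>X. below X S"] by simp
    \<comment> \<open>Each X below S is paired with its exact budget. These pairs cover S, and their
      \<open>x\<close>-values are the probabilities of a distribution on the subsets of S, which add
      up to 1.\<close>
    also have "\<dots> = sum x ((\<lambda>X. (X, gap X S)) ` {X \<in> cube n. below X S})"
      by (subst sum.reindex) (auto simp: x_def inj_on_def)
    also have "\<dots> \<le> (\<Sum>t | t \<in> T \<and> cv t S. x t)"
    proof (rule sum_mono2)
      show "finite {t \<in> T. cv t S}" by (simp add: T_def)
      show "(\<lambda>X. (X, gap X S)) ` {X \<in> cube n. below X S} \<subseteq> {t \<in> T. cv t S}"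
        using gap_le[of _ S] S by (auto simp: T_def cv_def)
    qed (use p in \<open>auto simp: x_def\<close>)
    finally show "1 \<le> (\<Sum>t | t \<in> T \<and> cv t S. x t)" .
  qed (use assms p in \<open>auto simp: T_def w_def x_def\<close>)
  then obtain T' where T': "T' \<subseteq> T" "\<forall>S\<in>cube n. \<exists>t\<in>T'. cv t S"
    "sum w T' \<le> (\<Sum>t\<in>T. x t * w t) * (\<Sum>i=1..card (cube n). 1 / real i)" by blast
  have "(\<Sum>t\<in>T. x t * w t) = (\<Sum>X\<in>cube n. \<Sum>r\<le>n. x (X, r) * w (X, r))"
    by (simp add: T_def sum.cartesian_product)
  also have "\<dots> = (\<Sum>X\<in>cube n. \<Sum>r\<le>n. p ^ ones X * b ^ (n - ones X) * ((1 - p) * c) ^ r)"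
    by (intro sum.cong refl) (simp only: x_def w_def split power_mult_distrib mult_ac)
  also have "\<dots> = (real n + 1) * (\<Sum>X\<in>cube n. p ^ ones X * b ^ (n - ones X))"
    unfolding p(2) by (simp add: sum_distrib_left mult_ac add.commute)
  also have "\<dots> = (real n + 1) * (1 + b - 1 / c) ^ n"
    unfolding sum_ones by (simp add: p_def algebra_simps)
  finally have V: "(\<Sum>t\<in>T. x t * w t) = (real n + 1) * (1 + b - 1 / c) ^ n" .
  have "1 + b - 1 / c \<ge> 0" using assms(1) p(1) unfolding p_def by linarith
  then have "(real n + 1) * (1 + b - 1 / c) ^ n * (\<Sum>i=1..card (cube n). 1 / real i)
      \<le> (real n + 1) * (1 + b - 1 / c) ^ n * (real n + 1)"
    unfolding card_cube by (intro mult_left_mono harmonic_two_power_le) auto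
  then have "sum w T' \<le> (real n + 1) ^ 2 * (1 + b - 1 / c) ^ n"
    using T'(3) unfolding V power2_eq_square by (simp only: mult_ac)
  moreover have "finite T'" using finite_subset[OF T'(1)] by (simp add: T_def)
  moreover have "\<forall>(X, r)\<in>T'. length X = n" using T'(1) by (auto simp: T_def)
  ultimately show ?thesis using T'(2) unfolding w_def cv_def by (intro exI[of _ T']) fastforce
qed

section \<open>Binary numbers and validity of covers\<close>

lemma iter_enc_list: "iter g (enc_list f xs) a = fold (\<lambda>x. g (f x)) xs a"
  by (induction xs arbitrary: a) auto

fun tlist :: "tree \<Rightarrow> tree list" where
  "tlist Leaf = []"
| "tlist (Node x y) = x # tlist y"

lemma enc_tlist [simp]: "enc_list (\<lambda>x. x) (tlist l) = l"
  by (induction l) auto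

lemma length_tlist [simp]: "length (tlist l) = tlen l"
  by (induction l) auto

lemma tlist_enc [simp]: "tlist (enc_list f xs) = map f xs"
  by (induction xs) auto

lemma tlen_enc [simp]: "tlen (enc_list f xs) = length xs"
  by (induction xs) auto

lemma iter_tlist: "iter g l a = fold g (tlist l) a"
  by (induction l arbitrary: a) auto

text \<open>The body is bounded only at accumulators that the loop really reaches; this is where
  loop invariants enter the cost estimates.\<close>

lemma iter_cost_enc_le:
  assumes "\<And>ys x zs. xs = ys @ x # zs \<Longrightarrow> c (f x) (fold (\<lambda>x. g (f x)) ys a) \<le> enat (M x)"
  shows "iter_cost g c (enc_list f xs) a \<le> enat (2 + (\<Sum>x\<leftarrow>xs. 13 + M x))"
  using assms
proof (induction xs arbitrary: a)
  case (Cons x xs)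
  have "iter_cost g c (enc_list f xs) (g (f x) a) \<le> enat (2 + (\<Sum>x\<leftarrow>xs. 13 + M x))"
    using Cons.prems[of "x # _"] by (intro Cons.IH) auto
  moreover have "c (f x) a \<le> enat (M x)" using Cons.prems[of "[]"] by simp
  ultimately have "13 + c (f x) a + iter_cost g c (enc_list f xs) (g (f x) a)
      \<le> 13 + enat (M x) + enat (2 + (\<Sum>x\<leftarrow>xs. 13 + M x))"
    by (intro add_mono) auto
  then show ?case by (simp add: numeral_eq_enat algebra_simps)
qed (simp add: numeral_eq_enat)

lemma iter_cost_finite: "(\<And>x y. c x y \<noteq> \<infinity>) \<Longrightarrow> iter_cost g c l a \<noteq> \<infinity>"
  by (induction l arbitrary: a) (auto simp: numeral_eq_enat plus_eq_infty_iff_enat)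

text \<open>Bounded loops always end, so a term can fail to halt only through a call. Pure terms
  handle candidates of unknown shape: decoding and testing a fixed candidate takes some finite time,
  which later counts as a constant.\<close>

fun pure :: "tm \<Rightarrow> bool" where
  "pure (Ret e) \<longleftrightarrow> True"
| "pure (Ite e a b) \<longleftrightarrow> pure a \<and> pure b"
| "pure (Bind i a b) \<longleftrightarrow> pure a \<and> pure b"
| "pure (For i j l a b) \<longleftrightarrow> pure b"
| "pure (Run p e) \<longleftrightarrow> (\<forall>x. runtime p x \<noteq> \<infinity>)"

lemma cost_pure: "pure a \<Longrightarrow> cost a s \<noteq> \<infinity>"
  by (induction a arbitrary: s) (auto simp: plus_eq_infty_iff_enat iter_cost_finite numeral_eq_enat)

lemma result_pure: "pure a \<Longrightarrow> result (compile a) x = den a (inp x)"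
  by (simp add: result_compile cost_pure)

lemma runtime_pure: "pure a \<Longrightarrow> runtime (compile a) x \<noteq> \<infinity>"
  by (simp add: runtime_compile cost_pure plus_eq_infty_iff_enat numeral_eq_enat)

lemma runtime_compile_le: "cost a (inp x) \<le> enat t \<Longrightarrow> t + 3 \<le> u \<Longrightarrow> runtime (compile a) x \<le> enat u"
  by (cases "cost a (inp x)") (auto simp: runtime_compile numeral_eq_enat)

lemma cost_Ite_le:
  assumes "eval_expr e s \<noteq> Leaf \<Longrightarrow> cost a s \<le> enat m" "eval_expr e s = Leaf \<Longrightarrow> cost b s \<le> enat n"
  shows "cost (Ite e a b) s \<le> enat (1 + cost_expr e + max m n)"
proof -
  have "(if eval_expr e s \<noteq> Leaf then cost a s else cost b s) \<le> enat (max m n)"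
    using assms by (auto intro: order_trans)
  then have "enat (1 + cost_expr e) + (if eval_expr e s \<noteq> Leaf then cost a s else cost b s)
      \<le> enat (1 + cost_expr e) + enat (max m n)" by (rule add_left_mono)
  then show ?thesis by simp
qed

lemma cost_Bind_le:
  assumes "cost a s \<le> enat m" "cost b (s(i := den a s)) \<le> enat n"
  shows "cost (Bind i a b) s \<le> enat (4 + m + n)"
proof -
  have "4 + cost a s + cost b (s(i := den a s)) \<le> 4 + enat m + enat n"
    by (intro add_mono assms order_refl)
  then show ?thesis by (simp add: numeral_eq_enat)
qed

lemma cost_For_le:
  assumes "eval_expr l s = enc_list f xs"
    and "\<And>ys x zs. xs = ys @ x # zs \<Longrightarrow>
      cost b (s(i := f x, j := fold (\<lambda>x y. den b (s(i := f x, j := y))) ys (eval_expr a s))) \<le> enat (M x)"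
  shows "cost (For i j l a b) s \<le> enat (6 + cost_expr a + cost_expr l + (\<Sum>x\<leftarrow>xs. 13 + M x))"
proof -
  have "iter_cost (\<lambda>x y. den b (s(i := x, j := y))) (\<lambda>x y. cost b (s(i := x, j := y))) (enc_list f xs) (eval_expr a s)
      \<le> enat (2 + (\<Sum>x\<leftarrow>xs. 13 + M x))"
    by (rule iter_cost_enc_le) (rule assms(2))
  then have "enat (4 + cost_expr a + cost_expr l) + iter_cost (\<lambda>x y. den b (s(i := x, j := y))) (\<lambda>x y. cost b (s(i := x, j := y))) (enc_list f xs) (eval_expr a s)
      \<le> enat (4 + cost_expr a + cost_expr l) + enat (2 + (\<Sum>x\<leftarrow>xs. 13 + M x))"
    by (rule add_left_mono)
  then show ?thesis using assms(1) by (simp add: add_ac)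
qed

lemma cost_For_le_const:
  assumes "eval_expr l s = enc_list f xs"
    and "\<And>ys x zs. xs = ys @ x # zs \<Longrightarrow>
      cost b (s(i := f x, j := fold (\<lambda>x y. den b (s(i := f x, j := y))) ys (eval_expr a s))) \<le> enat M"
  shows "cost (For i j l a b) s \<le> enat (6 + cost_expr a + cost_expr l + length xs * (13 + M))"
  using cost_For_le[of l s f xs b i j a "\<lambda>_. M"] assms by (simp add: sum_list_triv)

lemma cost_Run_le:
  assumes "runtime p (eval_expr e s) \<le> enat m"
  shows "cost (Run p e) s \<le> enat (call_cost p + cost_expr e + m)"
  using add_left_mono[OF assms, of "enat (call_cost p + cost_expr e)"] by simp

lemma cost_weaken: "cost a s \<le> enat m \<Longrightarrow> m \<le> n \<Longrightarrow> cost a s \<le> enat n"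
  by (meson enat_ord_simps(1) order_trans)

lemma den_For_enc: "eval_expr l s = enc_list f xs \<Longrightarrow>
    den (For i j l a b) s = fold (\<lambda>x y. den b (s(i := f x, j := y))) xs (eval_expr a s)"
  by (simp add: iter_enc_list)

abbreviation TrueE :: expr where "TrueE \<equiv> NodeE LeafE LeafE"

section \<open>Counting in binary\<close>

fun incr :: "bool list \<Rightarrow> bool list" where
  "incr [] = [True]"
| "incr (False # bs) = True # bs"
| "incr (True # bs) = False # incr bs"

lemma incr_binary: "incr (binary k) = binary (Suc k)"
proof (induction k rule: binary.induct)
  case (1 k)
  show ?case
  proof (cases "k = 0")
    case True
    then show ?thesis by (simp add: binary.simps)
  next
    case False
    with 1 show ?thesis by (cases "even k") (auto simp: binary.simps[of k] binary.simps[of "Suc k"])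
  qed
qed

lemma length_binary_le: "length (binary k) \<le> k"
proof (induction k rule: binary.induct)
  case (1 k)
  then show ?case by (subst binary.simps) auto
qed

text \<open>The carry is represented by the digits that it contributes at the end of the list.\<close>

definition inc_body :: tm where
  "inc_body = Ite (HdE (Var 3))
     (Ite (Var 2) (Ret (NodeE (HdE (Var 3)) (NodeE LeafE (TlE (Var 3)))))
        (Ret (NodeE LeafE (NodeE TrueE (TlE (Var 3))))))
     (Ret (NodeE LeafE (NodeE (Var 2) (TlE (Var 3)))))"

text \<open>The first loop adds with carry and leaves the digits in reverse order; the second puts
  them back in front of the leftover carry.\<close>

definition inc_tm :: tm where
  "inc_tm = Bind 1 (For 2 3 (Var 0) (NodeE (NodeE TrueE LeafE) LeafE) inc_body)
    (For 2 3 (TlE (Var 1)) (HdE (Var 1)) (Ret (NodeE (Var 2) (Var 3))))"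

definition inc_prog :: program where
  "inc_prog = compile inc_tm"

lemma pure_inc_tm: "pure inc_tm"
  by (simp add: inc_tm_def inc_body_def)

definition inc_step :: "tree \<Rightarrow> tree \<Rightarrow> tree" where
  "inc_step x y = (if hd_tree y \<noteq> Leaf then if x \<noteq> Leaf then Node (hd_tree y) (Node Leaf (tl_tree y))
     else Node Leaf (Node (enc_bool True) (tl_tree y)) else Node Leaf (Node x (tl_tree y)))"

lemma den_inc_body: "den inc_body s = inc_step (s 2) (s 3)"
  by (simp add: inc_body_def inc_step_def cong: if_cong)

lemma cost_inc_body: "cost inc_body s \<le> enat 20"
  by (simp add: inc_body_def)

lemma inc_loop:
  "\<exists>e out'. iter inc_step (enc_bits bs) (Node (enc_bits (if d then [True] else [])) (enc_bits out)) =
     Node (enc_bits (if e then [True] else [])) (enc_bits out') \<and> length out' = length out + length bs \<and>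
     rev out' @ (if e then [True] else []) = rev out @ (if d then incr bs else bs)"
proof (induction bs arbitrary: d out)
  case Nil
  show ?case by (intro exI[of _ d] exI[of _ out]) (simp add: enc_bits_def)
next
  case (Cons b bs)
  have "inc_step (enc_bool b) (Node (enc_bits (if d then [True] else [])) (enc_bits out)) =
     Node (enc_bits (if d \<and> b then [True] else [])) (enc_bits ((if d then \<not> b else b) # out))"
    by (cases d; cases b) (simp_all add: inc_step_def enc_bits_def)
  then have *: "iter inc_step (enc_bits (b # bs)) (Node (enc_bits (if d then [True] else [])) (enc_bits out)) =
      iter inc_step (enc_bits bs) (Node (enc_bits (if d \<and> b then [True] else [])) (enc_bits ((if d then \<not> b else b) # out)))"
    by (simp add: enc_bits_def)
  from Cons[of "d \<and> b" "(if d then \<not> b else b) # out"] obtain e out' where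
    **: "iter inc_step (enc_bits bs) (Node (enc_bits (if d \<and> b then [True] else [])) (enc_bits ((if d then \<not> b else b) # out))) =
     Node (enc_bits (if e then [True] else [])) (enc_bits out')"
     "length out' = length ((if d then \<not> b else b) # out) + length bs"
     "rev out' @ (if e then [True] else []) = rev ((if d then \<not> b else b) # out) @ (if d \<and> b then incr bs else bs)"
    by blast
  then show ?case unfolding * by (intro exI[of _ e] exI[of _ out']) (cases d; cases b; simp)
qed

lemma iter_Node: "iter Node (enc_list f xs) (enc_list f ys) = enc_list f (rev xs @ ys)"
proof (induction xs arbitrary: ys)
  case (Cons x xs)
  from Cons[of "x # ys"] show ?case by simp
qed simp

lemma inc_den: "den inc_tm (inp x) = iter Node (tl_tree (iter inc_step x (Node (enc_bits [True]) Leaf))) (hd_tree (iter inc_step x (Node (enc_bits [True]) Leaf)))"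
  by (simp add: inc_tm_def den_inc_body enc_bits_def)

lemma result_inc: "result inc_prog (enc_nat k) = enc_nat (Suc k)"
proof -
  obtain e out' where "iter inc_step (enc_bits (binary k)) (Node (enc_bits [True]) (enc_bits [])) =
     Node (enc_bits (if e then [True] else [])) (enc_bits out')"
     "rev out' @ (if e then [True] else []) = incr (binary k)"
    using inc_loop[of "binary k" True "[]"] by auto
  then show ?thesis
    unfolding inc_prog_def result_pure[OF pure_inc_tm] inc_den
    by (simp add: enc_nat_def incr_binary iter_Node enc_bits_def)
qed

lemma runtime_inc: "runtime inc_prog (enc_nat k) \<le> enat (100 + 100 * k)"
proof -
  obtain e out' where loop: "iter inc_step (enc_bits (binary k)) (Node (enc_bits [True]) (enc_bits [])) =
     Node (enc_bits (if e then [True] else [])) (enc_bits out')"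
     "length out' = length (binary k)"
    using inc_loop[of "binary k" True "[]"] by auto
  have "den (For 2 3 (Var 0) (NodeE (NodeE TrueE LeafE) LeafE) inc_body) (inp (enc_nat k)) = Node (enc_bits (if e then [True] else [])) (enc_bits out')"
    using loop(1) by (simp add: den_inc_body enc_nat_def enc_bits_def)
  note d = this
  have "cost inc_tm (inp (enc_nat k)) \<le> enat (4 + (6 + 7 + 1 + length (binary k) * (13 + 20)) + (6 + 2 + 2 + length out' * (13 + 4)))"
    unfolding inc_tm_def
  proof (rule cost_Bind_le)
    have "cost (For 2 3 (Var 0) (NodeE (NodeE TrueE LeafE) LeafE) inc_body) (inp (enc_nat k)) \<le>
       enat (6 + cost_expr (NodeE (NodeE TrueE LeafE) LeafE) + cost_expr (Var 0) + length (binary k) * (13 + 20))"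
      by (rule cost_For_le_const[where f = enc_bool]) (simp_all add: enc_nat_def enc_bits_def cost_inc_body)
    then show "cost (For 2 3 (Var 0) (NodeE (NodeE TrueE LeafE) LeafE) inc_body) (inp (enc_nat k)) \<le>
       enat (6 + 7 + 1 + length (binary k) * (13 + 20))" by (rule cost_weaken) simp
    let ?s = "(inp (enc_nat k))(1 := den (For 2 3 (Var 0) (NodeE (NodeE TrueE LeafE) LeafE) inc_body) (inp (enc_nat k)))"
    have "cost (For 2 3 (TlE (Var 1)) (HdE (Var 1)) (Ret (NodeE (Var 2) (Var 3)))) ?s \<le>
       enat (6 + cost_expr (HdE (Var 1)) + cost_expr (TlE (Var 1)) + length out' * (13 + 4))"
      unfolding d by (rule cost_For_le_const[where f = enc_bool]) (simp_all add: enc_bits_def)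
    then show "cost (For 2 3 (TlE (Var 1)) (HdE (Var 1)) (Ret (NodeE (Var 2) (Var 3)))) ?s \<le> enat (6 + 2 + 2 + length out' * (13 + 4))"
      by (rule cost_weaken) simp
  qed
  then have "cost inc_tm (inp (enc_nat k)) \<le> enat (50 + 100 * k)"
    by (rule cost_weaken) (use loop(2) length_binary_le[of k] in simp)
  then show ?thesis unfolding inc_prog_def by (rule runtime_compile_le) simp
qed

lemma runtime_inc_finite: "runtime inc_prog x \<noteq> \<infinity>"
  unfolding inc_prog_def by (rule runtime_pure[OF pure_inc_tm])

fun unary :: "nat \<Rightarrow> tree" where
  "unary 0 = Leaf"
| "unary (Suc k) = Node Leaf (unary k)"

lemma unary_eq_enc: "unary k = enc_list (\<lambda>x. x) (replicate k Leaf)"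
  by (induction k) auto

lemma tlen_unary [simp]: "tlen (unary k) = k"
  by (induction k) auto

lemma unary_eq_Leaf [simp]: "unary k = Leaf \<longleftrightarrow> k = 0"
  by (cases k) auto

lemma tl_unary [simp]: "tl_tree (unary k) = unary (k - 1)"
  by (cases k) auto

text \<open>Budgets are added in unary while a cover is expanded and converted only when a query is
  asked. Counting up is quadratic in the budget, which is affordable because budgets are linear in
  the size of the universe for a fixed cover.\<close>

definition to_binary_tm :: tm where
  "to_binary_tm = For 1 2 (Var 0) LeafE (Run inc_prog (Var 2))"

definition to_binary_prog :: program where
  "to_binary_prog = compile to_binary_tm"

lemma fold_inc: "fold (\<lambda>x. result inc_prog) xs (enc_nat k) = enc_nat (k + length xs)"
  by (induction xs arbitrary: k) (auto simp: result_inc)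

lemma enc_nat_0: "enc_nat 0 = Leaf"
  by (simp add: enc_nat_def enc_bits_def binary.simps)

lemma pure_to_binary_tm: "pure to_binary_tm"
  by (simp add: to_binary_tm_def runtime_inc_finite)

lemma result_to_binary: "result to_binary_prog (unary k) = enc_nat k"
  unfolding to_binary_prog_def result_pure[OF pure_to_binary_tm]
  using fold_inc[of "replicate k Leaf" 0] by (simp add: to_binary_tm_def iter_enc_list unary_eq_enc enc_nat_0)

lemma runtime_to_binary: "\<exists>A. \<forall>k. runtime to_binary_prog (unary k) \<le> enat (A * (k + 1) ^ 2)"
proof (intro exI allI)
  fix k
  let ?A = "300 + call_cost inc_prog"
  have "cost to_binary_tm (inp (unary k)) \<le> enat (6 + cost_expr LeafE + cost_expr (Var 0) +
      length (replicate k Leaf) * (13 + (call_cost inc_prog + cost_expr (Var 2) + (100 + 100 * k))))"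
    unfolding to_binary_tm_def
  proof (intro cost_For_le_const[where f = "\<lambda>x. x"] cost_Run_le)
    fix ys x zs assume *: "replicate k Leaf = ys @ x # zs"
    from arg_cong[OF this, of length] have "length ys \<le> k" by simp
    then have "enat (100 + 100 * length ys) \<le> enat (100 + 100 * k)" by simp
    with runtime_inc[of "length ys"] have "runtime inc_prog (enc_nat (length ys)) \<le> enat (100 + 100 * k)"
      by (rule order_trans)
    then show "runtime inc_prog (eval_expr (Var 2) ((inp (unary k))(1 := x,
         2 := fold (\<lambda>x y. den (Run inc_prog (Var 2)) ((inp (unary k))(1 := x, 2 := y))) ys (eval_expr LeafE (inp (unary k))))))
         \<le> enat (100 + 100 * k)"
      using fold_inc[of ys 0] by (simp add: enc_nat_0)
  qed (simp add: unary_eq_enc)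
  then show "runtime to_binary_prog (unary k) \<le> enat (?A * (k + 1) ^ 2)"
    unfolding to_binary_prog_def
    by (rule runtime_compile_le) (simp add: power2_eq_square algebra_simps)
qed

text \<open>Trees are written in postfix order: a digit 0 pushes \<^const>\<open>Leaf\<close> on a stack, a digit 1 joins the two
  topmost trees.\<close>

definition decode_body :: tm where
  "decode_body = Ite (Var 1)
     (Ret (NodeE (NodeE (HdE (TlE (Var 2))) (HdE (Var 2))) (TlE (TlE (Var 2)))))
     (Ret (NodeE LeafE (Var 2)))"

definition decode_tm :: tm where
  "decode_tm = Bind 3 (For 1 2 (Var 0) LeafE decode_body) (Ret (HdE (Var 3)))"

definition decode_prog :: program where
  "decode_prog = compile decode_tm"

definition decode_step :: "tree \<Rightarrow> tree \<Rightarrow> tree" where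
  "decode_step x y = (if x \<noteq> Leaf then Node (Node (hd_tree (tl_tree y)) (hd_tree y)) (tl_tree (tl_tree y)) else Node Leaf y)"

lemma den_decode_body: "den decode_body s = decode_step (s 1) (s 2)"
  by (simp add: decode_body_def decode_step_def cong: if_cong)

fun postfix :: "tree \<Rightarrow> bool list" where
  "postfix Leaf = [False]"
| "postfix (Node x y) = postfix x @ postfix y @ [True]"

lemma decode_postfix: "fold (\<lambda>x. decode_step (enc_bool x)) (postfix c) st = Node c st"
  by (induction c arbitrary: st) (auto simp: decode_step_def)

lemma binary_surj: "bs = [] \<or> last bs \<Longrightarrow> \<exists>k. binary k = bs"
proof (induction bs)
  case Nil
  show ?case by (intro exI[of _ 0]) (simp add: binary.simps)
next
  case (Cons b bs)
  then have "bs = [] \<or> last bs" by (auto split: if_splits)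
  with Cons obtain k where k: "binary k = bs" by blast
  have "k = 0 \<Longrightarrow> b" using Cons.prems k by (auto simp: binary.simps)
  then have "2 * k + of_bool b > 0" by auto
  then have "binary (2 * k + of_bool b) = b # bs" using k by (subst binary.simps) auto
  then show ?case by blast
qed

lemma pure_decode_tm: "pure decode_tm"
  by (simp add: decode_tm_def decode_body_def)

text \<open>The postfix code of a \<open>Node\<close> ends with the digit 1 and is therefore a
  binary numeral without leading zeros. So every pair of trees occurs among the candidates;
  repetitions do no harm to the search.\<close>

lemma decode_surj: "\<exists>k. result decode_prog (enc_nat k) = Node x y"
proof -
  obtain k where k: "binary k = postfix (Node x y)" using binary_surj[of "postfix (Node x y)"] by auto
  have "result decode_prog (enc_nat k) = hd_tree (fold (\<lambda>x. decode_step (enc_bool x)) (binary k) Leaf)"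
    unfolding decode_prog_def result_pure[OF pure_decode_tm]
    by (simp add: decode_tm_def den_decode_body enc_nat_def enc_bits_def iter_enc_list)
  then show ?thesis unfolding k decode_postfix by auto
qed

text \<open>Patterns are arbitrary trees, read as lists padded with \<^const>\<open>Leaf\<close>; the entries other than \<^const>\<open>Leaf\<close>
  mark a set \<open>X\<close>, and \<open>cov x r S\<close> says that \<open>X\<close> is contained in \<open>S\<close> with at most \<open>r\<close> elements of \<open>S\<close> missing.\<close>

fun cov :: "tree \<Rightarrow> nat \<Rightarrow> bool list \<Rightarrow> bool" where
  "cov x r [] \<longleftrightarrow> True"
| "cov x r (s # S) \<longleftrightarrow> (if hd_tree x \<noteq> Leaf then s \<and> cov (tl_tree x) r S
     else if s then r > 0 \<and> cov (tl_tree x) (r - 1) S else cov (tl_tree x) r S)"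

fun ins :: "nat \<Rightarrow> tree \<Rightarrow> nat" where
  "ins 0 x = 0"
| "ins (Suc m) x = of_bool (hd_tree x \<noteq> Leaf) + ins m (tl_tree x)"

lemma ins_le: "ins m x \<le> m"
proof (induction m arbitrary: x)
  case (Suc m)
  from Suc[of "tl_tree x"] show ?case by auto
qed simp

lemma cov_enc_bits: "length X = length S \<Longrightarrow> cov (enc_bits X) r S \<longleftrightarrow> below X S \<and> gap X S \<le> r"
proof (induction X S arbitrary: r rule: list_induct2)
  case (Cons x X s S)
  then show ?case by (cases x; cases s; cases r) (auto simp: enc_bits_def)
qed simp

lemma ins_enc_bits: "ins (length X) (enc_bits X) = ones X"
proof (induction X)
  case (Cons x X)
  then show ?case by (cases x) (auto simp: enc_bits_def)
qed simp

text \<open>The accumulator \<open>Node x r\<close> holds the unread pattern and the remaining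
  budget in unary; \<open>Leaf\<close> stands for failure and is absorbing.\<close>

definition cov_body :: tm where
  "cov_body = Ite (Var 2) (Ite (HdE (HdE (Var 2)))
       (Ite (Var 1) (Ret (NodeE (TlE (HdE (Var 2))) (TlE (Var 2)))) (Ret LeafE))
       (Ite (Var 1)
         (Ite (TlE (Var 2)) (Ret (NodeE (TlE (HdE (Var 2))) (TlE (TlE (Var 2))))) (Ret LeafE))
         (Ret (NodeE (TlE (HdE (Var 2))) (TlE (Var 2))))))
     (Ret LeafE)"

definition cov_prog :: program where
  "cov_prog = compile (For 1 2 (HdE (Var 0)) (TlE (Var 0)) cov_body)"

definition cov_step :: "tree \<Rightarrow> tree \<Rightarrow> tree" where
  "cov_step x y = (if y \<noteq> Leaf then if hd_tree (hd_tree y) \<noteq> Leaf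
        then if x \<noteq> Leaf then Node (tl_tree (hd_tree y)) (tl_tree y) else Leaf
        else if x \<noteq> Leaf then if tl_tree y \<noteq> Leaf then Node (tl_tree (hd_tree y)) (tl_tree (tl_tree y)) else Leaf
          else Node (tl_tree (hd_tree y)) (tl_tree y)
      else Leaf)"

lemma den_cov_body: "den cov_body s = cov_step (s 1) (s 2)"
  by (simp add: cov_body_def cov_step_def cong: if_cong)

lemma fold_cov_Leaf: "fold (\<lambda>x. cov_step (f x)) xs Leaf = Leaf"
  by (induction xs) (auto simp: cov_step_def)

lemma fold_cov: "fold (\<lambda>x. cov_step (enc_bool x)) S (Node x r) \<noteq> Leaf \<longleftrightarrow> cov x (tlen r) S"
proof (induction S arbitrary: x r)
  case (Cons s S)
  have "cov_step (enc_bool s) (Node x r) =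
    (if hd_tree x \<noteq> Leaf then if s then Node (tl_tree x) r else Leaf
     else if s then if r \<noteq> Leaf then Node (tl_tree x) (tl_tree r) else Leaf else Node (tl_tree x) r)"
    by (cases s) (auto simp: cov_step_def)
  then show ?case by (auto simp: fold_cov_Leaf Cons tlen_pos)
qed simp

lemma pure_cov: "pure (For 1 2 (HdE (Var 0)) (TlE (Var 0)) cov_body)"
  by (simp add: cov_body_def)

lemma result_cov: "result cov_prog (Node (enc_bits S) (Node x r)) \<noteq> Leaf \<longleftrightarrow> cov x (tlen r) S"
  unfolding cov_prog_def result_pure[OF pure_cov] 
  using fold_cov[of S x r] by (simp add: den_cov_body enc_bits_def iter_enc_list)

lemma runtime_cov: "runtime cov_prog x \<noteq> \<infinity>"
  unfolding cov_prog_def by (rule runtime_pure[OF pure_cov])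

definition covered_tm :: tm where
  "covered_tm = For 1 2 (HdE (Var 0)) LeafE (Ite (Var 2) (Ret (Var 2))
     (Run cov_prog (NodeE (TlE (Var 0)) (NodeE (HdE (Var 1)) (TlE (Var 1))))))"

definition covered_prog :: program where
  "covered_prog = compile covered_tm"

lemma pure_covered: "pure covered_tm"
  by (simp add: covered_tm_def runtime_cov)

lemma fold_or: "fold (\<lambda>x y. if y \<noteq> Leaf then y else f x) xs a \<noteq> Leaf \<longleftrightarrow> a \<noteq> Leaf \<or> (\<exists>x\<in>set xs. f x \<noteq> Leaf)"
  by (induction xs arbitrary: a) auto

lemma result_covered: "result covered_prog (Node C (enc_bits S)) \<noteq> Leaf \<longleftrightarrow>
    (\<exists>t\<in>set (tlist C). cov (hd_tree t) (tlen (tl_tree t)) S)"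
proof -
  have "result covered_prog (Node C (enc_bits S)) = fold (\<lambda>x y. if y \<noteq> Leaf then y else result cov_prog (Node (enc_bits S) (Node (hd_tree x) (tl_tree x)))) (tlist C) Leaf"
    unfolding covered_prog_def result_pure[OF pure_covered]
    by (simp add: covered_tm_def iter_tlist cong: if_cong)
  also have "\<dots> \<noteq> Leaf \<longleftrightarrow> (\<exists>t\<in>set (tlist C). cov (hd_tree t) (tlen (tl_tree t)) S)"
    unfolding fold_or result_cov by simp
  finally show ?thesis .
qed

lemma runtime_covered: "runtime covered_prog x \<noteq> \<infinity>"
  unfolding covered_prog_def by (rule runtime_pure[OF pure_covered])

definition cube_inner :: tm where
  "cube_inner = For 3 4 (Var 2) LeafE (Ret (NodeE (NodeE LeafE (Var 3)) (NodeE (NodeE TrueE (Var 3)) (Var 4))))"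

definition cube_tm :: tm where
  "cube_tm = For 1 2 (Var 0) (NodeE LeafE LeafE) cube_inner"

lemma cube_inner_den: "s 2 = enc_list enc_bits L \<Longrightarrow>
   \<exists>L'. den cube_inner s = enc_list enc_bits L' \<and> set L' = (#) False ` set L \<union> (#) True ` set L"
proof -
  assume s: "s 2 = enc_list enc_bits L"
  have *: "\<exists>L'. fold (\<lambda>x y. Node (Node Leaf (enc_bits x)) (Node (Node (enc_bool True) (enc_bits x)) y)) L (enc_list enc_bits A) = enc_list enc_bits L' \<and>
       set L' = (#) False ` set L \<union> (#) True ` set L \<union> set A" for A
  proof (induction L arbitrary: A)
    case (Cons x L)
    from Cons[of "(False # x) # (True # x) # A"] show ?case
      by (auto simp: enc_bits_def insert_commute)
  qed auto
  from *[of "[]"] s show ?thesis by (auto simp: cube_inner_def iter_enc_list)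
qed

lemma cube_tm_den: "\<exists>L. den cube_tm (inp x) = enc_list enc_bits L \<and> set L = cube (tlen x)"
proof -
  define g where "g = (\<lambda>y z. den cube_inner ((inp x)(1 := y, 2 := z)))"
  have g: "\<exists>L'. g y (enc_list enc_bits L) = enc_list enc_bits L' \<and> set L' = (#) False ` set L \<union> (#) True ` set L" for y L
    unfolding g_def by (rule cube_inner_den) simp
  have *: "\<exists>L'. fold g xs (enc_list enc_bits L) = enc_list enc_bits L' \<and> set L' = cube (n + length xs)"
    if "set L = cube n" for xs L n
    using that
  proof (induction xs arbitrary: L n)
    case (Cons x xs)
    obtain L' where L': "g x (enc_list enc_bits L) = enc_list enc_bits L'"
      "set L' = (#) False ` set L \<union> (#) True ` set L" using g by blast
    then have "set L' = cube (Suc n)" using Cons.prems by (auto simp: cube_Suc)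
    from Cons.IH[OF this] show ?case using L'(1) by simp
  qed auto
  have "set [[]] = cube 0" by simp
  from *[OF this, of "tlist x"] show ?thesis
    unfolding g_def by (simp add: cube_tm_def iter_tlist enc_bits_def)
qed

definition valid_tm :: tm where
  "valid_tm = Bind 1 (Run (compile cube_tm) (NodeE LeafE (HdE (Var 0))))
     (For 2 3 (Var 1) TrueE (Ite (Var 3) (Run covered_prog (NodeE (TlE (Var 0)) (Var 2))) (Ret LeafE)))"

definition valid_prog :: program where
  "valid_prog = compile valid_tm"

lemma pure_cube: "pure cube_tm"
  by (simp add: cube_tm_def cube_inner_def)

lemma pure_valid: "pure valid_tm"
  by (simp add: valid_tm_def runtime_covered runtime_pure pure_cube)

lemma fold_and: "fold (\<lambda>x y. if y \<noteq> Leaf then f x else Leaf) xs a \<noteq> Leaf \<longleftrightarrow> a \<noteq> Leaf \<and> (\<forall>x\<in>set xs. f x \<noteq> Leaf)"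
  by (induction xs arbitrary: a) auto

text \<open>A candidate is a single tree. The spine of its head has length block size minus 1, so
  that no block is empty, and its tail lists the pairs, each budget being the length of a spine.
  Every tree can be read in this way, so no separate syntax check arises.\<close>

definition valid_cover :: "tree \<Rightarrow> bool" where
  "valid_cover c \<longleftrightarrow> (\<forall>S\<in>cube (Suc (tlen (hd_tree c))). \<exists>t\<in>set (tlist (tl_tree c)). cov (hd_tree t) (tlen (tl_tree t)) S)"

lemma result_valid: "result valid_prog c \<noteq> Leaf \<longleftrightarrow> valid_cover c"
proof -
  obtain L where L: "den cube_tm (inp (Node Leaf (hd_tree c))) = enc_list enc_bits L" "set L = cube (Suc (tlen (hd_tree c)))"
    using cube_tm_den[of "Node Leaf (hd_tree c)"] by auto
  have "result valid_prog c = fold (\<lambda>x y. if y \<noteq> Leaf then result covered_prog (Node (tl_tree c) (enc_bits x)) else Leaf) L (Node Leaf Leaf)"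
    unfolding valid_prog_def result_pure[OF pure_valid]
    by (simp add: valid_tm_def result_pure[OF pure_cube] L(1) iter_enc_list cong: if_cong)
  also have "\<dots> \<noteq> Leaf \<longleftrightarrow> (\<forall>x\<in>set L. \<exists>t\<in>set (tlist (tl_tree c)). cov (hd_tree t) (tlen (tl_tree t)) x)"
    unfolding fold_and result_covered by simp
  finally show ?thesis unfolding valid_cover_def L(2) .
qed

lemma runtime_valid: "runtime valid_prog x \<noteq> \<infinity>"
  unfolding valid_prog_def by (rule runtime_pure[OF pure_valid])

section \<open>Expansion of a cover over the universe\<close>

text \<open>A query \<open>(x, k, X, Y)\<close> asks for an extension of \<open>X\<close> by at most \<open>k\<close> elements; \<open>Y\<close> collects the other
  elements of the universe seen so far, and \<open>x\<close> is the unused part of the current pattern.\<close>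

type_synonym query = "tree \<times> nat \<times> bitstring list \<times> bitstring list"

fun enc_query :: "query \<Rightarrow> tree" where
  "enc_query (x, k, X, Y) = Node x (Node (unary k) (Node (enc_list enc_bits X) (enc_list enc_bits Y)))"

fun advance :: "bitstring \<Rightarrow> query \<Rightarrow> query" where
  "advance u (x, k, X, Y) = (if hd_tree x \<noteq> Leaf then (tl_tree x, k, u # X, Y) else (tl_tree x, k, X, u # Y))"

fun renew :: "tree \<Rightarrow> query \<Rightarrow> query" where
  "renew t (x, k, X, Y) = (hd_tree t, k + tlen (tl_tree t), X, Y)"

definition cross :: "tree list \<Rightarrow> query list \<Rightarrow> query list" where
  "cross ts Q = fold (\<lambda>t A. rev (map (renew t) Q) @ A) ts []"

text \<open>The length of the first component is the number of positions left in the current block.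
  Once it is empty, a new block begins: every query is combined with every pair, and
  \<open>u\<close> is consumed at once, which is why the head of \<open>c\<close> has length block
  size minus 1. The reversals come from loops that push their results onto a list.\<close>

definition step :: "tree \<Rightarrow> bitstring \<Rightarrow> tree \<times> query list \<Rightarrow> tree \<times> query list" where
  "step c u = (\<lambda>(l, Q). if l \<noteq> Leaf then (tl_tree l, rev (map (advance u) Q))
     else (hd_tree c, rev (map (advance u) (cross (tlist (tl_tree c)) Q))))"

definition expansion :: "tree \<Rightarrow> bitstring list \<Rightarrow> tree \<times> query list" where
  "expansion c us = fold (step c) us (Leaf, [(Leaf, 0, [], [])])"

lemma expansion_snoc: "expansion c (us @ [u]) = step c u (expansion c us)"
  by (simp add: expansion_def)

lemma expansion_Nil: "expansion c [] = (Leaf, [(Leaf, 0, [], [])])"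
  by (simp add: expansion_def)

lemma set_cross: "set (cross ts Q) = (\<Union>t\<in>set ts. renew t ` set Q)"
proof -
  have "set (fold (\<lambda>t A. rev (map (renew t) Q) @ A) ts A) = (\<Union>t\<in>set ts. renew t ` set Q) \<union> set A" for A
    by (induction ts arbitrary: A) auto
  then show ?thesis by (simp add: cross_def)
qed

lemma sum_cross: "(\<Sum>q\<leftarrow>cross ts Q. f q) = (\<Sum>t\<leftarrow>ts. \<Sum>q\<leftarrow>Q. f (renew t q))" for f :: "query \<Rightarrow> real"
proof -
  have "(\<Sum>q\<leftarrow>fold (\<lambda>t A. rev (map (renew t) Q) @ A) ts A. f q) = (\<Sum>t\<leftarrow>ts. \<Sum>q\<leftarrow>Q. f (renew t q)) + (\<Sum>q\<leftarrow>A. f q)" for A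
    by (induction ts arbitrary: A) (simp_all add: rev_map sum_list_rev o_def flip: rev_map)
  then show ?thesis by (simp add: cross_def)
qed

lemma length_cross: "length (cross ts Q) = length ts * length Q"
proof -
  have "length (fold (\<lambda>t A. rev (map (renew t) Q) @ A) ts A) = length ts * length Q + length A" for A
    by (induction ts arbitrary: A) simp_all
  then show ?thesis by (simp add: cross_def)
qed

definition block :: "tree \<Rightarrow> nat" where
  "block c = Suc (tlen (hd_tree c))"

definition cover_weight :: "real \<Rightarrow> real \<Rightarrow> tree \<Rightarrow> real" where
  "cover_weight b c t = (\<Sum>i\<leftarrow>tlist (tl_tree t). b ^ (block t - ins (block t) (hd_tree i)) * c ^ tlen (tl_tree i))"

text \<open>With \<open>m\<close> positions of the block left, the pattern already decides how many
  of them go to \<open>Y\<close>; the exponent of \<open>b\<close> is the size that \<open>Y\<close>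
  will have at the end of the block.\<close>

fun weight :: "real \<Rightarrow> real \<Rightarrow> nat \<Rightarrow> query \<Rightarrow> real" where
  "weight b c m (x, k, X, Y) = b ^ (length Y + m - ins m x) * c ^ k"

lemma weight_advance: "weight b c m (advance u q) = weight b c (Suc m) q"
proof (cases q)
  case (fields x k X Y)
  have "ins m (tl_tree x) \<le> m" by (rule ins_le)
  then show ?thesis by (simp add: fields)
qed

lemma weight_renew: "weight b c m (renew t q) = b ^ (m - ins m (hd_tree t)) * c ^ tlen (tl_tree t) * weight b c 0 q"
proof (cases q)
  case (fields x k X Y)
  have "ins m (hd_tree t) \<le> m" by (rule ins_le)
  then have "length Y + m - ins m (hd_tree t) = length Y + (m - ins m (hd_tree t))" by simp
  then show ?thesis by (simp add: fields power_add)
qed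

text \<open>Looking ahead to the end of the block makes \<open>advance\<close> preserve weights, so
  the total changes only when a block begins, and then by the factor
  \<open>cover_weight b c t\<close>. The witness \<open>j\<close> counts the blocks begun.\<close>

lemma expansion_weight:
  assumes "expansion t us = (l, Q)"
  shows "\<exists>j. j * block t = length us + tlen l \<and> (\<Sum>q\<leftarrow>Q. weight b c (tlen l) q) = cover_weight b c t ^ j"
  using assms
proof (induction us arbitrary: l Q rule: rev_induct)
  case Nil
  then show ?case by (intro exI[of _ 0]) (auto simp: expansion_Nil)
next
  case (snoc u us)
  obtain l' Q' where e: "expansion t us = (l', Q')" by fastforce
  from snoc.IH[OF this] obtain j where j: "j * block t = length us + tlen l'"
    "(\<Sum>q\<leftarrow>Q'. weight b c (tlen l') q) = cover_weight b c t ^ j" by blast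
  show ?case
  proof (cases "l' = Leaf")
    case False
    then have l: "l = tl_tree l'" "Q = rev (map (advance u) Q')"
      using snoc.prems by (auto simp: expansion_snoc e step_def)
    have s: "tlen l' = Suc (tlen l)" using False l by (cases l') auto
    have "(\<Sum>q\<leftarrow>Q. weight b c (tlen l) q) = (\<Sum>q\<leftarrow>Q'. weight b c (tlen l') q)"
      by (simp add: l(2) s rev_map sum_list_rev o_def weight_advance flip: rev_map)
    then show ?thesis using j s by (intro exI[of _ j]) simp
  next
    case True
    then have l: "l = hd_tree t" "Q = rev (map (advance u) (cross (tlist (tl_tree t)) Q'))"
      using snoc.prems by (auto simp: expansion_snoc e step_def)
    have B: "Suc (tlen l) = block t" by (simp add: l block_def)
    have "(\<Sum>q\<leftarrow>Q. weight b c (tlen l) q) = (\<Sum>q\<leftarrow>cross (tlist (tl_tree t)) Q'. weight b c (block t) q)"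
      by (simp add: l(2) rev_map sum_list_rev o_def weight_advance B flip: rev_map)
    also have "\<dots> = cover_weight b c t * (\<Sum>q\<leftarrow>Q'. weight b c 0 q)"
      by (simp add: sum_cross weight_renew cover_weight_def sum_list_const_mult sum_list_mult_const)
    finally have "(\<Sum>q\<leftarrow>Q. weight b c (tlen l) q) = cover_weight b c t ^ Suc j"
      using j(2) True by simp
    moreover have "Suc j * block t = length (us @ [u]) + tlen l" using j(1) True B by simp
    ultimately show ?thesis by blast
  qed
qed

text \<open>At most one block begins per element, and it adds at most \<open>R\<close> to a budget.
  This crude bound keeps unary budgets of polynomial length.\<close>

lemma expansion_sets:
  assumes "expansion t us = (l, Q)" "distinct us" "\<And>i. i \<in> set (tlist (tl_tree t)) \<Longrightarrow> tlen (tl_tree i) \<le> R"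
    "(x, k, X, Y) \<in> set Q"
  shows "distinct (X @ Y) \<and> set X \<union> set Y = set us \<and> k \<le> R * length us"
  using assms
proof (induction us arbitrary: l Q x k X Y rule: rev_induct)
  case Nil
  then show ?case by (auto simp: expansion_Nil)
next
  case (snoc u us)
  obtain l' Q' where e: "expansion t us = (l', Q')" by fastforce
  have "\<exists>x' k' X' Y'. (x', k', X', Y') \<in> set Q' \<and> k \<le> k' + R \<and> (X = u # X' \<and> Y = Y' \<or> X = X' \<and> Y = u # Y')"
  proof (cases "l' = Leaf")
    case False
    then have "Q = rev (map (advance u) Q')"
      using snoc.prems by (auto simp: expansion_snoc e step_def)
    then show ?thesis using snoc.prems(4) by (fastforce split: if_splits)
  next
    case True
    then have "Q = rev (map (advance u) (cross (tlist (tl_tree t)) Q'))"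
      using snoc.prems by (auto simp: expansion_snoc e step_def)
    then obtain i q where q: "i \<in> set (tlist (tl_tree t))" "q \<in> set Q'" "(x, k, X, Y) = advance u (renew i q)"
      using snoc.prems(4) by (auto simp: set_cross)
    then show ?thesis using snoc.prems(3)[OF q(1)] by (cases q) (fastforce split: if_splits)
  qed
  then obtain x' k' X' Y' where q: "(x', k', X', Y') \<in> set Q'" "k \<le> k' + R"
    "X = u # X' \<and> Y = Y' \<or> X = X' \<and> Y = u # Y'" by blast
  have "distinct (X' @ Y') \<and> set X' \<union> set Y' = set us \<and> k' \<le> R * length us"
    using snoc.IH[OF e _ snoc.prems(3) q(1)] snoc.prems(2) by simp
  then show ?case using q(2,3) snoc.prems(2) by auto
qed

text \<open>The part of \<open>S\<close> among the next \<open>m\<close> elements \<open>vs\<close>,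
  padded with \<open>False\<close> because the universe may end inside a block.\<close>

definition future :: "bitstring set \<Rightarrow> nat \<Rightarrow> bitstring list \<Rightarrow> bool list" where
  "future S m vs = map (\<lambda>v. v \<in> S) (take m vs) @ replicate (m - length vs) False"

lemma future_Suc: "future S (Suc m) (v # vs) = (v \<in> S) # future S m vs"
  by (simp add: future_def)

lemma length_future [simp]: "length (future S m vs) = m"
  by (simp add: future_def)

text \<open>The list \<open>vs\<close> stands for the elements still to come, since a pair chosen at
  the start of a block must fit \<open>S\<close> on the entire block. The share \<open>r\<close> of
  the budget is reserved for elements of \<open>S\<close> missed later in this block; the rest pays
  for those already in \<open>Y\<close>. After the last element, \<open>X\<close> can thus be
  completed to \<open>S\<close> within the budget.\<close>

lemma expansion_covers:
  assumes "valid_cover t" "expansion t us = (l, Q)"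
  shows "\<exists>x k X Y r. (x, k, X, Y) \<in> set Q \<and> set X \<subseteq> S \<and> cov x r (future S (tlen l) vs) \<and>
    length (filter (\<lambda>y. y \<in> S) Y) + r \<le> k"
  using assms(2)
proof (induction us arbitrary: l Q vs rule: rev_induct)
  case Nil
  then show ?case by (intro exI[of _ Leaf] exI[of _ 0] exI[of _ "[]"]) (auto simp: expansion_Nil future_def)
next
  case (snoc u us)
  obtain l' Q' where e: "expansion t us = (l', Q')" by fastforce
  have adv: "\<exists>x k X Y r. (x, k, X, Y) \<in> advance u ` A \<and> set X \<subseteq> S \<and> cov x r (future S m vs) \<and>
    length (filter (\<lambda>y. y \<in> S) Y) + r \<le> k"
    if "(x, k, X, Y) \<in> A" "set X \<subseteq> S" "cov x r (future S (Suc m) (u # vs))" "length (filter (\<lambda>y. y \<in> S) Y) + r \<le> k"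
    for x k X Y r m A
  proof -
    have "\<exists>x' X' Y' r'. advance u (x, k, X, Y) = (x', k, X', Y') \<and> set X' \<subseteq> S \<and> cov x' r' (future S m vs) \<and>
       length (filter (\<lambda>y. y \<in> S) Y') + r' \<le> k"
      using that by (cases r) (auto simp: future_Suc split: if_splits)
    then show ?thesis using that(1) by (metis image_eqI)
  qed
  show ?case
  proof (cases "l' = Leaf")
    case False
    then have l: "l = tl_tree l'" "Q = rev (map (advance u) Q')"
      using snoc.prems by (auto simp: expansion_snoc e step_def)
    have s: "tlen l' = Suc (tlen l)" using False l by (cases l') auto
    from snoc.IH[OF e, of "u # vs"] obtain x k X Y r where
      "(x, k, X, Y) \<in> set Q'" "set X \<subseteq> S" "cov x r (future S (Suc (tlen l)) (u # vs))" "length (filter (\<lambda>y. y \<in> S) Y) + r \<le> k"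
      unfolding s by blast
    from adv[OF this] show ?thesis by (simp add: l(2))
  next
    case True
    then have l: "l = hd_tree t" "Q = rev (map (advance u) (cross (tlist (tl_tree t)) Q'))"
      using snoc.prems by (auto simp: expansion_snoc e step_def)
    from snoc.IH[OF e, of "u # vs"] obtain x k X Y r where
      q: "(x, k, X, Y) \<in> set Q'" "set X \<subseteq> S" "length (filter (\<lambda>y. y \<in> S) Y) + r \<le> k"
      by blast
    \<comment> \<open>Validity of the cover supplies the pair: the vector of \<open>S\<close> on the
      new block, padded if necessary, is covered by one of them.\<close>
    obtain i where i: "i \<in> set (tlist (tl_tree t))" "cov (hd_tree i) (tlen (tl_tree i)) (future S (Suc (tlen l)) (u # vs))"
      using assms(1) unfolding valid_cover_def l(1) by fastforce
    have "renew i (x, k, X, Y) \<in> set (cross (tlist (tl_tree t)) Q')"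
      using i(1) q(1) unfolding set_cross by blast
    then have "(hd_tree i, k + tlen (tl_tree i), X, Y) \<in> set (cross (tlist (tl_tree t)) Q')" by simp
    from adv[OF this q(2) i(2)] q(3) show ?thesis by (simp add: l(2))
  qed
qed

section \<open>Programs that compute the expansion\<close>

definition renew_tm :: tm where
  "renew_tm = Bind 5 (For 6 7 (TlE (Var 1)) (HdE (TlE (Var 3))) (Ret (NodeE LeafE (Var 7))))
     (Ret (NodeE (NodeE (HdE (Var 1)) (NodeE (Var 5) (TlE (TlE (Var 3))))) (Var 4)))"

definition cross_tm :: tm where
  "cross_tm = For 1 2 (HdE (Var 0)) LeafE (For 3 4 (TlE (Var 0)) (Var 2) renew_tm)"

definition advance_tm :: tm where
  "advance_tm = Ite (HdE (HdE (Var 1)))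
     (Ret (NodeE (NodeE (TlE (HdE (Var 1))) (NodeE (HdE (TlE (Var 1)))
        (NodeE (NodeE (HdE (Var 0)) (HdE (TlE (TlE (Var 1))))) (TlE (TlE (TlE (Var 1))))))) (Var 2)))
     (Ret (NodeE (NodeE (TlE (HdE (Var 1))) (NodeE (HdE (TlE (Var 1)))
        (NodeE (HdE (TlE (TlE (Var 1)))) (NodeE (HdE (Var 0)) (TlE (TlE (TlE (Var 1)))))))) (Var 2)))"

definition cross_prog :: program where
  "cross_prog = compile cross_tm"

definition advance_prog :: program where
  "advance_prog = compile (For 1 2 (TlE (Var 0)) LeafE advance_tm)"

definition expand_body :: tm where
  "expand_body = Ite (HdE (Var 2))
     (Bind 3 (Run advance_prog (NodeE (Var 1) (TlE (Var 2)))) (Ret (NodeE (TlE (HdE (Var 2))) (Var 3))))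
     (Bind 3 (Run cross_prog (NodeE (TlE (HdE (Var 0))) (TlE (Var 2))))
       (Bind 4 (Run advance_prog (NodeE (Var 1) (Var 3))) (Ret (NodeE (HdE (HdE (Var 0))) (Var 4)))))"

definition expand_tm :: tm where
  "expand_tm = Bind 5 (For 1 2 (TlE (Var 0))
       (NodeE LeafE (NodeE (NodeE LeafE (NodeE LeafE (NodeE LeafE LeafE))) LeafE)) expand_body)
     (Ret (TlE (Var 5)))"

definition expand_prog :: program where
  "expand_prog = compile expand_tm"

lemma iter_unary: "iter (\<lambda>x. Node Leaf) r (unary k) = unary (k + tlen r)"
proof (induction r arbitrary: k)
  case (Node x y)
  from Node.IH(2)[of "Suc k"] show ?case by simp
qed simp

lemma den_renew: "s 3 = enc_query q \<Longrightarrow> den renew_tm s = Node (enc_query (renew (s 1) q)) (s 4)"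
  by (cases q) (simp add: renew_tm_def iter_unary)

lemma cost_renew: "cost renew_tm s \<le> enat (40 + 20 * tlen (tl_tree (s 1)))"
  unfolding renew_tm_def
  by (rule cost_weaken, rule cost_Bind_le, rule cost_For_le_const[where f = "\<lambda>x. x" and xs = "tlist (tl_tree (s 1))" and M = 4]) auto

lemma fold_renew: "fold (\<lambda>q. Node (enc_query (renew t q))) Q (enc_list enc_query A) = enc_list enc_query (rev (map (renew t) Q) @ A)"
proof (induction Q arbitrary: A)
  case (Cons q Q)
  from Cons.IH[of "renew t q # A"] show ?case by simp
qed simp

lemma den_renew_loop:
  "s 0 = Node C (enc_list enc_query Q) \<Longrightarrow> s 2 = enc_list enc_query A \<Longrightarrow>
   den (For 3 4 (TlE (Var 0)) (Var 2) renew_tm) s = enc_list enc_query (rev (map (renew (s 1)) Q) @ A)"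
  by (simp add: iter_enc_list den_renew fold_renew)

lemma pure_cross: "pure cross_tm"
  by (simp add: cross_tm_def renew_tm_def)

lemma result_cross: "result cross_prog (Node C (enc_list enc_query Q)) = enc_list enc_query (cross (tlist C) Q)"
proof -
  define g where "g = (\<lambda>t y. den (For 3 4 (TlE (Var 0)) (Var 2) renew_tm) ((inp (Node C (enc_list enc_query Q)))(1 := t, 2 := y)))"
  have g: "g t (enc_list enc_query A) = enc_list enc_query (rev (map (renew t) Q) @ A)" for t A
    unfolding g_def by (subst den_renew_loop) simp_all
  have "fold g ts (enc_list enc_query A) = enc_list enc_query (fold (\<lambda>t A. rev (map (renew t) Q) @ A) ts A)" for ts A
    by (induction ts arbitrary: A) (simp_all add: g)
  note fold = this
  have "den cross_tm (inp (Node C (enc_list enc_query Q))) = iter g C Leaf"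
    unfolding cross_tm_def g_def by simp
  then show ?thesis
    using fold[of "tlist C" "[]"]
    unfolding cross_prog_def result_pure[OF pure_cross] by (simp add: iter_tlist cross_def)
qed

lemma runtime_cross:
  assumes "\<And>i. i \<in> set (tlist C) \<Longrightarrow> tlen (tl_tree i) \<le> R"
  shows "runtime cross_prog (Node C (enc_list enc_query Q)) \<le> enat (30 + tlen C * (30 + length Q * (60 + 20 * R)))"
  unfolding cross_prog_def
proof (rule runtime_compile_le)
  show "cost cross_tm (inp (Node C (enc_list enc_query Q))) \<le>
     enat (6 + cost_expr LeafE + cost_expr (HdE (Var 0)) + length (tlist C) * (13 + (6 + 1 + 2 + length Q * (13 + (40 + 20 * R)))))"
    unfolding cross_tm_def
  proof (rule cost_For_le_const[where f = "\<lambda>x. x"])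
    fix ys x zs assume xs: "tlist C = ys @ x # zs"
    define y where "y = fold (\<lambda>x y. den (For 3 4 (TlE (Var 0)) (Var 2) renew_tm) ((inp (Node C (enc_list enc_query Q)))(1 := x, 2 := y))) ys
           (eval_expr LeafE (inp (Node C (enc_list enc_query Q))))"
    have "cost (For 3 4 (TlE (Var 0)) (Var 2) renew_tm) ((inp (Node C (enc_list enc_query Q)))(1 := x, 2 := y))
       \<le> enat (6 + cost_expr (Var 2) + cost_expr (TlE (Var 0)) + length Q * (13 + (40 + 20 * R)))"
      by (rule cost_For_le_const[where f = enc_query, OF _ cost_weaken[OF cost_renew]])
        (use xs assms[of x] in simp_all)
    then show "cost (For 3 4 (TlE (Var 0)) (Var 2) renew_tm) ((inp (Node C (enc_list enc_query Q)))(1 := x, 2 := y))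
       \<le> enat (6 + 1 + 2 + length Q * (13 + (40 + 20 * R)))" by (rule cost_weaken) simp
  qed simp
qed (simp add: algebra_simps)

lemma den_advance: "s 0 = Node (enc_bits u) Q \<Longrightarrow> s 1 = enc_query q \<Longrightarrow>
    den advance_tm s = Node (enc_query (advance u q)) (s 2)"
  by (cases q) (simp add: advance_tm_def)

lemma cost_advance: "cost advance_tm s \<le> enat 40"
  by (simp add: advance_tm_def)

lemma pure_advance: "pure (For 1 2 (TlE (Var 0)) LeafE advance_tm)"
  by (simp add: advance_tm_def)

lemma result_advance:
  "result advance_prog (Node (enc_bits u) (enc_list enc_query Q)) = enc_list enc_query (rev (map (advance u) Q))"
proof -
  have "fold (\<lambda>q. Node (enc_query (advance u q))) Q (enc_list enc_query A) = enc_list enc_query (rev (map (advance u) Q) @ A)" for A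
  proof (induction Q arbitrary: A)
    case (Cons q Q)
    from Cons.IH[of "advance u q # A"] show ?case by simp
  qed simp
  from this[of "[]"] show ?thesis
    unfolding advance_prog_def result_pure[OF pure_advance] by (simp add: iter_enc_list den_advance)
qed

lemma runtime_advance: "runtime advance_prog (Node u (enc_list enc_query Q)) \<le> enat (30 + length Q * 60)"
  unfolding advance_prog_def
  by (rule runtime_compile_le, rule cost_For_le_const[where f = enc_query and xs = Q, OF _ cost_weaken[OF cost_advance order_refl]])
    (simp_all add: algebra_simps)

lemma runtime_advance_finite: "runtime advance_prog x \<noteq> \<infinity>"
  unfolding advance_prog_def by (rule runtime_pure[OF pure_advance])

lemma runtime_cross_finite: "runtime cross_prog x \<noteq> \<infinity>"
  unfolding cross_prog_def by (rule runtime_pure[OF pure_cross])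

fun enc_state :: "tree \<times> query list \<Rightarrow> tree" where
  "enc_state (l, Q) = Node l (enc_list enc_query Q)"

lemma den_expand_body:
  assumes "s 0 = Node c U" "s 1 = enc_bits u" "s 2 = enc_state z"
  shows "den expand_body s = enc_state (step c u z)"
  using assms by (cases z) (simp add: expand_body_def step_def result_advance result_cross cong: if_cong)

lemma cost_expand_body:
  assumes "\<And>i. i \<in> set (tlist (tl_tree c)) \<Longrightarrow> tlen (tl_tree i) \<le> R"
    and "s 0 = Node c U" "s 1 = enc_bits u" "s 2 = enc_state (l, Q)" "length Q \<le> M"
  shows "cost expand_body s \<le> enat ((200 + 2 * call_cost advance_prog + call_cost cross_prog + tlen (tl_tree c) * (200 + 20 * R)) * (M + 1))"
proof -
  let ?L = "tlen (tl_tree c)"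
  have "cost expand_body s \<le> enat (1 + cost_expr (HdE (Var 2)) + max
      (4 + (call_cost advance_prog + cost_expr (NodeE (Var 1) (TlE (Var 2))) + (30 + length Q * 60)) + 10)
      (4 + (call_cost cross_prog + cost_expr (NodeE (TlE (HdE (Var 0))) (TlE (Var 2))) + (30 + ?L * (30 + length Q * (60 + 20 * R)))) +
        (4 + (call_cost advance_prog + cost_expr (NodeE (Var 1) (Var 3)) + (30 + ?L * length Q * 60)) + 10)))"
    unfolding expand_body_def
  proof (intro cost_Ite_le cost_Bind_le cost_Run_le)
    show "runtime advance_prog (eval_expr (NodeE (Var 1) (TlE (Var 2))) s) \<le> enat (30 + length Q * 60)"
      using assms(4) runtime_advance by simp
    show "runtime cross_prog (eval_expr (NodeE (TlE (HdE (Var 0))) (TlE (Var 2))) s) \<le> enat (30 + ?L * (30 + length Q * (60 + 20 * R)))"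
    proof -
      have "runtime cross_prog (Node (tl_tree c) (enc_list enc_query Q)) \<le> enat (30 + ?L * (30 + length Q * (60 + 20 * R)))"
        by (rule runtime_cross) (rule assms(1))
      then show ?thesis using assms(2,4) by (simp del: tlen_tl)
    qed
    show "runtime advance_prog (eval_expr (NodeE (Var 1) (Var 3)) (s(3 := den (Run cross_prog (NodeE (TlE (HdE (Var 0))) (TlE (Var 2)))) s)))
      \<le> enat (30 + ?L * length Q * 60)"
      using assms(2,4) runtime_advance[of _ "cross (tlist (tl_tree c)) Q"] by (simp add: result_cross length_cross)
  qed simp_all
  moreover obtain d where "M = length Q + d" using assms(5) le_Suc_ex by blast
  ultimately show ?thesis by (elim cost_weaken) (simp add: algebra_simps del: tlen_tl)
qed

lemma fold_expand:
  assumes "s 0 = Node c U"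
  shows "fold (\<lambda>x y. den expand_body (s(1 := enc_bits x, 2 := y))) us (enc_state z) = enc_state (fold (step c) us z)"
proof -
  define g where "g = (\<lambda>x y. den expand_body (s(1 := enc_bits x, 2 := y)))"
  have "g x (enc_state z) = enc_state (step c x z)" for x z
    unfolding g_def by (rule den_expand_body[where U = U]) (use assms in simp_all)
  then have "fold g us (enc_state z) = enc_state (fold (step c) us z)" for z
    by (induction us arbitrary: z) simp_all
  then show ?thesis unfolding g_def .
qed

lemma pure_expand: "pure expand_tm"
  by (simp add: expand_tm_def expand_body_def runtime_advance_finite runtime_cross_finite)

lemma result_expand: "result expand_prog (Node c (enc_list enc_bits us)) = enc_list enc_query (snd (expansion c us))"
proof -
  let ?s = "inp (Node c (enc_list enc_bits us))"
  have "den (For 1 2 (TlE (Var 0)) (NodeE LeafE (NodeE (NodeE LeafE (NodeE LeafE (NodeE LeafE LeafE))) LeafE)) expand_body) ?s =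
     fold (\<lambda>x y. den expand_body (?s(1 := enc_bits x, 2 := y))) us (enc_state (Leaf, [(Leaf, 0, [], [])]))"
    by (subst den_For_enc[where f = enc_bits and xs = us]) simp_all
  also have "\<dots> = enc_state (expansion c us)"
    by (subst fold_expand) (simp_all add: expansion_def)
  finally show ?thesis
    unfolding expand_prog_def result_pure[OF pure_expand] unfolding expand_tm_def den.simps(3)
    by (cases "expansion c us") simp
qed

text \<open>The constant may depend on the cover, which is fixed in the later estimates.
  \<open>M\<close> has to bound the lists at all intermediate stages, since each of them is
  built.\<close>

lemma runtime_expand:
  "\<exists>A. \<forall>us M. (\<forall>ys zs. us = ys @ zs \<longrightarrow> length (snd (expansion c ys)) \<le> M) \<longrightarrow>
     runtime expand_prog (Node c (enc_list enc_bits us)) \<le> enat (A * (length us + 1) * (M + 1))"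
proof -
  define R where "R = Max (insert 0 ((\<lambda>i. tlen (tl_tree i)) ` set (tlist (tl_tree c))))"
  have R: "tlen (tl_tree i) \<le> R" if "i \<in> set (tlist (tl_tree c))" for i
    unfolding R_def using that by (intro Max_ge) auto
  define B where "B = 200 + 2 * call_cost advance_prog + call_cost cross_prog + tlen (tl_tree c) * (200 + 20 * R)"
  show ?thesis
  proof (intro exI allI impI)
    fix us M assume M: "\<forall>ys zs. us = ys @ zs \<longrightarrow> length (snd (expansion c ys)) \<le> M"
    let ?s = "inp (Node c (enc_list enc_bits us))"
    let ?a = "NodeE LeafE (NodeE (NodeE LeafE (NodeE LeafE (NodeE LeafE LeafE))) LeafE)"
    have "cost expand_tm ?s \<le> enat (4 + (6 + cost_expr ?a + cost_expr (TlE (Var 0)) + length us * (13 + B * (M + 1))) + 3)"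
      unfolding expand_tm_def
    proof (rule cost_Bind_le, rule cost_For_le_const[where f = enc_bits])
      fix ys x zs assume us: "us = ys @ x # zs"
      obtain l Q where lQ: "expansion c ys = (l, Q)" by fastforce
      have "eval_expr ?a ?s = enc_state (Leaf, [(Leaf, 0, [], [])])" by simp
      then have f: "fold (\<lambda>x y. den expand_body (?s(1 := enc_bits x, 2 := y))) ys (eval_expr ?a ?s) = enc_state (l, Q)"
        unfolding lQ[symmetric] expansion_def by (simp only:) (rule fold_expand, simp)
      have "length Q \<le> M" using M us lQ by (metis snd_conv)
      then show "cost expand_body (?s(1 := enc_bits x, 2 := fold (\<lambda>x y. den expand_body (?s(1 := enc_bits x, 2 := y))) ys (eval_expr ?a ?s)))
          \<le> enat (B * (M + 1))"
        unfolding f B_def by (intro cost_expand_body[OF R, where l = l and Q = Q]) auto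
    qed simp_all
    then show "runtime expand_prog (Node c (enc_list enc_bits us)) \<le> enat ((100 + B) * (length us + 1) * (M + 1))"
      unfolding expand_prog_def by (rule runtime_compile_le) (simp add: algebra_simps)
  qed
qed

section \<open>Queries, search and self-reduction\<close>

lemma result_compile_le: "cost a (inp x) \<le> enat m \<Longrightarrow> result (compile a) x = den a (inp x)"
  by (rule result_compile) (metis enat_ord_simps(5) infinity_ne_i0 enat.distinct(1))

lemma enc_bool_eq_Leaf [simp]: "enc_bool x = Leaf \<longleftrightarrow> \<not> x"
  by (cases x) auto

definition query_tm :: "program \<Rightarrow> tm" where
  "query_tm p = Bind 1 (Run to_binary_prog (TlE (TlE (Var 0))))
     (Run p (NodeE (HdE (Var 0)) (NodeE (HdE (TlE (Var 0))) (Var 1))))"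

definition search_body :: "program \<Rightarrow> tm" where
  "search_body p = Ite (Var 2) (Ret (Var 2))
     (Bind 3 (Run (compile (query_tm p)) (NodeE (HdE (Var 0)) (NodeE (HdE (TlE (TlE (Var 1)))) (HdE (TlE (Var 1))))))
       (Ite (Var 3) (Ret (Var 1)) (Ret LeafE)))"

definition search_tm :: "program \<Rightarrow> tm" where
  "search_tm p = For 1 2 (TlE (Var 0)) LeafE (search_body p)"

definition construct_body :: "program \<Rightarrow> tm" where
  "construct_body p = Ite (HdE (Var 2))
     (Bind 3 (Run (compile (query_tm p)) (NodeE (HdE (Var 0)) (NodeE (NodeE (Var 1) (TlE (Var 2))) (TlE (HdE (Var 2))))))
       (Ite (Var 3) (Ret (NodeE (TlE (HdE (Var 2))) (NodeE (Var 1) (TlE (Var 2))))) (Ret (Var 2))))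
     (Ret (Var 2))"

definition construct_tm :: "program \<Rightarrow> tm" where
  "construct_tm p = Bind 4 (For 1 2 (TlE (TlE (TlE (TlE (Var 0)))))
       (NodeE (HdE (TlE (TlE (Var 0)))) (HdE (TlE (TlE (TlE (Var 0)))))) (construct_body p))
     (Ret (TlE (Var 4)))"

text \<open>An answer is wrapped once more: \<open>Leaf\<close> rejects the candidate, whereas
  \<open>Node Leaf Leaf\<close> is the verdict that the family is empty.\<close>

definition solve_tm :: "program \<Rightarrow> program \<Rightarrow> tm" where
  "solve_tm pU p = Bind 1 (Run decode_prog (HdE (Var 0))) (Bind 2 (Run valid_prog (Var 1))
     (Ite (Var 2)
       (Bind 3 (Run pU (TlE (Var 0))) (Bind 4 (Run expand_prog (NodeE (Var 1) (Var 3)))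
         (Bind 5 (Run (compile (search_tm p)) (NodeE (TlE (Var 0)) (Var 4)))
           (Ite (Var 5)
             (Bind 6 (Run (compile (construct_tm p)) (NodeE (TlE (Var 0)) (Var 5)))
               (Ret (NodeE (NodeE LeafE (Var 6)) LeafE)))
             (Ret (NodeE LeafE LeafE))))))
       (Ret LeafE)))"

locale extension_algorithm =
  fixes \<Phi> :: "bitstring \<Rightarrow> set_system" and b c :: real and p :: program and C :: real and d :: nat
    and pU :: program and CU :: real and dU :: nat
  assumes implicit: "implicit_set_system \<Phi>"
    and b: "b \<ge> 1" and c: "c \<ge> 1"
    and extension: "solves_extension_in \<Phi> p
      (\<lambda>I X k. C * b ^ (card (universe \<Phi> I) - card X) * c ^ k * real (length I + 1) ^ d)"
    and universe: "\<And>I. \<exists>y t. computes pU (enc_bits I) y t \<and> represents y (universe \<Phi> I) \<and>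
      real t \<le> CU * real (length I + 1) ^ dU"
begin

abbreviation query_prog :: program where
  "query_prog \<equiv> compile (query_tm p)"

abbreviation search_prog :: program where
  "search_prog \<equiv> compile (search_tm p)"

abbreviation construct_prog :: program where
  "construct_prog \<equiv> compile (construct_tm p)"

abbreviation query_input :: "bitstring \<Rightarrow> bitstring list \<Rightarrow> nat \<Rightarrow> tree" where
  "query_input I X k \<equiv> Node (enc_bits I) (Node (enc_list enc_bits X) (unary k))"

definition extendable :: "bitstring \<Rightarrow> bitstring set \<Rightarrow> nat \<Rightarrow> bool" where
  "extendable I X k \<longleftrightarrow> (\<exists>S. S \<subseteq> universe \<Phi> I - X \<and> S \<union> X \<in> family \<Phi> I \<and> card S \<le> k)"

lemma finite_universe [simp]: "finite (universe \<Phi> I)"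
  using implicit by (auto simp: implicit_set_system_def)

lemma card_universe_le: "card (universe \<Phi> I) \<le> length I"
  using implicit by (auto simp: implicit_set_system_def)

lemma family_subset: "S \<in> family \<Phi> I \<Longrightarrow> S \<subseteq> universe \<Phi> I"
  using implicit by (auto simp: implicit_set_system_def)

text \<open>The factor (k + 1)^2 pays for converting the budget to binary.\<close>

definition query_bound :: "bitstring \<Rightarrow> bitstring list \<Rightarrow> nat \<Rightarrow> real" where
  "query_bound I X k = (real k + 1) ^ 2 * real (length I + 1) ^ d * (b ^ (card (universe \<Phi> I) - length X) * c ^ k)"

lemma query_bound_ge_1: "query_bound I X k \<ge> 1"
proof -
  have "1 \<le> (real k + 1) ^ 2" by (intro one_le_power) simp
  moreover have "1 \<le> real (length I + 1) ^ d" by (intro one_le_power) simp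
  moreover have "1 \<le> b ^ (card (universe \<Phi> I) - length X)" "1 \<le> c ^ k" using b c by (auto intro: one_le_power)
  ultimately have "1 * 1 * (1 * 1) \<le> query_bound I X k"
    unfolding query_bound_def by (intro mult_mono) auto
  then show ?thesis by simp
qed

lemma query:
  "\<exists>A\<ge>0. \<forall>I X k. distinct X \<longrightarrow> set X \<subseteq> universe \<Phi> I \<longrightarrow>
     result query_prog (query_input I X k) = enc_bool (extendable I (set X) k) \<and>
     (\<exists>m. runtime query_prog (query_input I X k) \<le> enat m \<and>
        real m \<le> A * query_bound I X k)"
proof -
  obtain A1 where A1: "\<And>k. runtime to_binary_prog (unary k) \<le> enat (A1 * (k + 1) ^ 2)"
    using runtime_to_binary by blast
  define K where "K = 7 + (call_cost to_binary_prog + 3) + (call_cost p + 8)"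
  show ?thesis
  proof (intro exI[of _ "real K + real A1 + \<bar>C\<bar>"] conjI allI impI)
    fix I and X :: "bitstring list" and k
    assume X: "distinct X" "set X \<subseteq> universe \<Phi> I"
    let ?x = "query_input I X k"
    let ?B = "query_bound I X k"
    have rep: "represents (enc_list enc_bits X) (set X)" using X by (auto simp: represents_def)
    from extension X(2) rep have "\<exists>t. computes p (Node (enc_bits I) (Node (enc_list enc_bits X) (enc_nat k))) (enc_bool (extendable I (set X) k)) t \<and>
        real t \<le> C * b ^ (card (universe \<Phi> I) - card (set X)) * c ^ k * real (length I + 1) ^ d"
      unfolding solves_extension_in_def extendable_def by blast
    then obtain t where t: "computes p (Node (enc_bits I) (Node (enc_list enc_bits X) (enc_nat k))) (enc_bool (extendable I (set X) k)) t"
        "real t \<le> C * b ^ (card (universe \<Phi> I) - length X) * c ^ k * real (length I + 1) ^ d"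
      using distinct_card[OF X(1)] by auto
    define m where "m = 4 + (call_cost to_binary_prog + cost_expr (TlE (TlE (Var 0))) + A1 * (k + 1) ^ 2) +
        (call_cost p + cost_expr (NodeE (HdE (Var 0)) (NodeE (HdE (TlE (Var 0))) (Var 1))) + t)"
    have m: "cost (query_tm p) (inp ?x) \<le> enat m"
      unfolding query_tm_def m_def
    proof (intro cost_Bind_le cost_Run_le)
      show "runtime to_binary_prog (eval_expr (TlE (TlE (Var 0))) (inp ?x)) \<le> enat (A1 * (k + 1) ^ 2)"
        using A1 by simp
      show "runtime p (eval_expr (NodeE (HdE (Var 0)) (NodeE (HdE (TlE (Var 0))) (Var 1)))
          ((inp ?x)(1 := den (Run to_binary_prog (TlE (TlE (Var 0)))) (inp ?x)))) \<le> enat t"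
        using computes_runtime[OF t(1)] by (simp add: result_to_binary)
    qed
    show "result query_prog ?x = enc_bool (extendable I (set X) k)"
      using result_compile_le[OF m] computes_result[OF t(1)] by (simp add: query_tm_def result_to_binary)
    show "\<exists>m. runtime query_prog ?x \<le> enat m \<and> real m \<le> (real K + real A1 + \<bar>C\<bar>) * ?B"
    proof (intro exI conjI)
      show "runtime query_prog ?x \<le> enat (m + 3)" using m by (rule runtime_compile_le) simp
      let ?w = "b ^ (card (universe \<Phi> I) - length X) * c ^ k" and ?N = "real (length I + 1) ^ d" and ?k = "(real k + 1) ^ 2"
      have "1 \<le> b ^ (card (universe \<Phi> I) - length X)" "1 \<le> c ^ k" using b c by (auto intro: one_le_power)
      then have "1 * 1 \<le> ?w" by (intro mult_mono) auto
      then have ge: "1 \<le> ?w" by simp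
      have N: "1 \<le> ?N" by (intro one_le_power) simp
      have k: "1 \<le> ?k" by (intro one_le_power) simp
      have "?k * 1 \<le> ?k * (?N * ?w)" using ge N mult_mono[of 1 ?N 1 ?w] by (intro mult_left_mono) auto
      then have 1: "?k \<le> ?B" by (simp add: query_bound_def mult_ac)
      have "C * (?N * ?w) \<le> \<bar>C\<bar> * (?N * ?w)" using ge N by (intro mult_right_mono) auto
      then have "real t \<le> \<bar>C\<bar> * (?N * ?w)" using t(2) by (simp add: mult_ac)
      also have "\<dots> \<le> \<bar>C\<bar> * ?B" unfolding query_bound_def mult.assoc
        using k ge N mult_right_mono[of 1 ?k "?N * ?w"] by (intro mult_left_mono) auto
      finally have 2: "real t \<le> \<bar>C\<bar> * ?B" .
      have 3: "real (A1 * (k + 1) ^ 2) \<le> real A1 * ?B"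
        using 1 by (simp add: mult_left_mono add.commute)
      have 4: "real K \<le> real K * ?B" using mult_left_mono[OF query_bound_ge_1[of I X k], of "real K"] by simp
      have "real (m + 3) = real K + real (A1 * (k + 1) ^ 2) + real t" by (simp add: m_def K_def power2_eq_square)
      also have "\<dots> \<le> (real K + real A1 + \<bar>C\<bar>) * ?B" using 2 3 4 by (simp add: algebra_simps)
      finally show "real (m + 3) \<le> (real K + real A1 + \<bar>C\<bar>) * ?B" .
    qed
  qed simp
qed

text \<open>The time is a sum over the queries rather than their number times the worst one; only
  this sum is controlled by the weight of the expansion.\<close>

lemma search:
  "\<exists>A\<ge>0. \<forall>I Q. (\<forall>(x, k, X, Y)\<in>set Q. distinct X \<and> set X \<subseteq> universe \<Phi> I) \<longrightarrow>
     (if \<exists>(x, k, X, Y)\<in>set Q. extendable I (set X) k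
      then \<exists>(x, k, X, Y)\<in>set Q. extendable I (set X) k \<and>
        result search_prog (Node (enc_bits I) (enc_list enc_query Q)) = enc_query (x, k, X, Y)
      else result search_prog (Node (enc_bits I) (enc_list enc_query Q)) = Leaf) \<and>
     (\<exists>m. runtime search_prog (Node (enc_bits I) (enc_list enc_query Q)) \<le> enat m \<and>
        real m \<le> A * (1 + (\<Sum>(x, k, X, Y)\<leftarrow>Q. query_bound I X k)))"
proof -
  obtain A where A: "A \<ge> 0" "\<And>I X k. distinct X \<Longrightarrow> set X \<subseteq> universe \<Phi> I \<Longrightarrow>
     result query_prog (query_input I X k) = enc_bool (extendable I (set X) k)"
     "\<And>I X k. distinct X \<Longrightarrow> set X \<subseteq> universe \<Phi> I \<Longrightarrow> (\<exists>m. runtime query_prog (query_input I X k) \<le> enat m \<and>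
        real m \<le> A * query_bound I X k)"
    using query by blast
  define K where "K = 100 + call_cost query_prog"
  show ?thesis
  proof (intro exI[of _ "real K + A"] conjI allI impI)
    fix I and Q :: "query list"
    assume Q: "\<forall>(x, k, X, Y)\<in>set Q. distinct X \<and> set X \<subseteq> universe \<Phi> I"
    let ?x = "Node (enc_bits I) (enc_list enc_query Q)"
    define P :: "query \<Rightarrow> bool" where "P = (\<lambda>(x, k, X, Y). extendable I (set X) k)"
    define B :: "query \<Rightarrow> real" where "B = (\<lambda>(x, k, X, Y). query_bound I X k)"
    define rt :: "query \<Rightarrow> enat" where
      "rt = (\<lambda>(x, k, X, Y). runtime query_prog (query_input I X k))"
    have "\<forall>q\<in>set Q. \<exists>m. rt q \<le> enat m \<and> real m \<le> A * B q"
    proof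
      fix q assume "q \<in> set Q"
      moreover obtain x k X Y where q: "q = (x, k, X, Y)" by (cases q)
      ultimately have "distinct X" "set X \<subseteq> universe \<Phi> I" using Q by auto
      from A(3)[OF this] show "\<exists>m. rt q \<le> enat m \<and> real m \<le> A * B q" by (simp add: rt_def B_def q)
    qed
    then obtain m where m: "\<And>q. q \<in> set Q \<Longrightarrow> rt q \<le> enat (m q)"
        "\<And>q. q \<in> set Q \<Longrightarrow> real (m q) \<le> A * B q" by metis
    have body: "den (search_body p) s = (if y \<noteq> Leaf then y else if P q then enc_query q else Leaf)"
      "cost (search_body p) s \<le> enat (30 + call_cost query_prog + m q)"
      if "q \<in> set Q" "s 0 = ?x" "s 1 = enc_query q" "s 2 = y" for s q y
    proof -
      obtain x k X Y where q: "q = (x, k, X, Y)" by (cases q)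
      have X: "distinct X" "set X \<subseteq> universe \<Phi> I" using Q that(1) q by auto
      show "den (search_body p) s = (if y \<noteq> Leaf then y else if P q then enc_query q else Leaf)"
        using that by (simp add: search_body_def q A(2)[OF X] P_def cong: if_cong)
      have "cost (search_body p) s \<le> enat (1 + cost_expr (Var 2) + max 2 (4 + (call_cost query_prog +
          cost_expr (NodeE (HdE (Var 0)) (NodeE (HdE (TlE (TlE (Var 1)))) (HdE (TlE (Var 1))))) + m q) + 4))"
        unfolding search_body_def
        by (intro cost_Ite_le cost_Bind_le cost_Run_le) (use that m(1)[OF that(1)] in \<open>simp_all add: q rt_def\<close>)
      then show "cost (search_body p) s \<le> enat (30 + call_cost query_prog + m q)"
        by (rule cost_weaken) simp
    qed
    have cost: "cost (search_tm p) (inp ?x) \<le> enat (6 + cost_expr LeafE + cost_expr (TlE (Var 0)) +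
        (\<Sum>q\<leftarrow>Q. 13 + (30 + call_cost query_prog + m q)))"
      unfolding search_tm_def by (rule cost_For_le[where f = enc_query]) (auto intro!: body(2))
    define g where "g = (\<lambda>q y. if y \<noteq> Leaf then y else if P q then enc_query q else Leaf)"
    have "fold (\<lambda>x y. den (search_body p) ((inp ?x)(1 := enc_query x, 2 := y))) Q Leaf = fold g Q Leaf"
      by (intro fold_cong refl) (auto simp: g_def body(1))
    then have res: "result search_prog ?x = fold g Q Leaf"
      unfolding result_compile_le[OF cost] unfolding search_tm_def by (simp add: iter_enc_list)
    have ne: "enc_query q \<noteq> Leaf" for q by (cases q) simp
    have stay: "fold g L y = y" if "y \<noteq> Leaf" for L y using that by (induction L) (auto simp: g_def)
    have "if \<exists>q\<in>set L. P q then \<exists>q\<in>set L. P q \<and> fold g L Leaf = enc_query q else fold g L Leaf = Leaf" for L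
    proof (induction L)
      case (Cons q L)
      show ?case
      proof (cases "P q")
        case True
        then have "fold g (q # L) Leaf = enc_query q" using stay[OF ne] by (simp add: g_def)
        then show ?thesis using True by auto
      next
        case False
        then have "fold g (q # L) Leaf = fold g L Leaf" by (simp add: g_def)
        then show ?thesis using False Cons.IH by (auto split: if_splits)
      qed
    qed simp
    then have "if \<exists>q\<in>set Q. P q then \<exists>q\<in>set Q. P q \<and> result search_prog ?x = enc_query q else result search_prog ?x = Leaf"
      unfolding res by blast
    then show "if \<exists>(x, k, X, Y)\<in>set Q. extendable I (set X) k
      then \<exists>(x, k, X, Y)\<in>set Q. extendable I (set X) k \<and> result search_prog ?x = enc_query (x, k, X, Y)
      else result search_prog ?x = Leaf"
      unfolding P_def by (fastforce split: if_splits)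
    show "\<exists>m. runtime search_prog ?x \<le> enat m \<and> real m \<le> (real K + A) * (1 + (\<Sum>(x, k, X, Y)\<leftarrow>Q. query_bound I X k))"
    proof (intro exI conjI)
      show "runtime search_prog ?x \<le> enat (20 + (\<Sum>q\<leftarrow>Q. K + m q))"
      proof -
        have "(\<Sum>q\<leftarrow>Q. 13 + (30 + call_cost query_prog + m q)) \<le> (\<Sum>q\<leftarrow>Q. K + m q)"
          by (rule sum_list_mono) (simp add: K_def)
        then show ?thesis using cost by (elim runtime_compile_le) simp
      qed
      have "real (\<Sum>q\<leftarrow>Q. K + m q) = (\<Sum>q\<leftarrow>Q. real (K + m q))"
        by (induction Q) auto
      also have "\<dots> \<le> (\<Sum>q\<leftarrow>Q. (real K + A) * B q)"
      proof (rule sum_list_mono)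
        fix q assume "q \<in> set Q"
        moreover have "1 \<le> B q" unfolding B_def using query_bound_ge_1 by (cases q) simp
        then have "real K * 1 \<le> real K * B q" by (intro mult_left_mono) auto
        ultimately show "real (K + m q) \<le> (real K + A) * B q" using m(2)[of q] by (simp add: algebra_simps)
      qed
      also have "\<dots> = (real K + A) * (\<Sum>q\<leftarrow>Q. B q)" by (rule sum_list_const_mult)
      finally show "real (20 + (\<Sum>q\<leftarrow>Q. K + m q)) \<le> (real K + A) * (1 + (\<Sum>(x, k, X, Y)\<leftarrow>Q. query_bound I X k))"
        using A(1) unfolding B_def by (simp add: algebra_simps K_def)
    qed
  qed (use A(1) in simp)
qed

end

section \<open>Self-reduction from a positive query\<close>

context extension_algorithm
begin

text \<open>Keeps the self-reduction cheap: its queries have larger sets and smaller budgets than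
  the positive query it starts from, so none of them has a larger bound.\<close>

lemma query_bound_antimono:
  assumes "length X \<le> length X'" "k' \<le> k"
  shows "query_bound I X' k' \<le> query_bound I X k"
  unfolding query_bound_def
proof (intro mult_mono)
  show "b ^ (card (universe \<Phi> I) - length X') \<le> b ^ (card (universe \<Phi> I) - length X)"
    using assms b by (intro power_increasing) auto
  show "c ^ k' \<le> c ^ k" using assms c by (intro power_increasing) auto
  show "(real k' + 1) ^ 2 \<le> (real k + 1) ^ 2" using assms by (intro power_mono) auto
qed (use b c in auto)

text \<open>The state consists of the remaining budget and the elements chosen. Without the guard
  \<open>k > 0\<close>, truncated subtraction would let an element in free of charge.\<close>

definition extend :: "bitstring \<Rightarrow> bitstring \<Rightarrow> nat \<times> bitstring list \<Rightarrow> nat \<times> bitstring list" where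
  "extend I u = (\<lambda>(k, X). if k > 0 \<and> extendable I (set (u # X)) (k - 1) then (k - 1, u # X) else (k, X))"

text \<open>The third assumption says that every element passed over so far was rejected; it stays so, since
  a later extension containing the element would also be an earlier one.\<close>

lemma extend_member:
  assumes "distinct (X @ Y)" "set X \<union> set Y \<subseteq> universe \<Phi> I"
    and "\<And>w. w \<in> universe \<Phi> I - set X - set Y \<Longrightarrow> k > 0 \<Longrightarrow> \<not> extendable I (insert w (set X)) (k - 1)"
    and "extendable I (set X) k"
  shows "distinct (snd (fold (extend I) Y (k, X))) \<and> set (snd (fold (extend I) Y (k, X))) \<in> family \<Phi> I"
  using assms
proof (induction Y arbitrary: k X)
  case Nil
  from Nil.prems(4) obtain S where S: "S \<subseteq> universe \<Phi> I - set X" "S \<union> set X \<in> family \<Phi> I" "card S \<le> k"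
    by (auto simp: extendable_def)
  have "finite S" using S(1) by (rule finite_subset) simp
  \<comment> \<open>No element is left to be tried. An element of \<open>S\<close> would have been
    rejected, although the rest of \<open>S\<close> would complete the set within the reduced
    budget.\<close>
  have "S = {}"
  proof (rule ccontr)
    assume "S \<noteq> {}"
    then obtain w where w: "w \<in> S" by blast
    then have "k > 0" using S(3) \<open>finite S\<close> by (metis card_gt_0_iff empty_iff gr0I le_zero_eq)
    moreover have "S - {w} \<subseteq> universe \<Phi> I - insert w (set X)" using S(1) by blast
    moreover have "(S - {w}) \<union> insert w (set X) \<in> family \<Phi> I" using S(2) w by (metis Un_insert_left Un_insert_right insert_Diff)
    moreover have "card (S - {w}) \<le> k - 1" using S(3) w \<open>finite S\<close> by simp
    ultimately have "extendable I (insert w (set X)) (k - 1)" unfolding extendable_def by blast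
    then show False using Nil.prems(3)[of w] w S(1) \<open>k > 0\<close> by auto
  qed
  then show ?case using S Nil.prems(1) by simp
next
  case (Cons u Y)
  show ?case
  proof (cases "k > 0 \<and> extendable I (set (u # X)) (k - 1)")
    case True
    have "distinct (snd (fold (extend I) Y (k - 1, u # X))) \<and> set (snd (fold (extend I) Y (k - 1, u # X))) \<in> family \<Phi> I"
    proof (rule Cons.IH)
      fix w assume w: "w \<in> universe \<Phi> I - set (u # X) - set Y" "k - 1 > 0"
      show "\<not> extendable I (insert w (set (u # X))) (k - 1 - 1)"
      proof
        assume "extendable I (insert w (set (u # X))) (k - 1 - 1)"
        then obtain S where S: "S \<subseteq> universe \<Phi> I - insert w (set (u # X))" "S \<union> insert w (set (u # X)) \<in> family \<Phi> I"
          "card S \<le> k - 1 - 1" by (auto simp: extendable_def)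
        have "finite S" using S(1) by (rule finite_subset) simp
        have "insert u S \<subseteq> universe \<Phi> I - insert w (set X)" using S(1) w Cons.prems(1,2) by auto
        moreover have "insert u S \<union> insert w (set X) \<in> family \<Phi> I" using S(2) by (simp add: insert_commute)
        moreover have "card (insert u S) \<le> k - 1" using S(3) w(2) card_insert_le_m1[of "k - 1" S u] by simp
        ultimately have "extendable I (insert w (set X)) (k - 1)" unfolding extendable_def by blast
        then show False using Cons.prems(3)[of w] w True by auto
      qed
    qed (use Cons.prems True in auto)
    moreover have "extend I u (k, X) = (k - 1, u # X)" using True by (simp add: extend_def)
    ultimately show ?thesis by (simp only: fold_Cons o_apply)
  next
    case False
    have "distinct (snd (fold (extend I) Y (k, X))) \<and> set (snd (fold (extend I) Y (k, X))) \<in> family \<Phi> I"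
    proof (rule Cons.IH)
      fix w assume w: "w \<in> universe \<Phi> I - set X - set Y" "k > 0"
      show "\<not> extendable I (insert w (set X)) (k - 1)"
        using Cons.prems(3)[of w] w False by (cases "w = u") auto
    qed (use Cons.prems in auto)
    moreover have "extend I u (k, X) = (k, X)" using False by (simp add: extend_def)
    ultimately show ?thesis by (simp only: fold_Cons o_apply)
  qed
qed

lemma extend_invariant:
  assumes "distinct (X @ Y)" "fold (extend I) ys (k, X) = (k', X')" "Y = ys @ zs"
  shows "distinct (X' @ zs) \<and> set X' \<subseteq> set X \<union> set ys \<and> length X \<le> length X' \<and> k' \<le> k"
  using assms
proof (induction ys arbitrary: k' X' zs rule: rev_induct)
  case (snoc u ys)
  obtain k1 X1 where 1: "fold (extend I) ys (k, X) = (k1, X1)" by fastforce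
  have "distinct (X1 @ u # zs) \<and> set X1 \<subseteq> set X \<union> set ys \<and> length X \<le> length X1 \<and> k1 \<le> k"
    using snoc.IH[OF _ 1, of "u # zs"] snoc.prems by simp
  moreover have "(k', X') = (k1 - 1, u # X1) \<or> (k', X') = (k1, X1)"
  proof -
    have "extend I u (k1, X1) = (k', X')" using snoc.prems(2) 1 by simp
    then show ?thesis by (auto simp: extend_def split: if_splits)
  qed
  ultimately show ?case by auto
qed auto

fun enc_pair :: "nat \<times> bitstring list \<Rightarrow> tree" where
  "enc_pair (k, X) = Node (unary k) (enc_list enc_bits X)"

lemma construct:
  "\<exists>A\<ge>0. \<forall>I x k X Y. distinct (X @ Y) \<longrightarrow> set X \<union> set Y = universe \<Phi> I \<longrightarrow> extendable I (set X) k \<longrightarrow>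
     (\<exists>Z. distinct Z \<and> set Z \<in> family \<Phi> I \<and>
       result construct_prog (Node (enc_bits I) (enc_query (x, k, X, Y))) = enc_list enc_bits Z) \<and>
     (\<exists>m. runtime construct_prog (Node (enc_bits I) (enc_query (x, k, X, Y))) \<le> enat m \<and>
        real m \<le> A * (real (length I) + 1) * query_bound I X k)"
proof -
  obtain A where A: "A \<ge> 0" "\<And>I X k. distinct X \<Longrightarrow> set X \<subseteq> universe \<Phi> I \<Longrightarrow>
     result query_prog (query_input I X k) = enc_bool (extendable I (set X) k)"
     "\<And>I X k. distinct X \<Longrightarrow> set X \<subseteq> universe \<Phi> I \<Longrightarrow> (\<exists>m. runtime query_prog (query_input I X k) \<le> enat m \<and>
        real m \<le> A * query_bound I X k)"
    using query by blast
  define K where "K = 100 + call_cost query_prog"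
  show ?thesis
  proof (intro exI[of _ "2 * (real K + A)"] conjI allI impI)
    fix I x k X Y
    assume XY: "distinct (X @ Y)" "set X \<union> set Y = universe \<Phi> I" "extendable I (set X) k"
    let ?x = "Node (enc_bits I) (enc_query (x, k, X, Y))"
    let ?B = "query_bound I X k"
    \<comment> \<open>One natural number that bounds every query of the loop, by
      \<open>query_bound_antimono\<close>.\<close>
    define M where "M = nat \<lfloor>A * ?B\<rfloor>"
    have "0 \<le> A * ?B" using A(1) query_bound_ge_1[of I X k] by simp
    then have M: "real M \<le> A * ?B" by (simp add: M_def)
    have body: "den (construct_body p) s = enc_pair (extend I u z)"
      "cost (construct_body p) s \<le> enat (30 + call_cost query_prog + M)"
      if "s 0 = ?x" "s 1 = enc_bits u" "s 2 = enc_pair z" "fold (extend I) ys (k, X) = z" "Y = ys @ u # zs" for s u z ys zs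
    proof -
      obtain k' X' where z: "z = (k', X')" by fastforce
      have inv: "distinct (X' @ u # zs) \<and> set X' \<subseteq> set X \<union> set ys \<and> length X \<le> length X' \<and> k' \<le> k"
        using extend_invariant[OF XY(1) that(4)[unfolded z] that(5)] .
      then have u: "distinct (u # X')" "set (u # X') \<subseteq> universe \<Phi> I" using XY(2) that(5) by auto
      have res: "result query_prog (Node (enc_bits I) (Node (Node (enc_bits u) (enc_list enc_bits X')) (unary (k' - 1))))
         = enc_bool (extendable I (insert u (set X')) (k' - 1))"
        using A(2)[OF u, of "k' - 1"] by simp
      show "den (construct_body p) s = enc_pair (extend I u z)"
        using that(1-3) by (auto simp: construct_body_def z res[unfolded One_nat_def] extend_def cong: if_cong)
      from A(3)[OF u, of "k' - 1"] obtain m where m: "runtime query_prog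
            (query_input I (u # X') (k' - 1)) \<le> enat m"
          "real m \<le> A * query_bound I (u # X') (k' - 1)" by blast
      have "A * query_bound I (u # X') (k' - 1) \<le> A * ?B"
        using inv A(1) by (intro mult_left_mono query_bound_antimono) auto
      with m(2) have "real m \<le> A * ?B" by simp
      then have "m \<le> M" unfolding M_def by (simp add: le_nat_floor)
      then have "enat m \<le> enat M" by simp
      with m(1) have rt: "runtime query_prog
            (query_input I (u # X') (k' - 1)) \<le> enat M"
        by (rule order_trans)
      have "cost (construct_body p) s \<le> enat (1 + cost_expr (HdE (Var 2)) + max (4 + (call_cost query_prog +
          cost_expr (NodeE (HdE (Var 0)) (NodeE (NodeE (Var 1) (TlE (Var 2))) (TlE (HdE (Var 2))))) + M) + 12) 2)"
        unfolding construct_body_def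
        by (intro cost_Ite_le cost_Bind_le cost_Run_le) (use that(1-3) rt in \<open>simp_all add: z\<close>)
      then show "cost (construct_body p) s \<le> enat (30 + call_cost query_prog + M)"
        by (rule cost_weaken) simp
    qed
    let ?l = "TlE (TlE (TlE (TlE (Var 0))))" and ?a = "NodeE (HdE (TlE (TlE (Var 0)))) (HdE (TlE (TlE (TlE (Var 0)))))"
    have a: "eval_expr ?a (inp ?x) = enc_pair (k, X)" and l: "eval_expr ?l (inp ?x) = enc_list enc_bits Y" by simp_all
    have fold: "fold (\<lambda>x y. den (construct_body p) ((inp ?x)(1 := enc_bits x, 2 := y))) ys (enc_pair (k, X)) = enc_pair (fold (extend I) ys (k, X))"
      if "Y = ys @ zs" for ys zs
      using that
    proof (induction ys arbitrary: zs rule: rev_induct)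
      case (snoc u ys)
      show ?case
        using snoc.IH[of "u # zs"] snoc.prems body(1)[of _ u "fold (extend I) ys (k, X)" ys zs] by simp
    qed simp
    have cost: "cost (construct_tm p) (inp ?x) \<le> enat (4 + (6 + cost_expr ?a + cost_expr ?l + length Y * (13 + (30 + call_cost query_prog + M))) + 3)"
      unfolding construct_tm_def
    proof (rule cost_Bind_le, rule cost_For_le_const[where f = enc_bits])
      fix ys u zs assume Y: "Y = ys @ u # zs"
      show "cost (construct_body p) ((inp ?x)(1 := enc_bits u, 2 := fold (\<lambda>x y. den (construct_body p) ((inp ?x)(1 := enc_bits x, 2 := y))) ys (eval_expr ?a (inp ?x))))
         \<le> enat (30 + call_cost query_prog + M)"
        unfolding a fold[OF Y] by (rule body(2)[OF _ _ _ refl Y]) simp_all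
    qed (simp_all add: l)
    have "den (For 1 2 ?l ?a (construct_body p)) (inp ?x) = enc_pair (fold (extend I) Y (k, X))"
      unfolding den_For_enc[OF l] a by (rule fold[of Y "[]"]) simp
    then have res: "result construct_prog ?x = enc_list enc_bits (snd (fold (extend I) Y (k, X)))"
      unfolding result_compile_le[OF cost] unfolding construct_tm_def den.simps(3)
      by (cases "fold (extend I) Y (k, X)") simp
    show "\<exists>Z. distinct Z \<and> set Z \<in> family \<Phi> I \<and> result construct_prog ?x = enc_list enc_bits Z"
      unfolding res using extend_member[OF XY(1), of I k] XY by (intro exI[of _ "snd (fold (extend I) Y (k, X))"]) auto
    show "\<exists>m. runtime construct_prog ?x \<le> enat m \<and> real m \<le> 2 * (real K + A) * (real (length I) + 1) * ?B"
    proof (intro exI conjI)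
      show "runtime construct_prog ?x \<le> enat (K + length Y * (K + M))"
        using cost by (rule runtime_compile_le) (simp add: K_def algebra_simps)
      have "length Y = card (set Y)" using XY(1) by (simp add: distinct_card)
      also have "\<dots> \<le> card (universe \<Phi> I)" using XY(2) by (intro card_mono) auto
      also have "\<dots> \<le> length I" by (rule card_universe_le)
      finally have "real (length Y) \<le> real (length I)" by simp
      moreover have KB: "real K \<le> real K * ?B" using mult_left_mono[OF query_bound_ge_1[of I X k], of "real K"] by simp
      then have "real (K + M) \<le> (real K + A) * ?B" using M by (simp add: algebra_simps)
      ultimately have "real (length Y) * real (K + M) \<le> real (length I) * ((real K + A) * ?B)" by (intro mult_mono) auto
      moreover have "real K \<le> (real K + A) * ?B" using KB \<open>0 \<le> A * ?B\<close> by (simp add: algebra_simps)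
      ultimately have "real (K + length Y * (K + M)) \<le> (real K + A) * ?B + real (length I) * ((real K + A) * ?B)" by simp
      also have "\<dots> \<le> 2 * (real K + A) * (real (length I) + 1) * ?B"
        using KB \<open>0 \<le> A * ?B\<close> A(1) query_bound_ge_1[of I X k] by (simp add: algebra_simps)
      finally show "real (K + length Y * (K + M)) \<le> 2 * (real K + A) * (real (length I) + 1) * ?B" .
    qed
  qed (use A(1) in simp)
qed

end

section \<open>Solving an instance with a single candidate\<close>

abbreviation decoded :: "nat \<Rightarrow> tree" where
  "decoded i \<equiv> result decode_prog (enc_nat i)"

lemma tlen_expansion: "tlen (fst (expansion t us)) < block t"
proof (induction us rule: rev_induct)
  case (snoc u us)
  then show ?case by (cases "expansion t us") (auto simp: expansion_snoc step_def block_def)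
qed (simp add: expansion_Nil block_def)

lemma sum_list_ge_length: "(\<And>x. x \<in> set xs \<Longrightarrow> f x \<ge> 1) \<Longrightarrow> real (length xs) \<le> (\<Sum>x\<leftarrow>xs. f x)"
proof (induction xs)
  case (Cons x xs)
  then have "real (length xs) \<le> (\<Sum>x\<leftarrow>xs. f x)" "1 \<le> f x" by auto
  then show ?case by simp
qed simp

lemma cover_weight_ge_1:
  assumes "b \<ge> 1" "c \<ge> 1" "valid_cover t"
  shows "cover_weight b c t \<ge> 1"
proof -
  have "replicate (block t) False \<in> cube (Suc (tlen (hd_tree t)))" by (simp add: block_def)
  then have "tlist (tl_tree t) \<noteq> []" using assms(3) unfolding valid_cover_def by fastforce
  then have "1 \<le> real (length (tlist (tl_tree t)))" by (cases "tlist (tl_tree t)") auto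
  also have "\<dots> \<le> cover_weight b c t"
    unfolding cover_weight_def
  proof (rule sum_list_ge_length)
    fix i
    have "1 \<le> b ^ (block t - ins (block t) (hd_tree i))" "1 \<le> c ^ tlen (tl_tree i)"
      using assms by (auto intro: one_le_power)
    then have "1 * 1 \<le> b ^ (block t - ins (block t) (hd_tree i)) * c ^ tlen (tl_tree i)"
      by (intro mult_mono) auto
    then show "1 \<le> b ^ (block t - ins (block t) (hd_tree i)) * c ^ tlen (tl_tree i)" by simp
  qed
  finally show ?thesis .
qed

lemma weight_ge:
  assumes "b \<ge> 1" "c \<ge> 1"
  shows "weight b c m (x, k, X, Y) \<ge> b ^ length Y * c ^ k"
proof -
  have "length Y \<le> length Y + m - ins m x" using ins_le[of m x] by simp
  then have "b ^ length Y \<le> b ^ (length Y + m - ins m x)" using assms by (intro power_increasing)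
  then show ?thesis using assms by (simp add: mult_right_mono)
qed

text \<open>The last block may be incomplete, whence the + 1 in the exponent; rounding up is
  harmless as the weight of a valid cover is at least 1. Each query weighs at least 1 too, so the
  same power bounds their number.\<close>

lemma expansion_weight_le:
  assumes "b \<ge> 1" "c \<ge> 1" "valid_cover t" "expansion t us = (l, Q)"
  shows "(\<Sum>(x, k, X, Y)\<leftarrow>Q. b ^ length Y * c ^ k) \<le> cover_weight b c t powr (real (length us) / real (block t) + 1)"
    and "real (length Q) \<le> cover_weight b c t powr (real (length us) / real (block t) + 1)"
proof -
  let ?W = "cover_weight b c t"
  have W: "?W \<ge> 1" by (rule cover_weight_ge_1) fact+
  obtain j where j: "j * block t = length us + tlen l" "(\<Sum>q\<leftarrow>Q. weight b c (tlen l) q) = ?W ^ j"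
    using expansion_weight[OF assms(4)] by blast
  have "tlen l < block t" using tlen_expansion[of t us] assms(4) by simp
  then have "j * block t \<le> length us + block t" using j(1) by simp
  then have "real j * real (block t) \<le> real (length us) + real (block t)"
    by (simp only: flip: of_nat_mult of_nat_add of_nat_le_iff)
  then have "real j \<le> real (length us) / real (block t) + 1"
    by (simp add: block_def field_simps)
  then have "?W powr real j \<le> ?W powr (real (length us) / real (block t) + 1)"
    using W by (intro powr_mono)
  then have le: "(\<Sum>q\<leftarrow>Q. weight b c (tlen l) q) \<le> ?W powr (real (length us) / real (block t) + 1)"
    using W j(2) by (simp add: powr_realpow)
  have "(\<Sum>(x, k, X, Y)\<leftarrow>Q. b ^ length Y * c ^ k) \<le> (\<Sum>q\<leftarrow>Q. weight b c (tlen l) q)"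
    by (rule sum_list_mono) (use weight_ge[OF assms(1,2)] in \<open>auto split: prod.splits\<close>)
  with le show "(\<Sum>(x, k, X, Y)\<leftarrow>Q. b ^ length Y * c ^ k) \<le> ?W powr (real (length us) / real (block t) + 1)"
    by simp
  have "real (length Q) \<le> (\<Sum>q\<leftarrow>Q. weight b c (tlen l) q)"
  proof (rule sum_list_ge_length)
    fix q assume "q \<in> set Q"
    obtain x k X Y where q: "q = (x, k, X, Y)" by (cases q)
    have "1 \<le> b ^ length Y" "1 \<le> c ^ k" using assms by (auto intro: one_le_power)
    then have "1 * 1 \<le> b ^ length Y * c ^ k" by (intro mult_mono) auto
    then show "1 \<le> weight b c (tlen l) q" using weight_ge[OF assms(1,2), of Y k "tlen l" x X] q by simp
  qed
  with le show "real (length Q) \<le> ?W powr (real (length us) / real (block t) + 1)" by simp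
qed

context extension_algorithm
begin

definition correct :: "bitstring \<Rightarrow> tree \<Rightarrow> bool" where
  "correct I y \<longleftrightarrow> (if family \<Phi> I = {} then y = Leaf
     else \<exists>S z. S \<in> family \<Phi> I \<and> represents z S \<and> y = Node Leaf z)"

abbreviation solve :: program where
  "solve \<equiv> compile (solve_tm pU p)"

text \<open>Termination with \<open>Leaf\<close> is all that matters here: the universal search runs
  every candidate under a clock, so a wrong candidate cannot delay the others.\<close>

lemma solve_invalid:
  assumes "\<not> valid_cover (decoded i)"
  shows "\<exists>m. computes solve (Node (enc_nat i) (enc_bits I)) Leaf m"
proof -
  let ?x = "Node (enc_nat i) (enc_bits I)" and ?t = "decoded i"
  obtain m1 where m1: "runtime decode_prog (enc_nat i) = enat m1"
    using runtime_pure[OF pure_decode_tm] unfolding decode_prog_def by fastforce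
  obtain m2 where m2: "runtime valid_prog ?t = enat m2"
    using runtime_valid[of ?t] by (cases "runtime valid_prog ?t") auto
  have v: "result valid_prog ?t = Leaf" using result_valid[of ?t] assms by simp
  have "\<exists>m. cost (solve_tm pU p) (inp ?x) = enat m"
    unfolding solve_tm_def by (simp add: m1 m2 v numeral_eq_enat)
  then obtain m where "cost (solve_tm pU p) (inp ?x) = enat m" by blast
  from computes_compile[OF this] show ?thesis
    by (intro exI[of _ "m + 3"]) (simp add: solve_tm_def v)
qed

text \<open>The constant depends on the candidate but not on the instance. The exponent
  \<open>d + dU + 3\<close> leaves room for the extension algorithm and for listing the universe,
  with two more from the conversion of budgets and one from the self-reduction, which asks at most
  one query per element.\<close>

lemma solve_valid:
  fixes i defines "t \<equiv> decoded i"
  assumes valid: "valid_cover t"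
  shows "\<exists>A\<ge>0. \<forall>I. \<exists>y m. correct I y \<and> computes solve (Node (enc_nat i) (enc_bits I)) (Node y Leaf) m \<and>
    real m \<le> A * real (length I + 1) ^ (d + dU + 3) *
       cover_weight b c t powr (real (card (universe \<Phi> I)) / real (block t) + 1)"
proof -
  obtain m1 where m1: "runtime decode_prog (enc_nat i) = enat m1"
    using runtime_pure[OF pure_decode_tm] unfolding decode_prog_def by fastforce
  obtain m2 where m2: "runtime valid_prog t = enat m2"
    using runtime_valid[of t] by (cases "runtime valid_prog t") auto
  have v: "result valid_prog t \<noteq> Leaf" using result_valid[of t] valid by simp
  obtain A1 where A1: "\<And>us M. (\<And>ys zs. us = ys @ zs \<Longrightarrow> length (snd (expansion t ys)) \<le> M) \<Longrightarrow>
     runtime expand_prog (Node t (enc_list enc_bits us)) \<le> enat (A1 * (length us + 1) * (M + 1))"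
    using runtime_expand[of t] by meson
  obtain A2 where A2: "A2 \<ge> 0" "\<And>I Q. (\<forall>(x, k, X, Y)\<in>set Q. distinct X \<and> set X \<subseteq> universe \<Phi> I) \<Longrightarrow>
     (if \<exists>(x, k, X, Y)\<in>set Q. extendable I (set X) k
      then \<exists>(x, k, X, Y)\<in>set Q. extendable I (set X) k \<and>
        result search_prog (Node (enc_bits I) (enc_list enc_query Q)) = enc_query (x, k, X, Y)
      else result search_prog (Node (enc_bits I) (enc_list enc_query Q)) = Leaf) \<and>
     (\<exists>m. runtime search_prog (Node (enc_bits I) (enc_list enc_query Q)) \<le> enat m \<and>
        real m \<le> A2 * (1 + (\<Sum>(x, k, X, Y)\<leftarrow>Q. query_bound I X k)))"
    using search by blast
  obtain A3 where A3: "A3 \<ge> 0" "\<And>I x k X Y. distinct (X @ Y) \<Longrightarrow> set X \<union> set Y = universe \<Phi> I \<Longrightarrow> extendable I (set X) k \<Longrightarrow>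
     (\<exists>Z. distinct Z \<and> set Z \<in> family \<Phi> I \<and>
       result construct_prog (Node (enc_bits I) (enc_query (x, k, X, Y))) = enc_list enc_bits Z) \<and>
     (\<exists>m. runtime construct_prog (Node (enc_bits I) (enc_query (x, k, X, Y))) \<le> enat m \<and>
        real m \<le> A3 * (real (length I) + 1) * query_bound I X k)"
    using construct by blast
  define R where "R = Max (insert 0 ((\<lambda>i. tlen (tl_tree i)) ` set (tlist (tl_tree t))))"
  have R: "tlen (tl_tree i) \<le> R" if "i \<in> set (tlist (tl_tree t))" for i
    unfolding R_def using that by (intro Max_ge) auto
  define K where "K = 200 + call_cost decode_prog + m1 + call_cost valid_prog + m2 + call_cost pU + call_cost expand_prog
     + call_cost search_prog + call_cost construct_prog"
  define A where "A = real K + \<bar>CU\<bar> + 2 * real A1 + A2 * (1 + (real R + 1) ^ 2) + A3 * (real R + 1) ^ 2"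
  have "A \<ge> 0" using A2(1) A3(1) by (simp add: A_def)
  moreover have "\<exists>y m. correct I y \<and> computes solve (Node (enc_nat i) (enc_bits I)) (Node y Leaf) m \<and>
    real m \<le> A * real (length I + 1) ^ (d + dU + 3) *
       cover_weight b c t powr (real (card (universe \<Phi> I)) / real (block t) + 1)" for I
  proof -
    let ?x = "Node (enc_nat i) (enc_bits I)"
    let ?N = "real (length I + 1)"
    obtain us tU where us: "distinct us" "set us = universe \<Phi> I" "computes pU (enc_bits I) (enc_list enc_bits us) tU"
      "real tU \<le> CU * ?N ^ dU"
      using universe[of I] by (auto simp: represents_def)
    define n where "n = length us"
    have n: "n = card (universe \<Phi> I)" using us(1,2) distinct_card[of us] by (simp add: n_def)
    have nN: "real n + 1 \<le> ?N" using card_universe_le[of I] n by simp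
    define P where "P = cover_weight b c t powr (real n / real (block t) + 1)"
    have W: "cover_weight b c t \<ge> 1" by (rule cover_weight_ge_1[OF b c valid])
    have P: "1 \<le> P" unfolding P_def using W by (intro ge_one_powr_ge_zero) auto
    define M where "M = nat \<lfloor>P\<rfloor>"
    have M: "real M \<le> P" using P by (simp add: M_def)
    obtain l Q where lQ: "expansion t us = (l, Q)" by fastforce
    have exp_rt: "runtime expand_prog (Node t (enc_list enc_bits us)) \<le> enat (A1 * (n + 1) * (M + 1))"
      unfolding n_def
    proof (rule A1)
      fix ys zs assume "us = ys @ zs"
      then have le: "length ys \<le> n" by (simp add: n_def)
      obtain l' Q' where e: "expansion t ys = (l', Q')" by fastforce
      have "real (length ys) / real (block t) \<le> real n / real (block t)"
        using le by (intro divide_right_mono) auto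
      then have "cover_weight b c t powr (real (length ys) / real (block t) + 1) \<le> P"
        unfolding P_def using W by (intro powr_mono) auto
      then have "real (length Q') \<le> P"
        using expansion_weight_le(2)[OF b c valid e] by simp
      then show "length (snd (expansion t ys)) \<le> M" by (simp add: e M_def le_nat_floor)
    qed
    have Q: "distinct (X @ Y) \<and> set X \<union> set Y = universe \<Phi> I \<and> k \<le> R * n" if "(x, k, X, Y) \<in> set Q" for x k X Y
      using expansion_sets[OF lQ us(1) R that] us(2) by (simp add: n_def)
    have Q': "\<forall>(x, k, X, Y)\<in>set Q. distinct X \<and> set X \<subseteq> universe \<Phi> I" using Q by fastforce
    let ?s = "result search_prog (Node (enc_bits I) (enc_list enc_query Q))"
    from A2(2)[OF Q'] obtain ms where
      s: "if \<exists>(x, k, X, Y)\<in>set Q. extendable I (set X) k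
      then \<exists>(x, k, X, Y)\<in>set Q. extendable I (set X) k \<and> ?s = enc_query (x, k, X, Y) else ?s = Leaf" and
      ms: "runtime search_prog (Node (enc_bits I) (enc_list enc_query Q)) \<le> enat ms"
        "real ms \<le> A2 * (1 + (\<Sum>(x, k, X, Y)\<leftarrow>Q. query_bound I X k))" by blast
    define H where "H = (real R + 1) ^ 2 * ?N ^ (d + 2)"
    have qb: "query_bound I X k \<le> H * (b ^ length Y * c ^ k)" if "(x, k, X, Y) \<in> set Q" for x k X Y
    proof -
      \<comment> \<open>Since \<open>X\<close> and \<open>Y\<close> partition the universe, the
        exponent of \<open>b\<close> in the query bound equals \<open>length Y\<close>, as in the
        bound on the expansion.\<close>
      have "card (universe \<Phi> I) = length (X @ Y)" using Q[OF that] distinct_card[of "X @ Y"] by simp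
      then have 1: "card (universe \<Phi> I) - length X = length Y" by simp
      have "real k + 1 \<le> real (R * n) + 1" using Q[OF that] by (simp only: add_le_cancel_right of_nat_le_iff)
      also have "\<dots> \<le> (real R + 1) * (real n + 1)" by (simp add: algebra_simps)
      also have "\<dots> \<le> (real R + 1) * ?N" using nN by (intro mult_left_mono) auto
      finally have "(real k + 1) ^ 2 \<le> ((real R + 1) * ?N) ^ 2" by (intro power_mono) auto
      then have "(real k + 1) ^ 2 * ?N ^ d \<le> ((real R + 1) * ?N) ^ 2 * ?N ^ d" by (intro mult_right_mono) auto
      also have "\<dots> = H" by (simp add: H_def power_mult_distrib power_add power2_eq_square)
      finally have "(real k + 1) ^ 2 * ?N ^ d \<le> H" .
      then show ?thesis unfolding query_bound_def 1 using b c by (intro mult_right_mono) auto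
    qed
    have H: "0 \<le> H" by (simp add: H_def)
    have "(\<Sum>(x, k, X, Y)\<leftarrow>Q. query_bound I X k) \<le> (\<Sum>(x, k, X, Y)\<leftarrow>Q. H * (b ^ length Y * c ^ k))"
      using qb by (intro sum_list_mono) fastforce
    also have "\<dots> = H * (\<Sum>(x, k, X, Y)\<leftarrow>Q. b ^ length Y * c ^ k)"
      unfolding sum_list_const_mult[symmetric] by (simp only: case_prod_unfold)
    also have "\<dots> \<le> H * P"
      using expansion_weight_le(1)[OF b c valid lQ] H unfolding P_def n_def by (intro mult_left_mono) auto
    finally have sumQ: "(\<Sum>(x, k, X, Y)\<leftarrow>Q. query_bound I X k) \<le> H * P" .
    have elemQ: "query_bound I X k \<le> H * P" if "(x, k, X, Y) \<in> set Q" for x k X Y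
    proof -
      have "query_bound I X k \<le> (\<Sum>(x, k, X, Y)\<leftarrow>Q. query_bound I X k)"
      proof -
        have "query_bound I X k \<in> set (map (\<lambda>(x, k, X, Y). query_bound I X k) Q)" using that by force
        moreover have "\<forall>z\<in>set (map (\<lambda>(x, k, X, Y). query_bound I X k) Q). 0 \<le> z"
          using query_bound_ge_1 by (auto intro: order_trans[OF zero_le_one])
        ultimately show ?thesis using member_le_sum_list by blast
      qed
      with sumQ show ?thesis by simp
    qed
    have "\<exists>mc. (?s \<noteq> Leaf \<longrightarrow> runtime construct_prog (Node (enc_bits I) ?s) \<le> enat mc \<and>
        (\<exists>Z. distinct Z \<and> set Z \<in> family \<Phi> I \<and> result construct_prog (Node (enc_bits I) ?s) = enc_list enc_bits Z)) \<and>
        real mc \<le> A3 * ?N * (H * P)"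
    proof (cases "?s = Leaf")
      case True
      then show ?thesis using A3(1) H P by (intro exI[of _ 0]) simp
    next
      case False
      with s obtain x k X Y where q: "(x, k, X, Y) \<in> set Q" "extendable I (set X) k" "?s = enc_query (x, k, X, Y)"
        by (auto split: if_splits)
      have "distinct (X @ Y)" "set X \<union> set Y = universe \<Phi> I" using Q[OF q(1)] by auto
      from A3(2)[OF this q(2), of x] obtain Z m where
        "distinct Z" "set Z \<in> family \<Phi> I" "result construct_prog (Node (enc_bits I) ?s) = enc_list enc_bits Z"
        and m: "runtime construct_prog (Node (enc_bits I) ?s) \<le> enat m" "real m \<le> A3 * (real (length I) + 1) * query_bound I X k"
        unfolding q(3) by blast
      moreover have "real m \<le> A3 * ?N * (H * P)"
      proof -
        have "A3 * (real (length I) + 1) * query_bound I X k \<le> A3 * (real (length I) + 1) * (H * P)"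
          using elemQ[OF q(1)] A3(1) by (intro mult_left_mono) auto
        with m(2) show ?thesis by (simp add: add.commute)
      qed
      ultimately show ?thesis by blast
    qed
    then obtain mc where mc: "?s \<noteq> Leaf \<Longrightarrow> runtime construct_prog (Node (enc_bits I) ?s) \<le> enat mc"
        "?s \<noteq> Leaf \<Longrightarrow> \<exists>Z. distinct Z \<and> set Z \<in> family \<Phi> I \<and> result construct_prog (Node (enc_bits I) ?s) = enc_list enc_bits Z"
        "real mc \<le> A3 * ?N * (H * P)" by blast
    have rU: "result pU (enc_bits I) = enc_list enc_bits us" "runtime pU (enc_bits I) = enat tU"
      using us(3) by (rule computes_result, rule computes_runtime)
    have rE: "result expand_prog (Node t (enc_list enc_bits us)) = enc_list enc_query Q"
      by (simp add: result_expand lQ)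
    define T where "T = K + tU + A1 * (n + 1) * (M + 1) + ms + mc"
    have "cost (solve_tm pU p) (inp ?x) \<le> enat (
      4 + (call_cost decode_prog + cost_expr (HdE (Var 0)) + m1) + (4 + (call_cost valid_prog + cost_expr (Var 1) + m2) +
      (1 + cost_expr (Var 2) + max (4 + (call_cost pU + cost_expr (TlE (Var 0)) + tU) +
        (4 + (call_cost expand_prog + cost_expr (NodeE (Var 1) (Var 3)) + A1 * (n + 1) * (M + 1)) +
        (4 + (call_cost search_prog + cost_expr (NodeE (TlE (Var 0)) (Var 4)) + ms) +
        (1 + cost_expr (Var 5) + max (4 + (call_cost construct_prog + cost_expr (NodeE (TlE (Var 0)) (Var 5)) + mc) + 6) 4)))) 2)))"
      unfolding solve_tm_def
      by (intro cost_Bind_le cost_Ite_le cost_Run_le)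
        (use m1 m2 exp_rt ms(1) mc(1) in \<open>simp_all add: rU rE flip: t_def\<close>)
    \<comment> \<open>Three steps are held back for those that \<open>compile\<close> adds.\<close>
    then have "cost (solve_tm pU p) (inp ?x) \<le> enat (T - 3)"
      by (rule cost_weaken) (simp add: T_def K_def)
    then obtain m where m: "cost (solve_tm pU p) (inp ?x) = enat m" "m \<le> T - 3"
      by (cases "cost (solve_tm pU p) (inp ?x)") auto
    have "den (solve_tm pU p) (inp ?x) = Node (if ?s \<noteq> Leaf then Node Leaf (result construct_prog (Node (enc_bits I) ?s)) else Leaf) Leaf"
      unfolding solve_tm_def using v by (simp add: rU rE flip: t_def cong: if_cong)
    then have comp: "computes solve ?x (Node (if ?s \<noteq> Leaf then Node Leaf (result construct_prog (Node (enc_bits I) ?s)) else Leaf) Leaf) (m + 3)"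
      using computes_compile[OF m(1)] by simp
    have "correct I (if ?s \<noteq> Leaf then Node Leaf (result construct_prog (Node (enc_bits I) ?s)) else Leaf)"
    proof (cases "?s = Leaf")
      case True
      \<comment> \<open>From a member \<open>S\<close> of the family,
        \<open>expansion_covers\<close> with no elements to come would produce a query that
        \<open>S - set X\<close> answers positively.\<close>
      have "family \<Phi> I = {}"
      proof (rule ccontr)
        assume "family \<Phi> I \<noteq> {}"
        then obtain S where S: "S \<in> family \<Phi> I" by blast
        then have SU: "S \<subseteq> universe \<Phi> I" by (rule family_subset)
        from expansion_covers[OF valid lQ, of S "[]"] obtain x k X Y r where
          q: "(x, k, X, Y) \<in> set Q" "set X \<subseteq> S" "length (filter (\<lambda>y. y \<in> S) Y) + r \<le> k" by blast
        have "S - set X = set (filter (\<lambda>y. y \<in> S) Y)" using Q[OF q(1)] SU by auto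
        then have "card (S - set X) \<le> k" using card_length[of "filter (\<lambda>y. y \<in> S) Y"] q(3) by simp
        moreover have "S - set X \<subseteq> universe \<Phi> I - set X" using SU by blast
        moreover have "(S - set X) \<union> set X \<in> family \<Phi> I" using S q(2) by (simp add: Un_absorb2)
        ultimately have "extendable I (set X) k" unfolding extendable_def by blast
        then have ex: "\<exists>(x, k, X, Y)\<in>set Q. extendable I (set X) k" using q(1) by blast
        with s True obtain x k X Y where "?s = enc_query (x, k, X, Y)" by auto
        then show False using True by simp
      qed
      then show ?thesis using True by (simp add: correct_def)
    next
      case False
      from mc(2)[OF this] obtain Z where "distinct Z" "set Z \<in> family \<Phi> I"
         "result construct_prog (Node (enc_bits I) ?s) = enc_list enc_bits Z" by blast
      then show ?thesis using False by (auto simp: correct_def represents_def)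
    qed
    moreover have "real (m + 3) \<le> A * ?N ^ (d + dU + 3) * P"
    proof -
      let ?D = "?N ^ (d + dU + 3)"
      have N1: "1 \<le> ?N" by simp
      have D: "1 \<le> ?D" using N1 by (rule one_le_power)
      have DP: "1 \<le> ?D * P" using mult_mono[OF D P] by simp
      have i1: "real K \<le> real K * (?D * P)" using mult_left_mono[OF DP, of "real K"] by simp
      have i2: "real tU \<le> \<bar>CU\<bar> * (?D * P)"
      proof -
        have "?N ^ dU \<le> ?D" using N1 by (intro power_increasing) auto
        then have "?N ^ dU * 1 \<le> ?D * P" using P by (intro mult_mono) auto
        then have "\<bar>CU\<bar> * ?N ^ dU \<le> \<bar>CU\<bar> * (?D * P)" by (intro mult_left_mono) auto
        moreover have "CU * ?N ^ dU \<le> \<bar>CU\<bar> * ?N ^ dU" by (intro mult_right_mono) auto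
        ultimately show ?thesis using us(4) by linarith
      qed
      have i3: "real (A1 * (n + 1) * (M + 1)) \<le> 2 * real A1 * (?D * P)"
      proof -
        have "?N ^ 1 \<le> ?D" using N1 by (intro power_increasing) auto
        then have "real n + 1 \<le> ?D" using nN by simp
        moreover have "real M + 1 \<le> 2 * P" using M P by simp
        ultimately have "(real n + 1) * (real M + 1) \<le> ?D * (2 * P)" by (intro mult_mono) auto
        then have "real A1 * ((real n + 1) * (real M + 1)) \<le> real A1 * (?D * (2 * P))" by (intro mult_left_mono) auto
        then show ?thesis by (simp add: algebra_simps)
      qed
      have HD: "?N * H \<le> (real R + 1) ^ 2 * ?D"
      proof -
        have "?N * ?N ^ (d + 2) \<le> ?D" unfolding power_Suc[symmetric] using N1 by (intro power_increasing) auto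
        then have "(real R + 1) ^ 2 * (?N * ?N ^ (d + 2)) \<le> (real R + 1) ^ 2 * ?D" by (intro mult_left_mono) auto
        then show ?thesis by (simp only: H_def mult_ac)
      qed
      have NH: "?N * H * P \<le> (real R + 1) ^ 2 * (?D * P)"
        using mult_right_mono[OF HD, of P] P by (simp add: mult.assoc)
      have "H * 1 \<le> H * ?N" using H by (intro mult_left_mono) auto
      then have "H * P \<le> ?N * H * P" using P by (intro mult_right_mono) (auto simp: mult.commute)
      then have HP: "H * P \<le> (real R + 1) ^ 2 * (?D * P)" using NH by simp
      have i4: "real ms \<le> A2 * (1 + (real R + 1) ^ 2) * (?D * P)"
      proof -
        have "1 + (\<Sum>(x, k, X, Y)\<leftarrow>Q. query_bound I X k) \<le> (1 + (real R + 1) ^ 2) * (?D * P)"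
          using sumQ HP DP by (simp add: distrib_right)
        then have "A2 * (1 + (\<Sum>(x, k, X, Y)\<leftarrow>Q. query_bound I X k)) \<le> A2 * ((1 + (real R + 1) ^ 2) * (?D * P))"
          using A2(1) by (rule mult_left_mono)
        then show ?thesis using ms(2) by (simp add: mult.assoc)
      qed
      have i5: "real mc \<le> A3 * (real R + 1) ^ 2 * (?D * P)"
      proof -
        have "A3 * (?N * H * P) \<le> A3 * ((real R + 1) ^ 2 * (?D * P))" using NH A3(1) by (rule mult_left_mono)
        then show ?thesis using mc(3) by (simp only: mult.assoc)
      qed
      have "3 \<le> T" by (simp add: T_def K_def)
      then have "real (m + 3) \<le> real T" using m(2) unfolding of_nat_le_iff by linarith
      also have "\<dots> = real K + real tU + real (A1 * (n + 1) * (M + 1)) + real ms + real mc" by (simp add: T_def)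
      also have "\<dots> \<le> real K * (?D * P) + \<bar>CU\<bar> * (?D * P) + 2 * real A1 * (?D * P) + A2 * (1 + (real R + 1) ^ 2) * (?D * P)
         + A3 * (real R + 1) ^ 2 * (?D * P)"
        by (intro add_mono i1 i2 i3 i4 i5)
      also have "\<dots> = A * ?D * P" by (simp only: A_def distrib_right mult.assoc)
      finally show ?thesis .
    qed
    ultimately show ?thesis using comp unfolding P_def n by blast
  qed
  ultimately show ?thesis by blast
qed

end

section \<open>Universal search\<close>

text \<open>The state of the universal search is \<open>Node flag (Node x (Node clock (Node i cands)))\<close> with a true flag
  while it is running, and \<open>Node Leaf y\<close> once it has found the output \<open>y\<close>.\<close>

abbreviation (input) "clockE \<equiv> HdE (TlE (TlE (Var 0)))"

abbreviation (input) "candsE \<equiv> TlE (TlE (TlE (Var 0)))"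

definition round_body :: "program \<Rightarrow> tm" where
  "round_body p = Ite (Var 2) (Ret (Var 2))
     (Bind 3 (Run (clocked p) (NodeE clockE (NodeE (Var 1) (HdE (TlE (Var 0))))))
       (Ret (HdE (Var 3))))"

abbreviation (input) "run_all p \<equiv> For 1 2 candsE LeafE (round_body p)"

abbreviation (input) "double_clock \<equiv> For 1 2 clockE clockE (Ret (NodeE LeafE (Var 2)))"

definition round_tm :: "program \<Rightarrow> tm" where
  "round_tm p = Bind 4 (run_all p)
     (Ite (Var 4) (Ret (NodeE LeafE (HdE (Var 4))))
       (Bind 5 double_clock
         (Bind 6 (Run inc_prog (HdE candsE))
           (Ret (NodeE TrueE (NodeE (HdE (TlE (Var 0))) (NodeE (Var 5) (NodeE (Var 6) candsE))))))))"

text \<open>The number of rounds has no bound known in advance, so this loop is a genuine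
  \<open>While\<close> around the compiled round, with the registers allotted as in
  \<open>compile\<close>.\<close>

definition round_loop :: "program \<Rightarrow> program" where
  "round_loop p = While (HdE (Var 0)) (Seq (code (round_tm p) (\<lambda>i. if i = 0 then 0 else 1) 2) (Assign 0 (Var 2)))"

text \<open>The initial state is that of round 0: the unary clock of length 1 and the candidate list
  [0] are both the tree \<open>TrueE\<close>, because 0 is encoded as \<open>Leaf\<close>.\<close>

definition universal_search :: "program \<Rightarrow> program" where
  "universal_search p = Seq (Assign 0 (NodeE TrueE (NodeE (Var 0) (NodeE TrueE TrueE))))
     (Seq (round_loop p) (Assign 0 (TlE (Var 0))))"

text \<open>Round \<open>s\<close> runs the candidates 0 to \<open>s\<close>, each with a clock of
  length 2^s. The largest comes first, so that the next one is the successor of the head.\<close>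

definition round_state :: "tree \<Rightarrow> nat \<Rightarrow> tree" where
  "round_state x s = Node (Node Leaf Leaf) (Node x (Node (unary (2 ^ s)) (enc_list enc_nat (rev [0..<Suc s]))))"

lemma fold_or_cases: "fold (\<lambda>x y. if y \<noteq> Leaf then y else f x) xs a = a \<or>
    (\<exists>x\<in>set xs. fold (\<lambda>x y. if y \<noteq> Leaf then y else f x) xs a = f x)"
proof (induction xs arbitrary: a)
  case (Cons x xs)
  from Cons.IH[of "if a \<noteq> Leaf then a else f x"] show ?case by (cases "a = Leaf") auto
qed simp

lemma iter_unary_unary: "iter (\<lambda>x. Node Leaf) (unary m) (unary k) = unary (k + m)"
  using iter_unary[of "unary m" k] by simp

text \<open>The assumption \<open>total\<close> makes the search sound: a candidate stopped by the
  clock yields nothing, and one that finishes either rejects or gives an output satisfying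
  \<open>P\<close>. A round costs about s + 1 clocks of length 2^s, plus the doubling of the
  clock.\<close>

lemma round_step:
  fixes s :: nat
  assumes total: "\<And>i. \<exists>y t. computes p (Node (enc_nat i) x) y t \<and> (y = Leaf \<or> (\<exists>z. y = Node z Leaf \<and> P z))"
  defines "a \<equiv> den (round_tm p) (inp (round_state x s))"
  shows "(\<exists>z. a = Node Leaf z \<and> P z) \<or> a = round_state x (Suc s)"
    and "computes p (Node (enc_nat i) x) (Node y Leaf) t \<Longrightarrow> i \<le> s \<Longrightarrow> t < 2 ^ s \<Longrightarrow> a \<noteq> round_state x (Suc s)"
    and "cost (round_tm p) (inp (round_state x s)) \<le>
      enat ((1000 + call_cost (clocked p) + 2 * clock_const p + call_cost inc_prog) * ((s + 2) * 2 ^ s))"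
proof -
  define k where "k = unary (2 ^ s)"
  define cands where "cands = rev [0..<Suc s]"
  have st: "round_state x s = Node (Node Leaf Leaf) (Node x (Node k (enc_list enc_nat cands)))"
    by (simp add: round_state_def k_def cands_def)
  have cands: "cands = s # rev [0..<s]" by (simp add: cands_def)
  define f where "f = (\<lambda>i. hd_tree (result (clocked p) (Node k (Node (enc_nat i) x))))"
  define B where "B = clock_const p * (1 + 2 ^ s) + 20"
  have f: "f i = Leaf \<or> (\<exists>z. f i = Node z Leaf \<and> P z)"
    and rt: "runtime (clocked p) (Node k (Node (enc_nat i) x)) \<le> enat B" for i
  proof -
    from total[of i] obtain y t where y: "computes p (Node (enc_nat i) x) y t" "y = Leaf \<or> (\<exists>z. y = Node z Leaf \<and> P z)"
      by blast
    from computes_clocked[OF y(1), of k] obtain z v where z: "computes (clocked p) (Node k (Node (enc_nat i) x)) z v"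
      "v \<le> clock_const p * (1 + tlen k) + 20" "z = Leaf \<or> z = Node y Leaf" by blast
    from computes_result[OF z(1)] y(2) z(3) show "f i = Leaf \<or> (\<exists>z. f i = Node z Leaf \<and> P z)"
      by (auto simp: f_def)
    from computes_runtime[OF z(1)] z(2) show "runtime (clocked p) (Node k (Node (enc_nat i) x)) \<le> enat B"
      by (simp add: B_def k_def)
  qed
  let ?s = "inp (round_state x s)"
  have den_body: "den (round_body p) (?s(1 := enc_nat i, 2 := y)) = (if y \<noteq> Leaf then y else f i)" for i y
    by (simp add: round_body_def st f_def cong: if_cong)
  define r where "r = fold (\<lambda>i y. if y \<noteq> Leaf then y else f i) cands Leaf"
  have den_loop: "den (run_all p) ?s = r"
  proof -
    have "den (run_all p) ?s =
        fold (\<lambda>i y. den (round_body p) (?s(1 := enc_nat i, 2 := y))) cands (eval_expr LeafE ?s)"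
      by (rule den_For_enc) (simp add: st)
    also have "(\<lambda>i y. den (round_body p) (?s(1 := enc_nat i, 2 := y))) = (\<lambda>i y. if y \<noteq> Leaf then y else f i)"
      by (intro ext den_body)
    finally show ?thesis by (simp add: r_def)
  qed
  have den_double: "den double_clock (?s(4 := r)) = unary (2 ^ Suc s)"
    by (simp add: st k_def iter_unary_unary mult_2)
  have a: "a = (if r \<noteq> Leaf then Node Leaf (hd_tree r) else round_state x (Suc s))"
  proof (cases "r = Leaf")
    case True
    have "a = Node (Node Leaf Leaf) (Node x (Node (unary (2 ^ Suc s)) (Node (result inc_prog (enc_nat s)) (enc_list enc_nat cands))))"
      unfolding a_def round_tm_def den.simps(1,2,3) den_loop den_double using True by (simp add: st cands)
    then show ?thesis using True by (simp add: round_state_def result_inc cands)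
  next
    case False
    then show ?thesis unfolding a_def round_tm_def den.simps(1,2,3) den_loop by simp
  qed
  have "r = Leaf \<or> (\<exists>i\<in>set cands. r = f i)" unfolding r_def by (rule fold_or_cases)
  then have r: "r = Leaf \<or> (\<exists>z. r = Node z Leaf \<and> P z)" using f by metis
  then show "(\<exists>z. a = Node Leaf z \<and> P z) \<or> a = round_state x (Suc s)" unfolding a by auto
  {
    assume i: "computes p (Node (enc_nat i) x) (Node y Leaf) t" "i \<le> s" "t < 2 ^ s"
    from computes_clocked[OF i(1), of k] i(3) obtain v where
      "computes (clocked p) (Node k (Node (enc_nat i) x)) (Node (Node y Leaf) Leaf) v"
      by (auto simp: k_def)
    from computes_result[OF this] have "f i \<noteq> Leaf" by (simp add: f_def)
    moreover have "i \<in> set cands" using i(2) by (auto simp: cands_def)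
    ultimately have "r \<noteq> Leaf" unfolding r_def fold_or by blast
    then show "a \<noteq> round_state x (Suc s)" unfolding a by (simp add: round_state_def)
  }
  have 1: "cost (run_all p) ?s
      \<le> enat (6 + cost_expr LeafE + cost_expr candsE + length cands * (13 + (20 + call_cost (clocked p) + B)))"
  proof (rule cost_For_le_const[where f = enc_nat])
    show "eval_expr candsE ?s = enc_list enc_nat cands" by (simp add: st)
    fix i y
    have "cost (round_body p) (?s(1 := enc_nat i, 2 := y)) \<le> enat (1 + cost_expr (Var 2) + max 2 (4 + (call_cost (clocked p) +
       cost_expr (NodeE clockE (NodeE (Var 1) (HdE (TlE (Var 0))))) + B) + 3))"
      unfolding round_body_def by (intro cost_Ite_le cost_Bind_le cost_Run_le) (use rt[of i] in \<open>simp_all add: st\<close>)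
    then show "cost (round_body p) (?s(1 := enc_nat i, 2 := y)) \<le> enat (20 + call_cost (clocked p) + B)"
      by (rule cost_weaken) simp
  qed
  have 2: "cost double_clock (?s(4 := r))
    \<le> enat (6 + cost_expr clockE + cost_expr clockE + length (replicate (2 ^ s) Leaf) * (13 + 4))"
    by (rule cost_For_le_const[where f = "\<lambda>x. x"]) (simp_all add: st k_def flip: unary_eq_enc)
  have "cost (round_tm p) ?s \<le> enat (4 +
     (6 + cost_expr LeafE + cost_expr candsE + length cands * (13 + (20 + call_cost (clocked p) + B))) +
     (1 + cost_expr (Var 4) + max 5 (4 + (6 + cost_expr clockE + cost_expr clockE + length (replicate (2 ^ s) Leaf) * (13 + 4)) +
      (4 + (call_cost inc_prog + cost_expr (HdE candsE) + (100 + 100 * s)) +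
       20))))"
    unfolding round_tm_def
  proof (intro cost_Bind_le cost_Ite_le cost_Run_le 1)
    show "runtime inc_prog (eval_expr (HdE candsE) (?s(4 := den (run_all p) ?s,
       5 := den double_clock (?s(4 := den (run_all p) ?s)))))
       \<le> enat (100 + 100 * s)"
      using runtime_inc[of s] by (simp add: st cands)
  qed (use 2 in \<open>simp_all only: den_loop\<close>, simp_all)
  then show "cost (round_tm p) ?s \<le> enat ((1000 + call_cost (clocked p) + 2 * clock_const p + call_cost inc_prog) * ((s + 2) * 2 ^ s))"
  proof (rule cost_weaken)
    define h :: nat where "h = 2 ^ s"
    have h: "1 \<le> h" by (simp add: h_def)
    then obtain h' where "h = Suc h'" by (cases h) auto
    then show "4 +
     (6 + cost_expr LeafE + cost_expr candsE + length cands * (13 + (20 + call_cost (clocked p) + B))) +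
     (1 + cost_expr (Var 4) + max 5 (4 + (6 + cost_expr clockE + cost_expr clockE + length (replicate (2 ^ s) Leaf) * (13 + 4)) +
      (4 + (call_cost inc_prog + cost_expr (HdE candsE) + (100 + 100 * s)) +
       20))) \<le> (1000 + call_cost (clocked p) + 2 * clock_const p + call_cost inc_prog) * ((s + 2) * 2 ^ s)"
      unfolding B_def h_def[symmetric] by (simp add: cands algebra_simps)
  qed
qed

text \<open>Candidate \<open>i\<close> succeeds in round \<open>s\<close> at the latest. Each of the
  s + 1 rounds is charged the bound for round \<open>s\<close>, which explains the square. If
  \<open>s\<close> is chosen small, 2^s stays within a constant factor, depending on
  \<open>i\<close>, of the time of that candidate.\<close>

lemma computes_universal_search:
  assumes total: "\<And>i. \<exists>y t. computes p (Node (enc_nat i) x) y t \<and> (y = Leaf \<or> (\<exists>z. y = Node z Leaf \<and> P z))"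
    and i: "computes p (Node (enc_nat i) x) (Node y Leaf) t" "i \<le> s" "t < 2 ^ s"
  shows "\<exists>z v. computes (universal_search p) x z v \<and> P z \<and>
    v \<le> (1100 + call_cost (clocked p) + 2 * clock_const p + call_cost inc_prog) * ((s + 2) ^ 2 * 2 ^ s)"
proof -
  define A where "A = 1000 + call_cost (clocked p) + 2 * clock_const p + call_cost inc_prog"
  define T where "T = A * ((s + 2) * 2 ^ s)"
  define r :: "nat \<Rightarrow> nat" where "r = (\<lambda>i. if i = 0 then 0 else 1)"
  have loop: "\<exists>v u'. exec (round_loop p) u v u' \<and> (\<exists>z. u' 0 = Node Leaf z \<and> P z) \<and> v \<le> (s - j + 1) * (T + 10) + 10"
    if "j \<le> s" "u 0 = round_state x j" "u 1 = Leaf" for j u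
    using that
  proof (induction "s - j" arbitrary: j u rule: less_induct)
    case less
    have "cost (round_tm p) (inp (round_state x j)) \<le> enat (A * ((j + 2) * 2 ^ j))"
      unfolding A_def by (rule round_step(3)[OF total])
    moreover have "A * ((j + 2) * 2 ^ j) \<le> T"
      unfolding T_def using less.prems(1) by (intro mult_le_mono2 mult_le_mono power_increasing) auto
    ultimately have "cost (round_tm p) (inp (round_state x j)) \<le> enat T" by (rule cost_weaken)
    then obtain m where m: "cost (round_tm p) (inp (round_state x j)) = enat m" "m \<le> T"
      by (cases "cost (round_tm p) (inp (round_state x j))") auto
    have "\<exists>u1. exec (code (round_tm p) r 2) u m u1 \<and> u1 2 = den (round_tm p) (inp (round_state x j)) \<and> (\<forall>j<2. u1 j = u j)"
      by (rule exec_code) (use less.prems m(1) in \<open>auto simp: r_def inp_def\<close>)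
    then obtain u1 where u1: "exec (code (round_tm p) r 2) u m u1" "u1 2 = den (round_tm p) (inp (round_state x j))" "\<forall>j<2. u1 j = u j"
      by blast
    define u2 where "u2 = u1(0 := u1 2)"
    have "exec (Assign 0 (Var 2)) u1 2 u2" by (rule exec_Assign) (simp_all add: u2_def)
    then have body: "exec (Seq (code (round_tm p) r 2) (Assign 0 (Var 2))) u (1 + m + 2) u2"
      by (rule exec.Seq[OF u1(1)])
    have cond: "eval_expr (HdE (Var 0)) u \<noteq> Leaf" using less.prems by (simp add: round_state_def)
    have u2: "u2 0 = den (round_tm p) (inp (round_state x j))" "u2 1 = Leaf"
      using u1 less.prems by (auto simp: u2_def)
    have loop_eq: "round_loop p = While (HdE (Var 0)) (Seq (code (round_tm p) r 2) (Assign 0 (Var 2)))"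
      by (simp add: round_loop_def r_def)
    show ?case
    proof (cases "\<exists>z. u2 0 = Node Leaf z \<and> P z")
      case True
      have "exec (round_loop p) u2 (1 + cost_expr (HdE (Var 0))) u2"
        unfolding loop_eq by (rule exec.WhileFalse) (use True in auto)
      then have "exec (round_loop p) u (1 + cost_expr (HdE (Var 0)) + (1 + m + 2) + (1 + cost_expr (HdE (Var 0)))) u2"
        unfolding loop_eq by (rule exec.WhileTrue[OF cond body])
      moreover have "1 + cost_expr (HdE (Var 0)) + (1 + m + 2) + (1 + cost_expr (HdE (Var 0))) \<le> (s - j + 1) * (T + 10) + 10"
        using m(2) by simp
      ultimately show ?thesis using True by blast
    next
      case False
      with round_step(1)[where P = P, OF total] u2(1) have next_state: "u2 0 = round_state x (Suc j)"
        by auto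
      then have "j \<noteq> s" using round_step(2)[OF total i] u2(1) by auto
      then have "j < s" using less.prems by simp
      then have "s - Suc j < s - j" "Suc j \<le> s" by auto
      from less.hyps[OF this next_state u2(2)] obtain v u' where
        v: "exec (round_loop p) u2 v u'" "\<exists>z. u' 0 = Node Leaf z \<and> P z" "v \<le> (s - Suc j + 1) * (T + 10) + 10" by blast
      have "exec (round_loop p) u (1 + cost_expr (HdE (Var 0)) + (1 + m + 2) + v) u'"
        using v(1) unfolding loop_eq by (rule exec.WhileTrue[OF cond body])
      moreover have "1 + cost_expr (HdE (Var 0)) + (1 + m + 2) + v \<le> (s - j + 1) * (T + 10) + 10"
      proof -
        have "s - j = Suc (s - Suc j)" using \<open>j < s\<close> by simp
        then show ?thesis using v(3) m(2) by simp
      qed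
      ultimately show ?thesis using v(2) by blast
    qed
  qed
  define u where "u = (inp x)(0 := round_state x 0)"
  have init: "exec (Assign 0 (NodeE TrueE (NodeE (Var 0) (NodeE TrueE TrueE)))) (inp x) 14 u"
    by (rule exec_Assign) (simp_all add: u_def round_state_def enc_nat_0)
  from loop[of 0 u] obtain v u' z where
    v: "exec (round_loop p) u v u'" "u' 0 = Node Leaf z" "P z" "v \<le> (s + 1) * (T + 10) + 10"
    by (auto simp: u_def)
  have fin: "exec (Assign 0 (TlE (Var 0))) u' 3 (u'(0 := z))"
    by (rule exec_Assign) (simp_all add: v(2))
  have "exec (universal_search p) (inp x) (1 + 14 + (1 + v + 3)) (u'(0 := z))"
    unfolding universal_search_def by (rule exec.Seq[OF init exec.Seq[OF v(1) fin]])
  then have "computes (universal_search p) x z (1 + 14 + (1 + v + 3))"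
    unfolding computes_inp by (intro exI[of _ "u'(0 := z)"]) simp
  moreover have "1 + 14 + (1 + v + 3) \<le> (1100 + call_cost (clocked p) + 2 * clock_const p + call_cost inc_prog) * ((s + 2) ^ 2 * 2 ^ s)"
  proof -
    have *: "1 + 14 + (1 + v + 3) \<le> (s + 2) * (T + 28)" using v(4) by (simp add: algebra_simps)
    have T: "T + 28 \<le> (A + 100) * ((s + 2) * 2 ^ s)"
    proof -
      define h where "h = (s + 2) * (2 ^ s :: nat)"
      have "1 * 1 \<le> h" unfolding h_def by (intro mult_le_mono) auto
      then show ?thesis unfolding T_def h_def[symmetric] by (simp add: add_mult_distrib)
    qed
    have "1 + 14 + (1 + v + 3) \<le> (s + 2) * ((A + 100) * ((s + 2) * 2 ^ s))"
      using * mult_le_mono2[OF T] by (rule order_trans)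
    also have "\<dots> = (A + 100) * ((s + 2) ^ 2 * 2 ^ s)" by (simp only: power2_eq_square mult_ac)
    also have "A + 100 = 1100 + call_cost (clocked p) + 2 * clock_const p + call_cost inc_prog" by (simp add: A_def)
    finally show ?thesis .
  qed
  ultimately show ?thesis using v(3) by blast
qed

section \<open>The running time\<close>

text \<open>The set is listed without repetitions, so that the weight of the tree is exactly the sum
  over the set.\<close>

lemma cover_index:
  assumes "finite T" "\<And>X r. (X, r) \<in> T \<Longrightarrow> length X = Suc m"
    and "\<And>S. length S = Suc m \<Longrightarrow> \<exists>(X, r)\<in>T. below X S \<and> gap X S \<le> r"
  shows "\<exists>i. valid_cover (decoded i) \<and> block (decoded i) = Suc m \<and>
    cover_weight b c (decoded i) = (\<Sum>(X, r)\<in>T. b ^ (Suc m - ones X) * c ^ r)"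
proof -
  obtain L where L: "set L = T" "distinct L" using finite_distinct_list[OF assms(1)] by blast
  define f :: "bool list \<times> nat \<Rightarrow> tree" where "f = (\<lambda>(X, r). Node (enc_bits X) (unary r))"
  define t where "t = Node (unary m) (enc_list f L)"
  obtain i where i: "decoded i = t" unfolding t_def using decode_surj by blast
  have "valid_cover t" unfolding valid_cover_def
  proof
    fix S assume "S \<in> cube (Suc (tlen (hd_tree t)))"
    then have S: "length S = Suc m" by (simp add: t_def)
    from assms(3)[OF this] obtain X r where X: "(X, r) \<in> T" "below X S" "gap X S \<le> r" by blast
    have "cov (enc_bits X) r S" using cov_enc_bits[of X S r] assms(2)[OF X(1)] S X(2,3) by simp
    then show "\<exists>i\<in>set (tlist (tl_tree t)). cov (hd_tree i) (tlen (tl_tree i)) S"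
      using X(1) L(1) by (intro bexI[of _ "f (X, r)"]) (auto simp: t_def f_def)
  qed
  moreover have B: "block t = Suc m" by (simp add: block_def t_def)
  moreover have "cover_weight b c t = (\<Sum>(X, r)\<in>T. b ^ (Suc m - ones X) * c ^ r)"
  proof -
    have "cover_weight b c t = (\<Sum>(X, r)\<leftarrow>L. b ^ (Suc m - ins (Suc m) (enc_bits X)) * c ^ r)"
      unfolding cover_weight_def B by (simp add: t_def o_def f_def case_prod_unfold)
    also have "\<dots> = (\<Sum>(X, r)\<in>T. b ^ (Suc m - ins (Suc m) (enc_bits X)) * c ^ r)"
      using L by (simp add: sum_list_distinct_conv_sum_set)
    also have "\<dots> = (\<Sum>(X, r)\<in>T. b ^ (Suc m - ones X) * c ^ r)"
    proof (intro sum.cong refl)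
      fix z assume "z \<in> T"
      then show "(case z of (X, r) \<Rightarrow> b ^ (Suc m - ins (Suc m) (enc_bits X)) * c ^ r) = (case z of (X, r) \<Rightarrow> b ^ (Suc m - ones X) * c ^ r)"
        using assms(2) ins_enc_bits by (cases z) (metis case_prod_conv)
    qed
    finally show ?thesis .
  qed
  ultimately show ?thesis using i by (intro exI[of _ i]) simp
qed

lemma cube_cover_index:
  assumes "b \<ge> 1" "c \<ge> 1"
  shows "\<exists>i. valid_cover (decoded i) \<and> block (decoded i) = Suc m \<and>
    cover_weight b c (decoded i) \<le> (real (Suc m) + 1) ^ 2 * (1 + b - 1 / c) ^ Suc m"
proof -
  obtain T where T: "finite T" "\<forall>(X, r)\<in>T. length X = Suc m"
    "\<forall>S\<in>cube (Suc m). \<exists>(X, r)\<in>T. below X S \<and> gap X S \<le> r"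
    "(\<Sum>(X, r)\<in>T. b ^ (Suc m - ones X) * c ^ r) \<le> (real (Suc m) + 1) ^ 2 * (1 + b - 1 / c) ^ Suc m"
    using cube_cover_exists[OF assms, of "Suc m"] by blast
  obtain i where "valid_cover (decoded i)" "block (decoded i) = Suc m"
    "cover_weight b c (decoded i) = (\<Sum>(X, r)\<in>T. b ^ (Suc m - ones X) * c ^ r)"
    using cover_index[OF T(1), of m b c] T(2,3) by fast
  with T(4) show ?thesis by (intro exI[of _ i]) simp
qed

text \<open>For b = c = 1 the base is 1, and no exponent can absorb the polynomial loss of the
  greedy cover. Blocks of size 1 with the empty set and budget 1 have weight exactly 1; expanding
  them gives the single query for the empty set with budget n.\<close>

lemma unit_cover_index:
  "\<exists>i. valid_cover (decoded i) \<and> cover_weight 1 1 (decoded i) = 1"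
proof -
  have "\<exists>i. valid_cover (decoded i) \<and> block (decoded i) = Suc 0 \<and>
    cover_weight 1 1 (decoded i) = (\<Sum>(X, r)\<in>{([False], 1)}. 1 ^ (Suc 0 - ones X) * 1 ^ r)"
    by (rule cover_index) (auto simp: length_Suc_conv)
  then show ?thesis by auto
qed

context extension_algorithm
begin

definition subset_prog :: program where
  "subset_prog = universal_search solve"

lemma solve_total:
  "\<exists>y t. computes solve (Node (enc_nat i) (enc_bits I)) y t \<and> (y = Leaf \<or> (\<exists>z. y = Node z Leaf \<and> correct I z))"
proof (cases "valid_cover (decoded i)")
  case True
  from solve_valid[OF this] show ?thesis by blast
next
  case False
  from solve_invalid[OF this] show ?thesis by blast
qed

text \<open>The run with candidate \<open>i\<close> takes single-exponential time, so the number of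
  rounds is linear in the input length. The quadratic factor of the search then adds 2 to the
  degree, and waiting for candidate \<open>i\<close> costs the constant 2^(i + 1).\<close>

lemma subset_prog_time:
  fixes i defines "t \<equiv> decoded i"
  assumes valid: "valid_cover t"
  shows "\<exists>K>0. \<forall>I. \<exists>z v. computes subset_prog (enc_bits I) z v \<and> correct I z \<and>
    real v \<le> K * real (length I + 1) ^ (d + dU + 5) *
       cover_weight b c t powr (real (card (universe \<Phi> I)) / real (block t) + 1)"
proof -
  let ?W = "cover_weight b c t" and ?D = "d + dU + 3"
  obtain A where A: "A \<ge> 0" "\<And>I. \<exists>y m. correct I y \<and> computes solve (Node (enc_nat i) (enc_bits I)) (Node y Leaf) m \<and>
    real m \<le> A * real (length I + 1) ^ ?D * ?W powr (real (card (universe \<Phi> I)) / real (block t) + 1)"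
    using solve_valid[of i] valid unfolding t_def by blast
  have W: "?W \<ge> 1" by (rule cover_weight_ge_1[OF b c valid])
  define G where "G = 1100 + call_cost (clocked solve) + 2 * clock_const solve + call_cost inc_prog"
  \<comment> \<open>Chosen so that the logarithm of the time bound of candidate \<open>i\<close> is
    at most \<open>L\<close> times the input length plus one; \<open>K1\<close> then bounds the
    number of rounds in the same unit.\<close>
  define L where "L = ln (A + 1) + real ?D + ln ?W"
  have L: "L \<ge> 0" using A(1) W by (simp add: L_def)
  define K1 where "K1 = real i + 3 + 2 * L"
  define K where "K = real G * K1 ^ 2 * 2 ^ (i + 1) * (A + 1)"
  have "G > 0" by (simp add: G_def)
  then have "K > 0" unfolding K_def K1_def using A(1) L by (intro mult_pos_pos zero_less_power) auto
  moreover have "\<exists>z v. computes subset_prog (enc_bits I) z v \<and> correct I z \<and>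
    real v \<le> K * real (length I + 1) ^ (d + dU + 5) * ?W powr (real (card (universe \<Phi> I)) / real (block t) + 1)" for I
  proof -
    let ?N = "real (length I + 1)"
    let ?e = "real (card (universe \<Phi> I)) / real (block t) + 1"
    define E where "E = ?N ^ ?D * ?W powr ?e"
    obtain y m where m: "correct I y" "computes solve (Node (enc_nat i) (enc_bits I)) (Node y Leaf) m" "real m \<le> A * E"
      using A(2)[of I] by (auto simp: E_def mult.assoc)
    have N: "1 \<le> ?N" by simp
    have e0: "0 \<le> ?e" by simp
    have "1 \<le> ?N ^ ?D" using N by (rule one_le_power)
    moreover have "1 \<le> ?W powr ?e" using W e0 by (rule ge_one_powr_ge_zero)
    ultimately have "1 * 1 \<le> E" unfolding E_def by (intro mult_mono) auto
    then have E: "1 \<le> E" by simp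
    obtain n where n: "2 ^ n \<le> m + 1" "m + 1 < 2 ^ (n + 1)" using ex_power_ivl1[of 2 "m + 1"] by auto
    have "real (2 ^ n) \<le> real (m + 1)" using n(1) unfolding of_nat_le_iff .
    then have pn: "2 ^ n \<le> (A + 1) * E" using m(3) E by (simp add: algebra_simps)
    have "real n * ln 2 = ln (2 ^ n)" by (simp add: ln_realpow)
    also have "\<dots> \<le> ln ((A + 1) * E)" using pn A(1) E by (subst ln_le_cancel_iff) (auto intro: mult_pos_pos)
    also have "\<dots> = ln (A + 1) + ln E" using A(1) E by (intro ln_mult_pos) auto
    also have "ln E = real ?D * ln ?N + ?e * ln ?W"
      unfolding E_def using N W by (subst ln_mult_pos) (auto simp: ln_realpow ln_powr)
    also have "ln (A + 1) + (real ?D * ln ?N + ?e * ln ?W) \<le> L * ?N"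
    proof -
      have 1: "ln (A + 1) \<le> ln (A + 1) * ?N" using mult_left_mono[OF N, of "ln (A + 1)"] A(1) by simp
      have "ln ?N \<le> ?N" using ln_le_minus_one[of ?N] by simp
      then have 2: "real ?D * ln ?N \<le> real ?D * ?N" by (intro mult_left_mono) auto
      have "real (card (universe \<Phi> I)) / real (block t) \<le> real (card (universe \<Phi> I)) / 1"
        by (intro divide_left_mono) (auto simp: block_def)
      then have "?e \<le> ?N" using card_universe_le[of I] by simp
      then have 3: "?e * ln ?W \<le> ?N * ln ?W" using W by (intro mult_right_mono) auto
      have "ln (A + 1) + (real ?D * ln ?N + ?e * ln ?W) \<le> ln (A + 1) * ?N + (real ?D * ?N + ?N * ln ?W)"
        by (intro add_mono 1 2 3)
      also have "\<dots> = L * ?N" by (simp only: L_def distrib_right mult.commute[of ?N "ln ?W"] add.assoc)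
      finally show ?thesis .
    qed
    finally have "real n * ln 2 \<le> L * ?N" by simp
    \<comment> \<open>The inequality ln 2 \<ge> 1/2 comes from ln (1/2) \<le> 1/2 - 1.\<close>
    moreover have "real n * (1 / 2) \<le> real n * ln 2" using ln_le_minus_one[of "1 / 2"] by (intro mult_left_mono) (auto simp: ln_div)
    ultimately have n2: "real n \<le> 2 * L * ?N" by simp
    define s where "s = i + n + 1"
    have "i \<le> s" by (simp add: s_def)
    moreover have "m < 2 ^ s"
    proof -
      have "(2::nat) ^ (n + 1) \<le> 2 ^ s" by (rule power_increasing) (simp_all add: s_def)
      then show ?thesis using n(2) by linarith
    qed
    ultimately obtain z v where v: "computes subset_prog (enc_bits I) z v" "correct I z" "v \<le> G * ((s + 2) ^ 2 * 2 ^ s)"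
      using computes_universal_search[where P = "correct I", OF solve_total m(2)] unfolding subset_prog_def G_def by blast
    have "real v \<le> real (G * ((s + 2) ^ 2 * 2 ^ s))" using v(3) unfolding of_nat_le_iff .
    also have "\<dots> = real G * (real (s + 2) ^ 2 * 2 ^ s)" by simp
    also have "\<dots> \<le> real G * ((K1 * ?N) ^ 2 * (2 ^ (i + 1) * ((A + 1) * E)))"
    proof (intro mult_left_mono mult_mono power_mono)
      have "real i + 3 \<le> (real i + 3) * ?N" using mult_left_mono[OF N, of "real i + 3"] by simp
      then show "real (s + 2) \<le> K1 * ?N" using n2 unfolding K1_def s_def by (simp add: distrib_right)
      show "2 ^ s \<le> 2 ^ (i + 1) * ((A + 1) * E)"
        using mult_left_mono[OF pn, of "2 ^ (i + 1)"] by (simp add: s_def power_add mult_ac)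
    qed auto
    also have "\<dots> = K * ?N ^ (d + dU + 5) * ?W powr ?e"
    proof -
      have "?N ^ (d + dU + 5) = ?N ^ 2 * ?N ^ ?D" by (simp add: add.commute flip: power_add)
      then show ?thesis unfolding K_def E_def power_mult_distrib by (simp only: mult_ac)
    qed
    finally show ?thesis using v by blast
  qed
  ultimately show ?thesis by blast
qed

end

text \<open>Merges a bound for each \<delta>, with a constant depending on \<delta>, into one
  sublinear function: the worst excess over all inputs of a size lies below every line
  \<open>L + \<delta> * n\<close>. Adjoining 0 gives the supremum a meaning for sizes that do not
  occur and makes it nonnegative.\<close>

lemma sup_smallo:
  fixes h :: "'a \<Rightarrow> real" and size :: "'a \<Rightarrow> nat"
  assumes "\<And>\<delta>. \<delta> > 0 \<Longrightarrow> \<exists>L. \<forall>x. h x \<le> L + \<delta> * real (size x)"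
  shows "\<exists>g. g \<in> o(\<lambda>n. real n) \<and> (\<forall>x. h x \<le> g (size x))"
proof -
  define g where "g n = Sup (insert 0 (h ` {x. size x = n}))" for n
  have upper: "y \<le> max 0 L + \<delta> * real n" if "\<forall>x. h x \<le> L + \<delta> * real (size x)" "\<delta> > 0" "y \<in> insert 0 (h ` {x. size x = n})" for L \<delta> y n
  proof (cases "y = 0")
    case True
    then show ?thesis using that(2) by simp
  next
    case False
    with that(3) obtain x where "y = h x" "size x = n" by auto
    then have "y \<le> L + \<delta> * real n" using that(1) by blast
    then show ?thesis by simp
  qed
  have bdd: "bdd_above (insert 0 (h ` {x. size x = n}))" for n
  proof -
    obtain L where L: "\<forall>x. h x \<le> L + 1 * real (size x)" using assms[of 1] by auto
    show ?thesis by (rule bdd_aboveI) (rule upper[OF L], simp_all)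
  qed
  have g0: "0 \<le> g n" for n unfolding g_def by (intro cSup_upper bdd) auto
  have "h x \<le> g (size x)" for x unfolding g_def by (intro cSup_upper bdd) auto
  moreover have "g \<in> o(\<lambda>n. real n)"
  proof (rule landau_o.smallI)
    fix e :: real assume e: "e > 0"
    obtain L where L: "\<forall>x. h x \<le> L + e / 2 * real (size x)" using assms[of "e / 2"] e by auto
    have g: "g n \<le> max 0 L + e / 2 * real n" for n
      unfolding g_def using upper[OF L] e by (intro cSup_least) auto
    have "eventually (\<lambda>n. real n \<ge> 2 * max 0 L / e) sequentially"
      using filterlim_real_sequentially by (auto simp: filterlim_at_top)
    then show "eventually (\<lambda>n. norm (g n) \<le> e * norm (real n)) sequentially"
    proof eventually_elim
      case (elim n)
      then have "max 0 L \<le> e / 2 * real n" using e by (simp add: field_simps)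
      then show ?case using g[of n] g0[of n] by simp
    qed
  qed
  ultimately show ?thesis by blast
qed

lemma polynomial_factor_bound:
  assumes "\<beta> > 1" "\<delta> > 0"
  shows "\<exists>m. (real (Suc m) + 1) ^ 2 \<le> \<beta> powr (\<delta> * real (Suc m))"
proof -
  \<comment> \<open>The 4 consists of one factor 2 for the square and another for
    \<open>x \<le> 2 * real (Suc m)\<close>.\<close>
  define \<eta> where "\<eta> = \<delta> * ln \<beta> / 4"
  have \<eta>: "\<eta> > 0" using assms by (simp add: \<eta>_def)
  have "eventually (\<lambda>x::real. ln x / x < \<eta>) at_top"
    using ln_x_over_x_tendsto_0 \<eta> by (rule order_tendstoD(2))
  then obtain x0 where x0: "\<And>x. x \<ge> x0 \<Longrightarrow> ln x / x < \<eta>" by (auto simp: eventually_at_top_linorder)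
  obtain m where m: "real m \<ge> x0" using real_arch_simple by blast
  define x where "x = real (Suc m) + 1"
  have x: "x > 0" "x \<ge> x0" "x \<le> 2 * real (Suc m)" using m by (simp_all add: x_def)
  have "ln x < \<eta> * x" using x0[OF x(2)] x(1) by (simp add: divide_less_eq)
  also have "\<dots> \<le> \<eta> * (2 * real (Suc m))" using x(3) \<eta> by (intro mult_left_mono) auto
  finally have "ln x + ln x \<le> (\<delta> * real (Suc m)) * ln \<beta>" unfolding \<eta>_def by argo
  then have "exp (ln x + ln x) \<le> exp ((\<delta> * real (Suc m)) * ln \<beta>)" unfolding exp_le_cancel_iff .
  also have "exp (ln x + ln x) = x ^ 2" using x(1) unfolding exp_add power2_eq_square by simp
  also have "exp ((\<delta> * real (Suc m)) * ln \<beta>) = \<beta> powr (\<delta> * real (Suc m))" using assms(1) unfolding powr_def by auto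
  finally show ?thesis unfolding x_def by blast
qed

theorem theorem2:
  fixes \<Phi> :: "bitstring \<Rightarrow> set_system" and b c :: real
  assumes "implicit_set_system \<Phi>"
    and "poly_time_computable \<Phi>"
    and "b \<ge> 1" and "c \<ge> 1"
    and "\<exists>p (C::real) (d::nat). solves_extension_in \<Phi> p
           (\<lambda>I X k. C * b ^ (card (universe \<Phi> I) - card X) * c ^ k * real (length I + 1) ^ d)"
  shows "\<exists>q (C::real) (d::nat) (g :: nat \<Rightarrow> real). g \<in> o(\<lambda>n. real n) \<and>
           solves_subset_in \<Phi> q
             (\<lambda>I. C * (1 + b - 1 / c) powr
                        (real (card (universe \<Phi> I)) + g (card (universe \<Phi> I))) *
                  real (length I + 1) ^ d)"
proof -
  obtain p C d where ext: "solves_extension_in \<Phi> p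
           (\<lambda>I X k. C * b ^ (card (universe \<Phi> I) - card X) * c ^ k * real (length I + 1) ^ d)"
    using assms(5) by blast
  obtain pU CU dU where univ: "\<And>I. \<exists>y t. computes pU (enc_bits I) y t \<and> represents y (universe \<Phi> I) \<and>
      real t \<le> CU * real (length I + 1) ^ dU"
    using assms(2) unfolding poly_time_computable_def by blast
  interpret extension_algorithm \<Phi> b c p C d pU CU dU
    by unfold_locales (use assms(1,3,4) ext univ in auto)
  define \<beta> where "\<beta> = 1 + b - 1 / c"
  define D where "D = d + dU + 5"
  have solves: "solves_subset_in \<Phi> subset_prog T"
    if "\<And>I. \<exists>z v. computes subset_prog (enc_bits I) z v \<and> correct I z \<and> real v \<le> T I" for T
    using that unfolding solves_subset_in_def correct_def by meson
  have c1: "1 / c \<le> 1" using c by simp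
  show ?thesis
  proof (cases "\<beta> > 1")
    case False
    \<comment> \<open>As \<beta> is the sum of b \<ge> 1 and 1 - 1/c \<ge> 0, it fails to exceed 1
      only in this degenerate case.\<close>
    then have "b = 1" "1 / c = 1" using b c1 unfolding \<beta>_def by linarith+
    then have "c = 1" by (simp add: field_simps)
    with \<open>b = 1\<close> have \<beta>: "1 + b - 1 / c = 1" by simp
    from unit_cover_index obtain i where i: "valid_cover (decoded i)"
      "cover_weight b c (decoded i) = 1" unfolding \<open>b = 1\<close> \<open>c = 1\<close> by blast
    from subset_prog_time[OF i(1)] obtain K where
      "\<And>I. \<exists>z v. computes subset_prog (enc_bits I) z v \<and> correct I z \<and> real v \<le> K * real (length I + 1) ^ D"
      unfolding i(2) D_def by auto
    then have "solves_subset_in \<Phi> subset_prog (\<lambda>I. K * real (length I + 1) ^ D)" by (rule solves)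
    then show ?thesis unfolding \<beta>
      by (intro exI[of _ subset_prog] exI[of _ K] exI[of _ D] exI[of _ "\<lambda>_. 0"]) simp
  next
    case True
    have bound: "\<exists>K>0. \<forall>I. \<exists>z v. computes subset_prog (enc_bits I) z v \<and> correct I z \<and>
       real v \<le> K * real (length I + 1) ^ D * \<beta> powr ((1 + \<delta>) * real (card (universe \<Phi> I)))" if \<delta>: "\<delta> > 0" for \<delta>
    proof -
      from polynomial_factor_bound[OF True \<delta>] obtain m where m: "(real (Suc m) + 1) ^ 2 \<le> \<beta> powr (\<delta> * real (Suc m))"
        by blast
      from cube_cover_index[OF b c] obtain i where i: "valid_cover (decoded i)"
        "block (decoded i) = Suc m"
        "cover_weight b c (decoded i) \<le> (real (Suc m) + 1) ^ 2 * \<beta> ^ Suc m"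
        unfolding \<beta>_def by blast
      define W where "W = cover_weight b c (decoded i)"
      have W1: "W \<ge> 1" unfolding W_def by (rule cover_weight_ge_1[OF b c i(1)])
      have "W \<le> \<beta> powr (\<delta> * real (Suc m)) * \<beta> powr real (Suc m)"
        using i(3) m True unfolding W_def by (elim order_trans) (simp add: powr_realpow mult_right_mono del: of_nat_Suc power_Suc)
      then have W: "W \<le> \<beta> powr ((1 + \<delta>) * real (Suc m))" by (simp add: algebra_simps flip: powr_add)
      obtain K where K: "K > 0" "\<And>I. \<exists>z v. computes subset_prog (enc_bits I) z v \<and> correct I z \<and>
          real v \<le> K * real (length I + 1) ^ D * W powr (real (card (universe \<Phi> I)) / real (Suc m) + 1)"
        using subset_prog_time[OF i(1)] unfolding D_def W_def i(2) by blast
      \<comment> \<open>The price of the possibly incomplete last block; it is independent of the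
        instance and joins the constant.\<close>
      let ?c = "\<beta> powr ((1 + \<delta>) * real (Suc m))"
      show ?thesis
      proof (intro exI[of _ "K * ?c"] conjI allI)
        show "K * ?c > 0" using K(1) True by simp
        fix I
        let ?n = "real (card (universe \<Phi> I))"
        have "W powr (?n / real (Suc m) + 1) \<le> ?c powr (?n / real (Suc m) + 1)"
          using W W1 by (intro powr_mono2) auto
        also have "\<dots> = \<beta> powr ((1 + \<delta>) * ?n) * ?c"
        proof -
          have "(1 + \<delta>) * real (Suc m) * (?n / real (Suc m) + 1) = (1 + \<delta>) * ?n + (1 + \<delta>) * real (Suc m)"
            by (simp add: distrib_left del: of_nat_Suc)
          then show ?thesis unfolding powr_powr powr_add[symmetric] by (rule arg_cong)
        qed
        finally have le: "W powr (?n / real (Suc m) + 1) \<le> \<beta> powr ((1 + \<delta>) * ?n) * ?c" .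
        from K(2)[of I] obtain z v where v: "computes subset_prog (enc_bits I) z v" "correct I z"
           "real v \<le> K * real (length I + 1) ^ D * W powr (?n / real (Suc m) + 1)" by blast
        note v(3)
        also have "\<dots> \<le> K * real (length I + 1) ^ D * (\<beta> powr ((1 + \<delta>) * ?n) * ?c)"
          using le K(1) by (intro mult_left_mono) auto
        finally show "\<exists>z v. computes subset_prog (enc_bits I) z v \<and> correct I z \<and>
           real v \<le> K * ?c * real (length I + 1) ^ D * \<beta> powr ((1 + \<delta>) * ?n)"
          using v(1,2) by (auto simp: mult_ac)
      qed
    qed
    \<comment> \<open>The output and the running time are fixed before \<delta> varies. By
      determinism, the bounds for all \<delta> speak of this same run.\<close>
    from bound[of 1] have "\<forall>I. \<exists>z v. computes subset_prog (enc_bits I) z v \<and> correct I z" by fastforce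
    then obtain z v where zv: "\<And>I. computes subset_prog (enc_bits I) (z I) (v I)" "\<And>I. correct I (z I)" by metis
    \<comment> \<open>The time left after removing the polynomial factor, cut off at 1 to keep its
      logarithm defined and nonnegative.\<close>
    define \<rho> where "\<rho> I = max 1 (real (v I) / real (length I + 1) ^ D)" for I
    have "\<exists>g. g \<in> o(\<lambda>n. real n) \<and> (\<forall>I. log \<beta> (\<rho> I) - real (card (universe \<Phi> I)) \<le> g (card (universe \<Phi> I)))"
    proof (rule sup_smallo)
      fix \<delta> :: real assume \<delta>: "\<delta> > 0"
      from bound[OF this] obtain K where K: "K > 0" "\<And>I. \<exists>z v. computes subset_prog (enc_bits I) z v \<and> correct I z \<and>
         real v \<le> K * real (length I + 1) ^ D * \<beta> powr ((1 + \<delta>) * real (card (universe \<Phi> I)))" by blast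
      have "log \<beta> (\<rho> I) - real (card (universe \<Phi> I)) \<le> log \<beta> (max 1 K) + \<delta> * real (card (universe \<Phi> I))" for I
      proof -
        let ?n = "real (card (universe \<Phi> I))" and ?N = "real (length I + 1) ^ D"
        from K(2)[of I] have "real (v I) \<le> K * ?N * \<beta> powr ((1 + \<delta>) * ?n)"
          using computes_deterministic[OF zv(1)[of I]] by blast
        also have "\<dots> \<le> max 1 K * ?N * \<beta> powr ((1 + \<delta>) * ?n)"
          by (intro mult_right_mono) auto
        finally have "real (v I) / ?N \<le> max 1 K * \<beta> powr ((1 + \<delta>) * ?n)"
          by (simp add: divide_le_eq mult_ac)
        moreover have "1 * 1 \<le> max 1 K * \<beta> powr ((1 + \<delta>) * ?n)"
          using True \<delta> by (intro mult_mono ge_one_powr_ge_zero) auto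
        ultimately have "\<rho> I \<le> max 1 K * \<beta> powr ((1 + \<delta>) * ?n)" by (simp add: \<rho>_def)
        then have "log \<beta> (\<rho> I) \<le> log \<beta> (max 1 K * \<beta> powr ((1 + \<delta>) * ?n))"
          using True by (subst log_le_cancel_iff) (auto simp: \<rho>_def)
        also have "\<dots> = log \<beta> (max 1 K) + (1 + \<delta>) * ?n"
          using True by (subst log_mult_pos) auto
        finally show ?thesis by (simp add: algebra_simps)
      qed
      then show "\<exists>L. \<forall>I. log \<beta> (\<rho> I) - real (card (universe \<Phi> I)) \<le> L + \<delta> * real (card (universe \<Phi> I))" by blast
    qed
    then obtain g where g: "g \<in> o(\<lambda>n. real n)" "\<And>I. log \<beta> (\<rho> I) - real (card (universe \<Phi> I)) \<le> g (card (universe \<Phi> I))" by blast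
    \<comment> \<open>The constants belonging to the various \<delta> have gone into
      \<open>g\<close>, so the leading constant is 1.\<close>
    have "real (v I) \<le> 1 * \<beta> powr (real (card (universe \<Phi> I)) + g (card (universe \<Phi> I))) * real (length I + 1) ^ D" for I
    proof -
      let ?N = "real (length I + 1) ^ D"
      have "\<rho> I = \<beta> powr log \<beta> (\<rho> I)" using True by (subst powr_log_cancel) (auto simp: \<rho>_def)
      also have "\<dots> \<le> \<beta> powr (real (card (universe \<Phi> I)) + g (card (universe \<Phi> I)))"
        using True g(2)[of I] by (intro powr_mono) auto
      finally have "real (v I) / ?N \<le> \<beta> powr (real (card (universe \<Phi> I)) + g (card (universe \<Phi> I)))" by (simp add: \<rho>_def)
      then show ?thesis by (simp add: divide_le_eq)
    qed
    then have "solves_subset_in \<Phi> subset_prog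
       (\<lambda>I. 1 * \<beta> powr (real (card (universe \<Phi> I)) + g (card (universe \<Phi> I))) * real (length I + 1) ^ D)"
      using zv by (intro solves) blast
    then show ?thesis using g(1) unfolding \<beta>_def by blast
  qed
qed

end
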